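(* Let $M$ be a nilpotent finite-dimensional $\Delta_n$-representation and $X=\mathrm{Gr}_{\mathbf e}(M)$. There is a $\mathbb C$-linear homomorphism of $\mathbb Z$-graded rings $$\rho:{}^0\mathcal H(\mathfrak S_{\underline k})\to\mathrm{End}_{\mathbb C}(H_T^\bullet(X)),\qquad \partial_i\mapsto D_i\quad(i\in[d]\setminus\underline{k'}).$$
   Context: $\Delta_n$ ($n\ge 1$) is the quiver with vertex set $\mathbb Z/n\mathbb Z$ and one arrow $i\to i+1$ for each $i$. A finite-dimensional $\Delta_n$-representation $M$ consists of finite-dimensional $\mathbb C$-vector spaces $M^{(i)}$ and linear maps $M_i:M^{(i)}\to M^{(i+1)}$; it is nilpotent if for some $N$ every composition of $N$ consecutive maps is zero. Every nilpotent $M$ is a direct sum of indecomposables $U_1,\dots,U_d$, where $U_j$ has a basis $b_{j,0},\dots,b_{j,\ell_j-1}$ of vectors at consecutive vertices, with the maps sending $b_{j,p}\mapsto b_{j,p+1}$ and $b_{j,\ell_j-1}\mapsto 0$. Let $B$ be the basis of all $b_{j,p}$. $\mathrm{Gr}_{\mathbf e}(M)$ is the projective variety of subrepresentations of dimension vector $\mathbf e$ (assumed non-empty). The torus $T=(\mathbb C^* )^{d+1}\ni\gamma=(\gamma_0,\dots,\gamma_d)$ acts on $M$ by $\gamma.b_{j,p}=\gamma_0^p\gamma_jb_{j,p}$, inducing an action on $X$; $X^T$ is finite and consists of the subrepresentations spanned by subsets of $B$; there are finitely many one-dimensional $T$-orbits $E$, each closure containing exactly two fixed points, and $\alpha_E$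 denotes the character (up to sign) of $T$ describing the action on $E$. Put $R=H_T^\bullet(\mathrm{pt})=\mathbb C[\delta,\epsilon_1,\dots,\epsilon_d]$ with $\delta(\gamma)=\gamma_0$, $\epsilon_j(\gamma)=\gamma_j$, all of degree $2$. $H_T^\bullet(X)$ (complex coefficients) is identified, by restriction to $X^T$, with $\{(f_L)\in\bigoplus_{L\in X^T}R: f_L-f_{L'}\in\alpha_ER$ for every one-dimensional orbit $E$ with $\overline E=E\cup\{L,L'\}\}$. Number the $U_j$ so that isomorphic summands are consecutive: $k_1,\dots,k_{d_0}$ are the multiplicities of the distinct isomorphism classes, $k_j'=k_1+\dots+k_j$, $k_0'=0$, $\underline{k'}=\{k_1',\dots,k_{d_0}'=d\}$, $[d]=\{1,\dots,d\}$. $\mathfrak S_{\underline k}\subseteq\mathfrak S_d$ is the subgroup stabilising each block $\{k'_{j-1}+1,\dots,k_j'\}$; it is generated by the simple transpositions $\sigma_i=(i,i+1)$, $i\in[d]\setminus\underline{k'}$. $\sigma\in\mathfrak S_{\underline k}$ acts on $M$ by $b_{i,p}\mapsto b_{\sigma^{-1}(i),p}$, hence on $X$; on $R$ by the algebra automorphism with $\sigma(\delta)=\delta$, $\sigma(\epsilon_i)=\epsilon_{\sigma^{-1}(i)}$; and on $H_T^\bullet(X)$ by $\sigma\cdot(f_L)_L=(\sigma(f_{\sigma^{-1}(L)}))_L$ (products of permutations are read left to right so that these are left actions). For $i\in[d]\setminus\underline{k'}$: $\partial_i(a)=\frac{a-\sigma_i(a)}{\epsilon_{i+1}-\epsilon_i}$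 for polynomials $a$, and $D_i(f)=\frac{f-\sigma_i\cdot f}{\epsilon_{i+1}-\epsilon_i}$ for $f\in H_T^\bullet(X)$ (this is again an element of $H_T^\bullet(X)$). The nil Hecke algebra ${}^0\mathcal H(\mathfrak S_{\underline k})$ is the subalgebra of $\mathrm{End}_{\mathbb C}(\mathbb C[\epsilon_1,\dots,\epsilon_d])$ generated by the $\partial_i$, $i\in[d]\setminus\underline{k'}$, graded by $\deg(\partial_i)=-2$. That $\rho$ is graded means that elements of degree $m$ are sent to endomorphisms homogeneous of degree $m$, i.e. mapping $H_T^{q}(X)$ to $H_T^{q+m}(X)$ for all $q$. *)

theory Defs
  imports "HOL-Analysis.Analysis" "HOL-Algebra.Module"
    "HOL-Combinatorics.Transposition" "HOL-Library.Poly_Mapping" "HOL-Library.Function_Algebras"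
begin

section \<open>Representations of the cyclic quiver\<close>

text \<open>The vertex set Z/nZ is represented by \<open>{..<n}\<close>, and the arrow starting at \<open>v\<close> ends at
  \<open>Suc v mod n\<close>. The spaces at the vertices are subspaces of one ambient complex vector space, not
  assumed to be independent of each other, so a vector only has a meaning together with a vertex.\<close>

record 'v cyc_rep =
  nvert :: nat
  sc :: "complex \<Rightarrow> 'v \<Rightarrow> 'v"
  sp :: "nat \<Rightarrow> 'v set"
  ar :: "nat \<Rightarrow> 'v \<Rightarrow> 'v"

definition nxt :: "'v cyc_rep \<Rightarrow> nat \<Rightarrow> nat" where
  "nxt M v = Suc v mod nvert M"

definition lin_on :: "(complex \<Rightarrow> 'v \<Rightarrow> 'v) \<Rightarrow> 'v set \<Rightarrow> 'v set \<Rightarrow> ('v \<Rightarrow> 'v::ab_group_add) \<Rightarrow> bool" where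
  "lin_on s A A' \<phi> \<longleftrightarrow> \<phi> \<in> A \<rightarrow> A' \<and> (\<forall>x\<in>A. \<forall>y\<in>A. \<phi> (x + y) = \<phi> x + \<phi> y)
     \<and> (\<forall>c. \<forall>x\<in>A. \<phi> (s c x) = s c (\<phi> x))"

definition cyclic_rep :: "'v::ab_group_add cyc_rep \<Rightarrow> bool" where
  "cyclic_rep M \<longleftrightarrow> 1 \<le> nvert M \<and> vector_space (sc M)
     \<and> (\<forall>v<nvert M. \<exists>S. finite S \<and> sp M v = Modules.module.span (sc M) S)
     \<and> (\<forall>v<nvert M. lin_on (sc M) (sp M v) (sp M (nxt M v)) (ar M v))"

text \<open>The composition of \<open>N\<close> consecutive maps, the first one starting at \<open>v\<close>.\<close>

fun ar_comp :: "'v cyc_rep \<Rightarrow> nat \<Rightarrow> nat \<Rightarrow> 'v \<Rightarrow> 'v" where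
  "ar_comp M 0 v x = x"
| "ar_comp M (Suc N) v x = ar_comp M N (nxt M v) (ar M v x)"

definition nilpotent_rep :: "'v::ab_group_add cyc_rep \<Rightarrow> bool" where
  "nilpotent_rep M \<longleftrightarrow> (\<exists>N. \<forall>v<nvert M. \<forall>x\<in>sp M v. ar_comp M N v x = 0)"

definition rep_iso :: "'v::ab_group_add cyc_rep \<Rightarrow> (nat \<Rightarrow> 'v set) \<Rightarrow> (nat \<Rightarrow> 'v set) \<Rightarrow> bool" where
  "rep_iso M U U' \<longleftrightarrow> (\<exists>\<phi>. \<forall>v<nvert M.
     lin_on (sc M) (U v) (U' v) (\<phi> v) \<and> bij_betw (\<phi> v) (U v) (U' v)
     \<and> (\<forall>x\<in>U v. \<phi> (nxt M v) (ar M v x) = ar M v (\<phi> v x)))"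

text \<open>A decomposition into indecomposables: \<open>num\<close> summands, the \<open>j\<close>-th one having the basis
  \<open>bv j 0, \<dots>, bv j (len j - 1)\<close> with \<open>bv j 0\<close> at the vertex \<open>st j\<close>. Summands are numbered from 1.\<close>

record 'v seg_basis =
  num :: nat
  st :: "nat \<Rightarrow> nat"
  len :: "nat \<Rightarrow> nat"
  bv :: "nat \<Rightarrow> nat \<Rightarrow> 'v"

definition vtx :: "'v cyc_rep \<Rightarrow> 'v seg_basis \<Rightarrow> nat \<Rightarrow> nat \<Rightarrow> nat" where
  "vtx M B j p = (st B j + p) mod nvert M"

definition idx :: "'v cyc_rep \<Rightarrow> 'v seg_basis \<Rightarrow> nat \<Rightarrow> (nat \<times> nat) set" where
  "idx M B v = {(j, p). 1 \<le> j \<and> j \<le> num B \<and> p < len B j \<and> vtx M B j p = v}"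

definition basis_at :: "'v cyc_rep \<Rightarrow> 'v seg_basis \<Rightarrow> nat \<Rightarrow> 'v set" where
  "basis_at M B v = (\<lambda>(j, p). bv B j p) ` idx M B v"

definition segment_basis :: "'v::ab_group_add cyc_rep \<Rightarrow> 'v seg_basis \<Rightarrow> bool" where
  "segment_basis M B \<longleftrightarrow>
     (\<forall>j\<in>{1..num B}. st B j < nvert M \<and> 1 \<le> len B j)
     \<and> (\<forall>v<nvert M. inj_on (\<lambda>(j, p). bv B j p) (idx M B v)
          \<and> \<not> Modules.module.dependent (sc M) (basis_at M B v)
          \<and> Modules.module.span (sc M) (basis_at M B v) = sp M v)
     \<and> (\<forall>j\<in>{1..num B}. \<forall>p<len B j.
          ar M (vtx M B j p) (bv B j p) = (if Suc p < len B j then bv B j (Suc p) else 0))"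

definition summand :: "'v::ab_group_add cyc_rep \<Rightarrow> 'v seg_basis \<Rightarrow> nat \<Rightarrow> nat \<Rightarrow> 'v set" where
  "summand M B j v = Modules.module.span (sc M) {bv B j p |p. p < len B j \<and> vtx M B j p = v}"

definition partial_sum :: "nat list \<Rightarrow> nat \<Rightarrow> nat" where
  "partial_sum ks j = sum_list (take j ks)"

definition block_ends :: "nat list \<Rightarrow> nat set" where
  "block_ends ks = partial_sum ks ` {1..length ks}"

definition numbered_by :: "'v::ab_group_add cyc_rep \<Rightarrow> 'v seg_basis \<Rightarrow> nat list \<Rightarrow> bool" where
  "numbered_by M B ks \<longleftrightarrow> (\<forall>k\<in>set ks. 1 \<le> k) \<and> sum_list ks = num B
     \<and> (\<forall>i\<in>{1..num B}. \<forall>i'\<in>{1..num B}. rep_iso M (summand M B i) (summand M B i') \<longleftrightarrow>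
          (\<exists>j\<in>{1..length ks}. i \<in> {partial_sum ks (j - 1)<..partial_sum ks j}
             \<and> i' \<in> {partial_sum ks (j - 1)<..partial_sum ks j}))"


section \<open>The quiver Grassmannian and the group actions\<close>

definition Gr :: "'v::ab_group_add cyc_rep \<Rightarrow> (nat \<Rightarrow> nat) \<Rightarrow> (nat \<Rightarrow> 'v set) set" where
  "Gr M e = {L \<in> extensional {..<nvert M}. \<forall>v<nvert M.
     Modules.module.subspace (sc M) (L v) \<and> L v \<subseteq> sp M v
     \<and> vector_space.dim (sc M) (L v) = e v
     \<and> ar M v ` L v \<subseteq> L (nxt M v)}"

text \<open>The linear endomorphism at the vertex \<open>v\<close> sending each \<open>bv j p\<close> to \<open>w j p\<close>.\<close>

definition lin_ext ::
  "'v::ab_group_add cyc_rep \<Rightarrow> 'v seg_basis \<Rightarrow> (nat \<Rightarrow> nat \<Rightarrow> 'v) \<Rightarrow> nat \<Rightarrow> 'v \<Rightarrow> 'v" where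
  "lin_ext M B w v x = (\<Sum>(j, p)\<in>idx M B v.
     sc M (Modules.module.representation (sc M) (basis_at M B v) x (bv B j p)) (w j p))"

definition act_sub ::
  "'v::ab_group_add cyc_rep \<Rightarrow> 'v seg_basis \<Rightarrow> (nat \<Rightarrow> nat \<Rightarrow> 'v) \<Rightarrow> (nat \<Rightarrow> 'v set) \<Rightarrow> nat \<Rightarrow> 'v set" where
  "act_sub M B w L = (\<lambda>v\<in>{..<nvert M}. lin_ext M B w v ` L v)"

definition torus :: "'v seg_basis \<Rightarrow> (nat \<Rightarrow> complex) set" where
  "torus B = {0..num B} \<rightarrow>\<^sub>E (- {0})"

definition torus_act ::
  "'v::ab_group_add cyc_rep \<Rightarrow> 'v seg_basis \<Rightarrow> (nat \<Rightarrow> complex) \<Rightarrow> (nat \<Rightarrow> 'v set) \<Rightarrow> nat \<Rightarrow> 'v set" where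
  "torus_act M B \<gamma> = act_sub M B (\<lambda>j p. sc M (\<gamma> 0 ^ p * \<gamma> j) (bv B j p))"

definition perm_act ::
  "'v::ab_group_add cyc_rep \<Rightarrow> 'v seg_basis \<Rightarrow> (nat \<Rightarrow> nat) \<Rightarrow> (nat \<Rightarrow> 'v set) \<Rightarrow> nat \<Rightarrow> 'v set" where
  "perm_act M B \<sigma> = act_sub M B (\<lambda>j p. bv B (inv_into UNIV \<sigma> j) p)"

definition fixed_points ::
  "'v::ab_group_add cyc_rep \<Rightarrow> 'v seg_basis \<Rightarrow> (nat \<Rightarrow> nat) \<Rightarrow> (nat \<Rightarrow> 'v set) set" where
  "fixed_points M B e = {L \<in> Gr M e. \<forall>\<gamma>\<in>torus B. torus_act M B \<gamma> L = L}"

definition torus_orbits ::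
  "'v::ab_group_add cyc_rep \<Rightarrow> 'v seg_basis \<Rightarrow> (nat \<Rightarrow> nat) \<Rightarrow> (nat \<Rightarrow> 'v set) set set" where
  "torus_orbits M B e = (\<lambda>L. (\<lambda>\<gamma>. torus_act M B \<gamma> L) ` torus B) ` Gr M e"

text \<open>The analytic topology on the Grassmannian, as the quotient topology of the space of frames.
  A frame is given by coordinates: its \<open>k\<close>-th vector at the vertex \<open>v\<close> has the coefficient
  \<open>c v k j p\<close> at \<open>bv j p\<close>. Coefficients outside the relevant ranges are irrelevant. For torus orbits,
  being constructible, the analytic closure is the Zariski closure.\<close>

definition frame_span ::
  "'v::ab_group_add cyc_rep \<Rightarrow> 'v seg_basis \<Rightarrow> (nat \<Rightarrow> nat) \<Rightarrow>
    (nat \<Rightarrow> nat \<Rightarrow> nat \<Rightarrow> nat \<Rightarrow> complex) \<Rightarrow> nat \<Rightarrow> 'v set" where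
  "frame_span M B e c = (\<lambda>v\<in>{..<nvert M}. Modules.module.span (sc M)
     ((\<lambda>k. \<Sum>(j, p)\<in>idx M B v. sc M (c v k j p) (bv B j p)) ` {..<e v}))"

definition frames ::
  "'v::ab_group_add cyc_rep \<Rightarrow> 'v seg_basis \<Rightarrow> (nat \<Rightarrow> nat) \<Rightarrow>
    (nat \<Rightarrow> nat \<Rightarrow> nat \<Rightarrow> nat \<Rightarrow> complex) set" where
  "frames M B e = {c. frame_span M B e c \<in> Gr M e}"

definition Gr_top ::
  "'v::ab_group_add cyc_rep \<Rightarrow> 'v seg_basis \<Rightarrow> (nat \<Rightarrow> nat) \<Rightarrow> (nat \<Rightarrow> 'v set) topology" where
  "Gr_top M B e = topology (\<lambda>U. U \<subseteq> Gr M e \<and>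
     openin (top_of_set (frames M B e)) {c \<in> frames M B e. frame_span M B e c \<in> U})"

lemma openin_Gr_top:
  "openin (Gr_top M B e) U \<longleftrightarrow> U \<subseteq> Gr M e \<and>
     openin (top_of_set (frames M B e)) {c \<in> frames M B e. frame_span M B e c \<in> U}"
proof -
  let ?F = "frames M B e" and ?s = "frame_span M B e"
  have "istopology (\<lambda>U. U \<subseteq> Gr M e \<and> openin (top_of_set ?F) {c \<in> ?F. ?s c \<in> U})"
    unfolding istopology_def
  proof (intro conjI allI impI)
    fix S T
    assume a: "S \<subseteq> Gr M e \<and> openin (top_of_set ?F) {c \<in> ?F. ?s c \<in> S}"
      and b: "T \<subseteq> Gr M e \<and> openin (top_of_set ?F) {c \<in> ?F. ?s c \<in> T}"
    show "S \<inter> T \<subseteq> Gr M e" using a by blast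
    have "{c \<in> ?F. ?s c \<in> S \<inter> T} = {c \<in> ?F. ?s c \<in> S} \<inter> {c \<in> ?F. ?s c \<in> T}" by blast
    then show "openin (top_of_set ?F) {c \<in> ?F. ?s c \<in> S \<inter> T}"
      using a b by (simp only: openin_Int)
  next
    fix K
    assume a: "\<forall>S\<in>K. S \<subseteq> Gr M e \<and> openin (top_of_set ?F) {c \<in> ?F. ?s c \<in> S}"
    show "\<Union>K \<subseteq> Gr M e" using a by blast
    have "{c \<in> ?F. ?s c \<in> \<Union>K} = (\<Union>S\<in>K. {c \<in> ?F. ?s c \<in> S})" by blast
    moreover have "openin (top_of_set ?F) (\<Union>S\<in>K. {c \<in> ?F. ?s c \<in> S})"
      by (rule openin_Union) (use a in blast)
    ultimately show "openin (top_of_set ?F) {c \<in> ?F. ?s c \<in> \<Union>K}" by simp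
  qed
  then show ?thesis
    unfolding Gr_top_def by (subst topology_inverse') auto
qed

text \<open>A torus orbit is a complex manifold, so it is one-dimensional if and only if it is locally
  homeomorphic to the complex plane.\<close>

definition one_dim_orbits ::
  "'v::ab_group_add cyc_rep \<Rightarrow> 'v seg_basis \<Rightarrow> (nat \<Rightarrow> nat) \<Rightarrow> (nat \<Rightarrow> 'v set) set set" where
  "one_dim_orbits M B e = {E \<in> torus_orbits M B e. \<forall>L\<in>E. \<exists>U. \<exists>W::complex set.
     openin (subtopology (Gr_top M B e) E) U \<and> L \<in> U \<and> open W
     \<and> subtopology (Gr_top M B e) U homeomorphic_space top_of_set W}"

text \<open>The character with exponents \<open>a\<close> describes the action on an orbit \<open>E\<close> if \<open>E\<close> is equivariantly
  identified with \<open>C\<^sup>*\<close>, the torus acting there through the character. This determines the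
  character up to inversion, that is, \<open>a\<close> up to sign.\<close>

definition char_val :: "'v seg_basis \<Rightarrow> (nat \<Rightarrow> int) \<Rightarrow> (nat \<Rightarrow> complex) \<Rightarrow> complex" where
  "char_val B a \<gamma> = (\<Prod>i\<le>num B. \<gamma> i powi a i)"

definition orbit_char ::
  "'v::ab_group_add cyc_rep \<Rightarrow> 'v seg_basis \<Rightarrow> (nat \<Rightarrow> nat) \<Rightarrow> (nat \<Rightarrow> 'v set) set \<Rightarrow> (nat \<Rightarrow> int) \<Rightarrow> bool" where
  "orbit_char M B e E a \<longleftrightarrow> (\<exists>\<phi>.
     homeomorphic_map (top_of_set (- {0})) (subtopology (Gr_top M B e) E) \<phi>
     \<and> (\<forall>\<gamma>\<in>torus B. \<forall>z. z \<noteq> 0 \<longrightarrow> torus_act M B \<gamma> (\<phi> z) = \<phi> (char_val B a \<gamma> * z)))"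


section \<open>Polynomials\<close>

text \<open>The variable with index 0 is \<open>\<delta>\<close>, the variable with index \<open>i \<ge> 1\<close> is \<open>\<epsilon>\<^sub>i\<close>.\<close>

type_synonym cpoly = "(nat \<Rightarrow>\<^sub>0 nat) \<Rightarrow>\<^sub>0 complex"

definition pvar :: "nat \<Rightarrow> cpoly" where
  "pvar i = Poly_Mapping.single (Poly_Mapping.single i 1) 1"

definition pconst :: "complex \<Rightarrow> cpoly" where
  "pconst c = Poly_Mapping.single 0 c"

definition polys :: "nat set \<Rightarrow> cpoly set" where
  "polys A = {p. \<forall>m\<in>Poly_Mapping.keys p. Poly_Mapping.keys m \<subseteq> A}"

definition homog :: "int \<Rightarrow> cpoly set" where
  "homog q = {p. \<forall>m\<in>Poly_Mapping.keys p.
     2 * int (\<Sum>i\<in>Poly_Mapping.keys m. Poly_Mapping.lookup m i) = q}"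

definition psubst :: "(nat \<Rightarrow> cpoly) \<Rightarrow> cpoly \<Rightarrow> cpoly" where
  "psubst s p = (\<Sum>m\<in>Poly_Mapping.keys p. pconst (Poly_Mapping.lookup p m) *
     (\<Prod>i\<in>Poly_Mapping.keys m. s i ^ Poly_Mapping.lookup m i))"

definition perm_poly :: "(nat \<Rightarrow> nat) \<Rightarrow> cpoly \<Rightarrow> cpoly" where
  "perm_poly \<sigma> = psubst (\<lambda>i. if i = 0 then pvar 0 else pvar (inv_into UNIV \<sigma> i))"

text \<open>The exact quotient; it is only meaningful if \<open>b \<noteq> 0\<close> divides \<open>a\<close>.\<close>

definition pquot :: "cpoly \<Rightarrow> cpoly \<Rightarrow> cpoly" where
  "pquot a b = (THE c. b * c = a)"


section \<open>Equivariant cohomology\<close>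

definition char_poly :: "'v seg_basis \<Rightarrow> (nat \<Rightarrow> int) \<Rightarrow> cpoly" where
  "char_poly B a = (\<Sum>i\<le>num B. of_int (a i) * pvar i)"

text \<open>The description of equivariant cohomology by restriction to the fixed points.
  Families indexed by the fixed points are extended by 0 to other indices.\<close>

definition HT ::
  "'v::ab_group_add cyc_rep \<Rightarrow> 'v seg_basis \<Rightarrow> (nat \<Rightarrow> nat) \<Rightarrow> ((nat \<Rightarrow> 'v set) \<Rightarrow> cpoly) set" where
  "HT M B e = {f.
     (\<forall>L. L \<notin> fixed_points M B e \<longrightarrow> f L = 0)
     \<and> (\<forall>L\<in>fixed_points M B e. f L \<in> polys {0..num B})
     \<and> (\<forall>E\<in>one_dim_orbits M B e. \<forall>a. \<forall>L\<in>fixed_points M B e. \<forall>L'\<in>fixed_points M B e.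
          orbit_char M B e E a \<and> (Gr_top M B e) closure_of E = E \<union> {L, L'} \<longrightarrow>
          (\<exists>r\<in>polys {0..num B}. f L - f L' = char_poly B a * r))}"

definition HT_deg ::
  "'v::ab_group_add cyc_rep \<Rightarrow> 'v seg_basis \<Rightarrow> (nat \<Rightarrow> nat) \<Rightarrow> int \<Rightarrow> ((nat \<Rightarrow> 'v set) \<Rightarrow> cpoly) set" where
  "HT_deg M B e q = {f \<in> HT M B e. \<forall>L. f L \<in> homog q}"

definition perm_HT ::
  "'v::ab_group_add cyc_rep \<Rightarrow> 'v seg_basis \<Rightarrow> (nat \<Rightarrow> nat) \<Rightarrow> (nat \<Rightarrow> nat) \<Rightarrow>
    ((nat \<Rightarrow> 'v set) \<Rightarrow> cpoly) \<Rightarrow> (nat \<Rightarrow> 'v set) \<Rightarrow> cpoly" where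
  "perm_HT M B e \<sigma> f = (\<lambda>L. if L \<in> fixed_points M B e
     then perm_poly \<sigma> (f (perm_act M B (inv_into UNIV \<sigma>) L)) else 0)"


section \<open>Endomorphism algebras, the nil Hecke algebra and the operators\<close>

definition End_alg :: "(complex \<Rightarrow> 'a \<Rightarrow> 'a) \<Rightarrow> 'a set \<Rightarrow> (complex, 'a \<Rightarrow> 'a::ab_group_add) module" where
  "End_alg s V = \<lparr>carrier = {\<phi> \<in> extensional V. lin_on s V V \<phi>},
     monoid.mult = (\<lambda>\<phi> \<psi>. compose V \<phi> \<psi>), one = (\<lambda>x\<in>V. x),
     zero = (\<lambda>x\<in>V. 0), add = (\<lambda>\<phi> \<psi>. \<lambda>x\<in>V. \<phi> x + \<psi> x),
     smult = (\<lambda>c \<phi>. \<lambda>x\<in>V. s c (\<phi> x))\<rparr>"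

definition End_poly :: "nat \<Rightarrow> (complex, cpoly \<Rightarrow> cpoly) module" where
  "End_poly d = End_alg (\<lambda>c p. pconst c * p) (polys {1..d})"

definition End_HT ::
  "'v::ab_group_add cyc_rep \<Rightarrow> 'v seg_basis \<Rightarrow> (nat \<Rightarrow> nat) \<Rightarrow>
    (complex, ((nat \<Rightarrow> 'v set) \<Rightarrow> cpoly) \<Rightarrow> (nat \<Rightarrow> 'v set) \<Rightarrow> cpoly) module" where
  "End_HT M B e = End_alg (\<lambda>c f L. pconst c * f L) (HT M B e)"

inductive_set gen_subalg :: "(complex, 'a) module \<Rightarrow> 'a set \<Rightarrow> 'a set"
  for A :: "(complex, 'a) module" and S :: "'a set" where
  gen: "x \<in> S \<Longrightarrow> x \<in> gen_subalg A S"
| one: "\<one>\<^bsub>A\<^esub> \<in> gen_subalg A S"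
| add: "x \<in> gen_subalg A S \<Longrightarrow> y \<in> gen_subalg A S \<Longrightarrow> x \<oplus>\<^bsub>A\<^esub> y \<in> gen_subalg A S"
| mult: "x \<in> gen_subalg A S \<Longrightarrow> y \<in> gen_subalg A S \<Longrightarrow> x \<otimes>\<^bsub>A\<^esub> y \<in> gen_subalg A S"
| smult: "x \<in> gen_subalg A S \<Longrightarrow> c \<odot>\<^bsub>A\<^esub> x \<in> gen_subalg A S"

inductive_set lin_span :: "(complex, 'a) module \<Rightarrow> 'a set \<Rightarrow> 'a set"
  for A :: "(complex, 'a) module" and S :: "'a set" where
  base: "x \<in> S \<Longrightarrow> x \<in> lin_span A S"
| zero: "\<zero>\<^bsub>A\<^esub> \<in> lin_span A S"
| add: "x \<in> lin_span A S \<Longrightarrow> y \<in> lin_span A S \<Longrightarrow> x \<oplus>\<^bsub>A\<^esub> y \<in> lin_span A S"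
| smult: "x \<in> lin_span A S \<Longrightarrow> c \<odot>\<^bsub>A\<^esub> x \<in> lin_span A S"

fun gen_words :: "(complex, 'a) module \<Rightarrow> 'a set \<Rightarrow> nat \<Rightarrow> 'a set" where
  "gen_words A S 0 = {\<one>\<^bsub>A\<^esub>}"
| "gen_words A S (Suc r) = {x \<otimes>\<^bsub>A\<^esub> w |x w. x \<in> S \<and> w \<in> gen_words A S r}"

definition simple_idx :: "nat \<Rightarrow> nat list \<Rightarrow> nat set" where
  "simple_idx d ks = {1..d} - block_ends ks"

definition demazure :: "nat \<Rightarrow> nat \<Rightarrow> cpoly \<Rightarrow> cpoly" where
  "demazure d i = (\<lambda>a\<in>polys {1..d}.
     pquot (a - perm_poly (Transposition.transpose i (i + 1)) a) (pvar (i + 1) - pvar i))"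

definition demazure_HT ::
  "'v::ab_group_add cyc_rep \<Rightarrow> 'v seg_basis \<Rightarrow> (nat \<Rightarrow> nat) \<Rightarrow> nat \<Rightarrow>
    ((nat \<Rightarrow> 'v set) \<Rightarrow> cpoly) \<Rightarrow> (nat \<Rightarrow> 'v set) \<Rightarrow> cpoly" where
  "demazure_HT M B e i = (\<lambda>f\<in>HT M B e. \<lambda>L.
     pquot (f L - perm_HT M B e (Transposition.transpose i (i + 1)) f L) (pvar (i + 1) - pvar i))"

definition nil_Hecke :: "nat \<Rightarrow> nat list \<Rightarrow> (complex, cpoly \<Rightarrow> cpoly) module" where
  "nil_Hecke d ks =
     End_poly d\<lparr>carrier := gen_subalg (End_poly d) (demazure d ` simple_idx d ks)\<rparr>"

text \<open>Each generator has degree \<open>-2\<close>. The component is zero unless \<open>m\<close> is even and at most 0.\<close>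

definition nil_Hecke_deg :: "nat \<Rightarrow> nat list \<Rightarrow> int \<Rightarrow> (cpoly \<Rightarrow> cpoly) set" where
  "nil_Hecke_deg d ks m = lin_span (End_poly d)
     (\<Union>r\<in>{r. m = - 2 * int r}. gen_words (End_poly d) (demazure d ` simple_idx d ks) r)"

definition homogeneous_end ::
  "'v::ab_group_add cyc_rep \<Rightarrow> 'v seg_basis \<Rightarrow> (nat \<Rightarrow> nat) \<Rightarrow> int \<Rightarrow>
    (((nat \<Rightarrow> 'v set) \<Rightarrow> cpoly) \<Rightarrow> (nat \<Rightarrow> 'v set) \<Rightarrow> cpoly) \<Rightarrow> bool" where
  "homogeneous_end M B e m \<phi> \<longleftrightarrow> (\<forall>q. \<forall>f\<in>HT_deg M B e q. \<phi> f \<in> HT_deg M B e (q + m))"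

end

theory Submission
  imports Defs
begin

text \<open>
  The nil Hecke operators and the operators \<open>D\<^sub>i\<close> are given by the same expressions
  \<open>\<Sum>\<^sub>w (a\<^sub>w / q) w\<close> in the permutations \<open>w\<close> of isomorphic summands, acting on polynomials and on families
  of polynomials, respectively. Distinct permutations are linearly independent over the polynomials, so an
  element of the nil Hecke algebra determines its coefficients \<open>a\<^sub>w / q\<close> and with them the operator on
  cohomology.

  That \<open>D\<^sub>i\<close> preserves the cohomology rests on two facts about one-dimensional orbits. If
  \<open>\<sigma>\<^sub>i(L) \<noteq> L\<close>, the fixed points \<open>L\<close> and \<open>\<sigma>\<^sub>i(L)\<close> are joined by an orbit with character
  \<open>\<epsilon>\<^sub>i\<^sub>+\<^sub>1 - \<epsilon>\<^sub>i\<close>, namely the pencil which replaces \<open>b\<^sub>i\<^sub>p\<close> by \<open>x b\<^sub>i\<^sub>p + y b\<^sub>i\<^sub>+\<^sub>1\<^sub>p\<close>; this makes the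
  division possible. Conversely, every orbit whose character is a multiple of \<open>\<epsilon>\<^sub>i\<^sub>+\<^sub>1 - \<epsilon>\<^sub>i\<close> is such a
  pencil; for all other orbits the character is coprime to \<open>\<epsilon>\<^sub>i\<^sub>+\<^sub>1 - \<epsilon>\<^sub>i\<close>, and the congruence survives
  the division.
\<close>

section \<open>Polynomials\<close>

text \<open>The nil Hecke algebra is given as an algebra of operators, not by generators and
  relations, so the point at stake is that an expression in the \<open>demazure\<close> operators
  which vanishes on polynomials must vanish on cohomology as well. Fractions are avoided by carrying
  one denominator \<open>q\<close> for a whole expression. It is kept invariant under the group, so
  that it can be moved past every permutation when two expressions are composed.

  A second obstacle is that one-dimensional orbits, their closures and their characters are
  specified topologically, in the quotient topology of the space of frames. A congruence along an
  orbit can be used only after the orbit has been exhibited together with its closure and a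
  homeomorphism that fixes its character. Conversely, an orbit met in a proof is known only through
  some homeomorphism, and the way back to explicit subspaces leads through the subtorus that acts
  trivially on it.\<close>

abbreviation "keys \<equiv> Poly_Mapping.keys"
abbreviation "lookup \<equiv> Poly_Mapping.lookup"

lemma pconst_simps [simp]:
  "pconst 0 = 0" "pconst 1 = 1"
  by (simp_all add: pconst_def)

lemma pconst_add: "pconst (a + b) = pconst a + pconst b"
  by (simp add: pconst_def single_add)

lemma pconst_mult: "pconst (a * b) = pconst a * pconst b"
  by (simp add: pconst_def mult_single)

lemma pconst_minus: "pconst (- a) = - pconst a"
  by (simp add: pconst_def single_uminus)

lemma of_int_eq_pconst: "(of_int k :: cpoly) = pconst (of_int k)"
  by (simp add: pconst_def)

lemma lookup_pconst_mult: "lookup (pconst c * p) m = c * lookup p m"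
proof -
  have "pconst c * p = Poly_Mapping.map ((*) c) p"
    by (simp add: pconst_def mult_map_scale_conv_mult)
  then show ?thesis
    by (simp add: Poly_Mapping.map.rep_eq when_def)
qed

lemma polys_0 [simp]: "0 \<in> polys A"
  by (simp add: polys_def)

lemma polys_pconst [simp]: "pconst c \<in> polys A"
  by (simp add: polys_def pconst_def)

lemma polys_1 [simp]: "1 \<in> polys A"
  using polys_pconst[of 1 A] by simp

lemma polys_pvar [simp]: "pvar i \<in> polys A \<longleftrightarrow> i \<in> A"
  by (simp add: polys_def pvar_def)

lemma polys_add [intro]: "p \<in> polys A \<Longrightarrow> q \<in> polys A \<Longrightarrow> p + q \<in> polys A"
  using Poly_Mapping.keys_add[of p q] by (auto simp: polys_def)

lemma polys_uminus [intro]: "p \<in> polys A \<Longrightarrow> - p \<in> polys A"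
  by (auto simp: polys_def in_keys_iff)

lemma polys_diff [intro]: "p \<in> polys A \<Longrightarrow> q \<in> polys A \<Longrightarrow> p - q \<in> polys A"
  using polys_add[of p A "- q"] by auto

lemma polys_mult [intro]:
  assumes "p \<in> polys A" "q \<in> polys A" shows "p * q \<in> polys A"
  unfolding polys_def
proof (intro CollectI ballI)
  fix m assume "m \<in> keys (p * q)"
  then obtain a b where "m = a + b" "a \<in> keys p" "b \<in> keys q"
    using keys_mult[of p q] by blast
  then show "keys m \<subseteq> A"
    using assms Poly_Mapping.keys_add[of a b] unfolding polys_def by blast
qed

lemma polys_power [intro]: "p \<in> polys A \<Longrightarrow> p ^ k \<in> polys A"
  by (induction k) auto

lemma polys_sum [intro]: "(\<And>x. x \<in> S \<Longrightarrow> f x \<in> polys A) \<Longrightarrow> sum f S \<in> polys A"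
  by (induction S rule: infinite_finite_induct) auto

lemma pvar_power: "pvar i ^ k = Poly_Mapping.single (Poly_Mapping.single i k) 1"
proof (induction k)
  case (Suc k)
  then show ?case by (simp add: pvar_def mult_single single_add[symmetric])
qed simp

lemma single_eq_monomial:
  "Poly_Mapping.single m c = pconst c * (\<Prod>i\<in>keys m. pvar i ^ lookup m i)"
proof -
  have prod: "(\<Prod>i\<in>S. Poly_Mapping.single (g i) (1::complex)) = Poly_Mapping.single (\<Sum>i\<in>S. g i) 1"
    if "finite S" for S and g :: "nat \<Rightarrow> nat \<Rightarrow>\<^sub>0 nat"
    using that by (induction S) (auto simp: mult_single)
  have "(\<Sum>i\<in>keys m. Poly_Mapping.single i (lookup m i)) = m"
    by (rule poly_mapping_eqI) (auto simp: lookup_sum lookup_single when_def in_keys_iff)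
  then show ?thesis
    by (simp add: pvar_power prod pconst_def mult_single)
qed

lemma sum_singles_keys:
  "(\<Sum>m\<in>keys p. Poly_Mapping.single m (lookup p m)) = p"
  by (rule poly_mapping_eqI) (auto simp: lookup_sum lookup_single when_def in_keys_iff)

text \<open>Substitutions respect sums and products, so most of their properties follow from the
  values on constants and variables; this rule then spares arguments about monomials. The membership
  premises make facts available that hold only inside \<open>polys A\<close>.\<close>

lemma polys_induct [consumes 1, case_names pconst pvar add mult]:
  assumes p: "p \<in> polys A"
    and P: "\<And>c. P (pconst c)" "\<And>i. i \<in> A \<Longrightarrow> P (pvar i)"
      "\<And>p q. p \<in> polys A \<Longrightarrow> q \<in> polys A \<Longrightarrow> P p \<Longrightarrow> P q \<Longrightarrow> P (p + q)"
      "\<And>p q. p \<in> polys A \<Longrightarrow> q \<in> polys A \<Longrightarrow> P p \<Longrightarrow> P q \<Longrightarrow> P (p * q)"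
  shows "P p"
proof -
  let ?Q = "\<lambda>p. p \<in> polys A \<and> P p"
  have pow: "?Q (pvar i ^ k)" if "i \<in> A" for i k
    using P(1)[of 1] that by (induction k) (auto intro: P)
  have prod: "?Q (\<Prod>i\<in>S. pvar i ^ g i)" if "finite S" "S \<subseteq> A" for S and g :: "nat \<Rightarrow> nat"
    using that
  proof (induction S)
    case empty
    then show ?case using P(1)[of 1] by simp
  next
    case (insert i S)
    then have "?Q (\<Prod>i\<in>S. pvar i ^ g i)" "?Q (pvar i ^ g i)" using pow by auto
    then have "?Q (pvar i ^ g i * (\<Prod>i\<in>S. pvar i ^ g i))" by (auto intro!: P(4))
    then show ?case using insert by simp
  qed
  have single: "?Q (Poly_Mapping.single m c)" if "m \<in> keys p" for m c
  proof -
    have "?Q (\<Prod>i\<in>keys m. pvar i ^ lookup m i)"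
      using that p by (intro prod) (auto simp: polys_def)
    then show ?thesis
      unfolding single_eq_monomial[of m c] using P(1)[of c] by (intro conjI P(4)) (auto intro: polys_mult)
  qed
  have "?Q (\<Sum>m\<in>S. Poly_Mapping.single m (lookup p m))"
    if "finite S" "S \<subseteq> keys p" for S
    using that
  proof (induction S)
    case empty
    then show ?case using P(1)[of 0] by simp
  next
    case (insert m S)
    then show ?case using P(3) single by (simp add: polys_add)
  qed
  from this[of "keys p"] show ?thesis
    by (simp add: sum_singles_keys)
qed

lemma polys_UNIV [simp]: "p \<in> polys UNIV"
  by (simp add: polys_def)

subsection \<open>Substitution\<close>

lemma psubst_add: "psubst s (p + q) = psubst s p + psubst s q"
  unfolding psubst_def by (rule setsum_keys_plus_distrib) (auto simp: pconst_add algebra_simps)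

lemma psubst_0 [simp]: "psubst s 0 = 0"
  by (simp add: psubst_def)

lemma psubst_sum: "psubst s (sum f S) = (\<Sum>x\<in>S. psubst s (f x))"
  by (induction S rule: infinite_finite_induct) (auto simp: psubst_add)

lemma psubst_single: "psubst s (Poly_Mapping.single m c) =
    pconst c * (\<Prod>i\<in>keys m. s i ^ lookup m i)"
  by (cases "c = 0") (simp_all add: psubst_def)

lemma psubst_pconst [simp]: "psubst s (pconst c) = pconst c"
  unfolding pconst_def by (subst psubst_single) (simp add: pconst_def)

lemma psubst_1 [simp]: "psubst s 1 = 1"
  using psubst_pconst[of s 1] by simp

lemma psubst_pvar [simp]: "psubst s (pvar i) = s i"
  unfolding pvar_def by (subst psubst_single) (simp add: pconst_def)

lemma monomial_add:
  fixes s :: "nat \<Rightarrow> cpoly"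
  shows "(\<Prod>i\<in>keys (m + m'). s i ^ lookup (m + m') i) =
    (\<Prod>i\<in>keys m. s i ^ lookup m i) *
    (\<Prod>i\<in>keys m'. s i ^ lookup m' i)"
proof -
  let ?K = "keys m \<union> keys m'"
  have ext: "(\<Prod>i\<in>keys k. s i ^ lookup k i) =
      (\<Prod>i\<in>?K. s i ^ lookup k i)" if "keys k \<subseteq> ?K" for k
    using that by (intro prod.mono_neutral_left) (auto simp: in_keys_iff)
  show ?thesis
    using Poly_Mapping.keys_add[of m m']
    by (subst (1 2 3) ext) (auto simp: lookup_add power_add prod.distrib)
qed

lemma psubst_mult: "psubst s (p * q) = psubst s p * psubst s q"
proof -
  have single: "psubst s (Poly_Mapping.single m c * Poly_Mapping.single m' c') =
      psubst s (Poly_Mapping.single m c) * psubst s (Poly_Mapping.single m' c')" for m m' c c'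
    by (simp add: mult_single psubst_single monomial_add pconst_mult)
  let ?S = "\<lambda>p. \<Sum>m\<in>keys p. Poly_Mapping.single m (lookup p m)"
  have "psubst s (?S p * ?S q) = psubst s (?S p) * psubst s (?S q)"
    by (simp add: sum_product psubst_sum single)
  then show ?thesis by (simp add: sum_singles_keys)
qed

lemma psubst_power: "psubst s (p ^ k) = psubst s p ^ k"
  by (induction k) (auto simp: psubst_mult)

lemma psubst_prod: "psubst s (prod f S) = (\<Prod>x\<in>S. psubst s (f x))"
  by (induction S rule: infinite_finite_induct) (auto simp: psubst_mult)

lemma psubst_uminus: "psubst s (- p) = - psubst s p"
  using psubst_add[of s p "- p"] by (simp add: eq_neg_iff_add_eq_0 add.commute)

lemma psubst_diff: "psubst s (p - q) = psubst s p - psubst s q"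
  using psubst_add[of s p "- q"] by (simp add: psubst_uminus)

lemma psubst_in_polys:
  assumes "p \<in> polys A" "\<And>i. i \<in> A \<Longrightarrow> s i \<in> polys A'"
  shows "psubst s p \<in> polys A'"
  using assms(1) by (induction p rule: polys_induct) (auto simp: assms(2) psubst_add psubst_mult)

lemma psubst_psubst: "psubst s (psubst t p) = psubst (\<lambda>i. psubst s (t i)) p"
  using polys_UNIV[of p] by (induction p rule: polys_induct) (auto simp: psubst_add psubst_mult)

lemma psubst_id: "psubst pvar p = p"
  using polys_UNIV[of p] by (induction p rule: polys_induct) (auto simp: psubst_add psubst_mult)

text \<open>The polynomials congruent to their image modulo \<open>b\<close> are closed under sums
  and products, so the variables decide. Two instances matter: a transposition modulo the difference
  of the exchanged variables, and the elimination of a variable modulo a linear form.\<close>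

lemma psubst_cong_mod:
  assumes p: "p \<in> polys A"
    and s: "\<And>i. i \<in> A \<Longrightarrow> s i \<in> polys A \<and> (\<exists>r\<in>polys A. pvar i - s i = b * r)"
  shows "\<exists>r\<in>polys A. p - psubst s p = b * r"
  using p
proof (induction p rule: polys_induct)
  case (pconst c)
  then show ?case by (intro bexI[of _ 0]) auto
next
  case (pvar i)
  then show ?case using s by simp
next
  case (add p q)
  then obtain r r' where "r \<in> polys A" "p - psubst s p = b * r" "r' \<in> polys A" "q - psubst s q = b * r'"
    by blast
  then show ?case
    by (intro bexI[of _ "r + r'"]) (auto simp: psubst_add distrib_left add_diff_add)
next
  case (mult p q)
  then obtain r r' where r: "r \<in> polys A" "p - psubst s p = b * r" "r' \<in> polys A" "q - psubst s q = b * r'"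
    by blast
  have "p * q - psubst s (p * q) = (p - psubst s p) * q + psubst s p * (q - psubst s q)"
    by (simp add: psubst_mult algebra_simps)
  also have "\<dots> = b * (r * q + psubst s p * r')"
    by (simp only: r) (simp add: algebra_simps)
  finally show ?case
    using r mult psubst_in_polys[OF mult(1), of s A] s by (intro bexI[of _ "r * q + psubst s p * r'"]) auto
qed

subsection \<open>Linear forms\<close>

lemma single_one_eq_iff: "Poly_Mapping.single i (1::nat) = Poly_Mapping.single j 1 \<longleftrightarrow> i = j"
proof
  assume "Poly_Mapping.single i (1::nat) = Poly_Mapping.single j 1"
  then have "keys (Poly_Mapping.single i (1::nat)) = keys (Poly_Mapping.single j (1::nat))"
    by (rule arg_cong)
  then show "i = j" by simp
qed simp

lemma lookup_linear_form:
  assumes "finite I" "j \<in> I"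
  shows "lookup (\<Sum>i\<in>I. pconst (c i) * pvar i) (Poly_Mapping.single j 1) = c j"
proof -
  have "lookup (pconst (c i) * pvar i) (Poly_Mapping.single j 1) = (if i = j then c i else 0)" for i
    by (simp add: lookup_pconst_mult pvar_def lookup_single when_def single_one_eq_iff del: One_nat_def)
  then show ?thesis using assms by (simp add: lookup_sum)
qed

lemma pvar_eq_iff [simp]: "pvar i = pvar j \<longleftrightarrow> i = j"
proof
  assume "pvar i = pvar j"
  then have "lookup (pvar i) (Poly_Mapping.single i 1) = lookup (pvar j) (Poly_Mapping.single i 1)"
    by simp
  then show "i = j"
    by (simp add: pvar_def lookup_single when_def single_one_eq_iff del: One_nat_def split: if_splits)
qed simp

text \<open>Primality of a linear form: it divides exactly the polynomials killed by solving it for one variable.\<close>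

lemma linear_form_dvd_cancel:
  fixes c :: "nat \<Rightarrow> complex" and d :: nat
  defines "\<alpha> \<equiv> \<Sum>i\<le>d. pconst (c i) * pvar i"
  assumes i: "i < d"
    and np: "(\<exists>j\<le>d. j \<noteq> i \<and> j \<noteq> Suc i \<and> c j \<noteq> 0) \<or> c i + c (Suc i) \<noteq> 0 \<or> (\<forall>j\<le>d. c j = 0)"
    and h: "h \<in> polys {0..d}" and eq: "(pvar (Suc i) - pvar i) * h = \<alpha> * r"
  shows "\<exists>r'\<in>polys {0..d}. h = \<alpha> * r'"
proof (cases "\<forall>j\<le>d. c j = 0")
  case True
  then have "\<alpha> = 0" by (simp add: \<alpha>_def)
  then have "h = 0" using eq by simp
  then show ?thesis by (intro bexI[of _ 0]) auto
next
  case False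
  \<comment> \<open>The variable to be solved for must keep the difference of the variables
    \<open>i\<close> and \<open>Suc i\<close> alive. A \<open>k\<close> outside the two leaves both
    in place; if \<open>k\<close> is one of them, they become equal only if the other coefficient is
    \<open>- c k\<close>.\<close>
  have "\<exists>k\<le>d. c k \<noteq> 0 \<and> (k \<noteq> i \<and> k \<noteq> Suc i \<or> c i + c (Suc i) \<noteq> 0)"
    using np False by auto
  then obtain k where k: "k \<le> d" "c k \<noteq> 0" "k \<noteq> i \<and> k \<noteq> Suc i \<or> c i + c (Suc i) \<noteq> 0" by blast
  \<comment> \<open>The solution of \<open>\<alpha> = 0\<close> for the variable
    \<open>k\<close>.\<close>
  let ?x = "\<Sum>j\<in>{..d}. pconst ((if j = k then 0 else - c j / c k)) * pvar j"
  define s where "s = (\<lambda>j. if j = k then ?x else pvar j)"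
  have x: "pconst (c k) * ?x = pconst (c k) * pvar k - \<alpha>"
  proof -
    have "pconst (c k) * ?x = (\<Sum>j\<in>{..d}. (if j = k then pconst (c k) * pvar k else 0) - pconst (c j) * pvar j)"
      unfolding sum_distrib_left
      by (intro sum.cong) (auto simp: mult.assoc[symmetric] pconst_mult[symmetric] pconst_minus k)
    then show ?thesis using k by (simp add: sum_subtractf \<alpha>_def)
  qed
  have inv: "pconst (1 / c k) * pconst (c k) = 1"
    using k by (simp add: pconst_mult[symmetric])
  have "pvar k - ?x = pconst (1 / c k) * pconst (c k) * (pvar k - ?x)" by (simp only: inv) simp
  also have "\<dots> = \<alpha> * pconst (1 / c k)"
    unfolding mult.assoc right_diff_distrib[of "pconst (c k)"] x by (simp add: mult.commute)
  finally have diff: "pvar k - ?x = \<alpha> * pconst (1 / c k)" .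
  have cong: "\<exists>r\<in>polys {0..d}. p - psubst s p = \<alpha> * r" if "p \<in> polys {0..d}" for p
    using that
  proof (rule psubst_cong_mod)
    fix j assume "j \<in> {0..d}"
    then show "s j \<in> polys {0..d} \<and> (\<exists>r\<in>polys {0..d}. pvar j - s j = \<alpha> * r)"
    proof (cases "j = k")
      case True
      then show ?thesis using diff k(1)
        by (auto simp: s_def intro!: bexI[of _ "pconst (1 / c k)"] polys_sum polys_mult)
    next
      case False
      then show ?thesis using \<open>j \<in> {0..d}\<close> by (auto simp: s_def intro!: bexI[of _ 0])
    qed
  qed
  have "psubst s \<alpha> = (\<Sum>j\<in>{..d}. pconst (c j) * pvar j + (if j = k then pconst (c k) * ?x - pconst (c k) * pvar k else 0))"
    unfolding \<alpha>_def psubst_sum by (intro sum.cong) (auto simp: psubst_mult s_def)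
  also have "\<dots> = 0" unfolding x using k(1) by (simp add: sum.distrib \<alpha>_def)
  finally have s\<alpha>: "psubst s \<alpha> = 0" .
  have "psubst s (pvar (Suc i) - pvar i) \<noteq> 0"
  proof
    assume "psubst s (pvar (Suc i) - pvar i) = 0"
    then have ss: "s (Suc i) = s i" by (simp add: psubst_diff)
    have l: "lookup ?x (Poly_Mapping.single j 1) = (if j = k then 0 else - c j / c k)" if "j \<le> d" for j
      using that by (subst lookup_linear_form) auto
    consider "k \<noteq> i" "k \<noteq> Suc i" | "k = i" | "k = Suc i" by blast
    then show False
    proof cases
      case 1
      then show False using ss by (simp add: s_def)
    next
      case 2
      then have "?x = pvar (Suc i)" using ss by (simp add: s_def)
      then have "- c (Suc i) / c k = 1"
        using l[of "Suc i"] i 2 by (simp add: pvar_def)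
      then show False using k 2 by (simp add: field_simps eq_neg_iff_add_eq_0 neg_eq_iff_add_eq_0 add.commute)
    next
      case 3
      then have "?x = pvar i" using ss by (simp add: s_def)
      then have "- c i / c k = 1"
        using l[of i] i 3 by (simp add: pvar_def)
      then show False using k 3 by (simp add: field_simps eq_neg_iff_add_eq_0 neg_eq_iff_add_eq_0 add.commute)
    qed
  qed
  moreover have "psubst s (pvar (Suc i) - pvar i) * psubst s h = 0"
    using arg_cong[OF eq, of "psubst s"] by (simp add: psubst_mult s\<alpha>)
  ultimately have "psubst s h = 0" by simp
  then show ?thesis using cong[OF h] by simp
qed

subsection \<open>Degrees\<close>

lemma homog_0 [simp]: "0 \<in> homog q"
  by (simp add: homog_def)

lemma homog_add [intro]: "a \<in> homog q \<Longrightarrow> b \<in> homog q \<Longrightarrow> a + b \<in> homog q"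
  using Poly_Mapping.keys_add[of a b] by (auto simp: homog_def)

lemma homog_uminus [intro]: "a \<in> homog q \<Longrightarrow> - a \<in> homog q"
  by (auto simp: homog_def in_keys_iff)

lemma homog_diff [intro]: "a \<in> homog q \<Longrightarrow> b \<in> homog q \<Longrightarrow> a - b \<in> homog q"
  using homog_add[of a q "- b"] by auto

lemma homog_sum [intro]: "(\<And>x. x \<in> S \<Longrightarrow> f x \<in> homog q) \<Longrightarrow> sum f S \<in> homog q"
  by (induction S rule: infinite_finite_induct) auto

abbreviation mdeg :: "(nat \<Rightarrow>\<^sub>0 nat) \<Rightarrow> nat" where
  "mdeg m \<equiv> (\<Sum>i\<in>keys m. lookup m i)"

lemma mdeg_add: "mdeg (m + m') = mdeg m + mdeg m'"
  by (rule setsum_keys_plus_distrib) auto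

lemma homog_mult [intro]:
  assumes "a \<in> homog q" "b \<in> homog q'" shows "a * b \<in> homog (q + q')"
  unfolding homog_def
proof (intro CollectI ballI)
  fix m assume "m \<in> keys (a * b)"
  then obtain x y where "m = x + y" "x \<in> keys a" "y \<in> keys b"
    using keys_mult[of a b] by blast
  then show "2 * int (mdeg m) = q + q'"
    using assms mdeg_add[of x y] by (auto simp: homog_def)
qed

lemma homog_pconst [simp]: "pconst c \<in> homog 0"
  by (simp add: homog_def pconst_def)

lemma homog_pvar [simp]: "pvar i \<in> homog 2"
  by (simp add: homog_def pvar_def)

lemma homog_power: "a \<in> homog 2 \<Longrightarrow> a ^ k \<in> homog (2 * int k)"
proof (induction k)
  case 0
  then show ?case using homog_pconst[of 1] by simp
next
  case (Suc k)
  then have "a * a ^ k \<in> homog (2 + 2 * int k)" by blast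
  then show ?case by (simp add: algebra_simps)
qed

lemma homog_psubst:
  assumes "p \<in> homog q" "\<And>i. s i \<in> homog 2"
  shows "psubst s p \<in> homog q"
  unfolding psubst_def
proof (rule homog_sum)
  fix m assume m: "m \<in> keys p"
  have "(\<Prod>i\<in>S. s i ^ lookup m i) \<in> homog (2 * int (\<Sum>i\<in>S. lookup m i))"
    if "finite S" for S
    using that
  proof (induction S)
    case empty
    then show ?case using homog_pconst[of 1] by simp
  next
    case (insert x S)
    then have "s x ^ lookup m x * (\<Prod>i\<in>S. s i ^ lookup m i)
        \<in> homog (2 * int (lookup m x) + 2 * int (\<Sum>i\<in>S. lookup m i))"
      using homog_power[OF assms(2)] by blast
    then show ?case using insert by (simp add: algebra_simps)
  qed
  moreover have "2 * int (mdeg m) = q"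
    using m assms(1) unfolding homog_def by blast
  ultimately have "pconst (lookup p m) * (\<Prod>i\<in>keys m. s i ^ lookup m i) \<in> homog (0 + q)"
    using homog_mult[OF homog_pconst] finite_keys by metis
  then
  show "pconst (lookup p m) * (\<Prod>i\<in>keys m. s i ^ lookup m i) \<in> homog q"
    by simp
qed

text \<open>Split \<open>c\<close> into its part of degree \<open>q - 2\<close> and the rest; the product of \<open>b\<close> with
  the rest has degree \<open>q\<close> and no monomial of degree \<open>q\<close>.\<close>

lemma homog_cancel:
  assumes b: "b \<in> homog 2" "b \<noteq> 0" and bc: "b * c \<in> homog q"
  shows "c \<in> homog (q - 2)"
proof -
  let ?s = "\<lambda>m. Poly_Mapping.single m (lookup c m)"
  define K where "K = {m \<in> keys c. 2 * int (mdeg m) = q - 2}"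
  define c1 where "c1 = sum ?s K"
  define c2 where "c2 = sum ?s (keys c - K)"
  have c: "c = c1 + c2"
    unfolding c1_def c2_def
    using sum.subset_diff[of K "keys c" ?s] sum_singles_keys[of c]
    by (simp add: K_def add.commute)
  have c1: "c1 \<in> homog (q - 2)"
    unfolding c1_def by (rule homog_sum) (auto simp: homog_def K_def split: if_splits)
  have k2: "keys c2 \<subseteq> keys c - K"
    unfolding c2_def using keys_sum[of ?s "keys c - K"] by (auto split: if_splits)
  have "b * c2 = b * c - b * c1" by (simp add: c algebra_simps)
  then have "b * c2 \<in> homog q" using homog_diff[OF bc] homog_mult[OF b(1) c1] by simp
  moreover have "2 * int (mdeg m) \<noteq> q" if mk: "m \<in> keys (b * c2)" for m
  proof -
    obtain x y where m: "m = x + y" "x \<in> keys b" "y \<in> keys c2"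
      using subsetD[OF keys_mult mk] by blast
    then have "2 * int (mdeg x) = 2" "2 * int (mdeg y) \<noteq> q - 2"
      using b(1) k2 by (auto simp: homog_def K_def)
    then show ?thesis using mdeg_add[of x y] m by simp
  qed
  ultimately have "keys (b * c2) = {}"
    unfolding homog_def by blast
  then have "b * c2 = 0" by (simp only: keys_eq_empty)
  then show ?thesis using b c c1 by simp
qed

lemma pquot_eq: "b \<noteq> 0 \<Longrightarrow> b * c = a \<Longrightarrow> pquot a b = c"
  unfolding pquot_def by (rule the_equality) auto

section \<open>Coordinates with respect to a segment basis\<close>

locale seg_rep =
  fixes M :: "'v::ab_group_add cyc_rep" and B :: "'v seg_basis"
  assumes cyc: "cyclic_rep M" and seg: "segment_basis M B"
begin

sublocale vs: vector_space "sc M"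
  using cyc by (simp add: cyclic_rep_def)

abbreviation "DH \<equiv> demazure_HT M B"
abbreviation "EndH \<equiv> End_HT M B"
abbreviation "Hdeg \<equiv> HT_deg M B"
abbreviation "H \<equiv> HT M B"
abbreviation "Fix \<equiv> fixed_points M B"
abbreviation "Orb1 \<equiv> one_dim_orbits M B"
abbreviation "Orb \<equiv> torus_orbits M B"
abbreviation "ochar \<equiv> orbit_char M B"
abbreviation "Top \<equiv> Gr_top M B"
abbreviation "fspan \<equiv> frame_span M B"
abbreviation "Frm \<equiv> frames M B"
abbreviation "homEnd \<equiv> homogeneous_end M B"
abbreviation "tact \<equiv> torus_act M B"
abbreviation "lext \<equiv> lin_ext M B"
abbreviation "ix \<equiv> idx M B"
abbreviation "vx \<equiv> vtx M B"
abbreviation "nv \<equiv> nvert M"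

text \<open>Coordinates are total functions of \<open>j\<close> and \<open>p\<close>, which spares
  side conditions when computing with them. Only the values on \<open>ix v\<close> matter, and only
  these can be recovered from the vector.\<close>

definition vec :: "nat \<Rightarrow> (nat \<Rightarrow> nat \<Rightarrow> complex) \<Rightarrow> 'v" where
  "vec v c = (\<Sum>(j, p)\<in>ix v. sc M (c j p) (bv B j p))"

definition co :: "nat \<Rightarrow> 'v \<Rightarrow> nat \<Rightarrow> nat \<Rightarrow> complex" where
  "co v x j p = vs.representation (basis_at M B v) x (bv B j p)"

lemma nvert_pos: "0 < nv"
  using cyc by (simp add: cyclic_rep_def)

lemma nxt_less [simp]: "nxt M v < nv"
  using nvert_pos by (simp add: nxt_def)

lemma vtx_less [simp]: "vx j p < nv"
  using nvert_pos by (simp add: vtx_def)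

lemma vtx_Suc: "vx j (Suc p) = nxt M (vx j p)"
  by (simp add: vtx_def nxt_def mod_Suc_eq)

lemma vtx_Suc_eq_nxt_iff:
  assumes "v < nv" shows "vx j (Suc p) = nxt M v \<longleftrightarrow> vx j p = v"
proof
  assume "vx j (Suc p) = nxt M v"
  then have "Suc (vx j p) mod nv = Suc v mod nv"
    by (simp add: vtx_Suc nxt_def)
  then show "vx j p = v"
    using assms vtx_less[of j p] by (auto simp: mod_Suc split: if_splits)
qed (simp add: vtx_Suc)

lemma idx_iff: "(j, p) \<in> ix v \<longleftrightarrow> 1 \<le> j \<and> j \<le> num B \<and> p < len B j \<and> vx j p = v"
  by (simp add: idx_def)

lemma finite_idx [simp]: "finite (ix v)"
proof (rule finite_subset)
  show "ix v \<subseteq> Sigma {1..num B} (\<lambda>j. {..<len B j})" by (auto simp: idx_def)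
qed simp

lemma inj_bv: "v < nv \<Longrightarrow> inj_on (\<lambda>(j, p). bv B j p) (ix v)"
  using seg by (simp add: segment_basis_def)

lemma independent_basis_at: "v < nv \<Longrightarrow> vs.independent (basis_at M B v)"
  using seg by (simp add: segment_basis_def)

lemma span_basis_at: "v < nv \<Longrightarrow> vs.span (basis_at M B v) = sp M v"
  using seg by (simp add: segment_basis_def)

lemma finite_basis_at [simp]: "finite (basis_at M B v)"
  by (simp add: basis_at_def)

lemma subspace_sp: "v < nv \<Longrightarrow> vs.subspace (sp M v)"
  by (metis span_basis_at vs.subspace_span)

lemma bv_in_sp: "(j, p) \<in> ix v \<Longrightarrow> v < nv \<Longrightarrow> bv B j p \<in> sp M v"
  unfolding span_basis_at[symmetric] by (rule vs.span_base) (auto simp: basis_at_def)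

lemma vec_in_sp [simp]: "v < nv \<Longrightarrow> vec v c \<in> sp M v"
  unfolding vec_def
  by (rule vs.subspace_sum) (auto intro: subspace_sp vs.subspace_scale bv_in_sp)

lemma co_vec:
  assumes v: "v < nv" and jp: "(j, p) \<in> ix v"
  shows "co v (vec v c) j p = c j p"
proof -
  let ?h = "\<lambda>(j, p). bv B j p"
  let ?r = "\<lambda>y. if y \<in> basis_at M B v then case_prod c (inv_into (ix v) ?h y) else 0"
  have r: "?r (bv B j p) = c j p" if "(j, p) \<in> ix v" for j p
    using inv_into_f_f[OF inj_bv[OF v] that] that by (auto simp: basis_at_def)
  have "vs.representation (basis_at M B v) (vec v c) = ?r"
  proof (rule vs.representation_eqI)
    show "vs.independent (basis_at M B v)" using v by (rule independent_basis_at)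
    show "vec v c \<in> vs.span (basis_at M B v)" using v by (simp add: span_basis_at)
    have "{b. ?r b \<noteq> 0} \<subseteq> basis_at M B v" by auto
    then show fin: "finite {b. ?r b \<noteq> 0}" by (rule finite_subset) simp
    have "(\<Sum>b | ?r b \<noteq> 0. sc M (?r b) b) = (\<Sum>b\<in>basis_at M B v. sc M (?r b) b)"
      by (rule sum.mono_neutral_left) auto
    also have "\<dots> = (\<Sum>x\<in>ix v. sc M (?r (?h x)) (?h x))"
      unfolding basis_at_def by (subst sum.reindex[OF inj_bv[OF v]]) simp
    also have "\<dots> = vec v c"
      unfolding vec_def
    proof (rule sum.cong[OF refl])
      fix x assume x: "x \<in> ix v"
      obtain a b where "x = (a, b)" by (cases x)
      with x r[of a b] show "sc M (?r (?h x)) (?h x) = (case x of (j, p) \<Rightarrow> sc M (c j p) (bv B j p))"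
        by (simp only: prod.case)
    qed
    finally show "(\<Sum>b | ?r b \<noteq> 0. sc M (?r b) b) = vec v c" .
  qed (simp split: if_splits)
  then show ?thesis using r[OF jp] by (simp add: co_def)
qed

lemma vec_co:
  assumes v: "v < nv" and x: "x \<in> sp M v"
  shows "vec v (co v x) = x"
proof -
  have "x = (\<Sum>b\<in>basis_at M B v. sc M (vs.representation (basis_at M B v) x b) b)"
    using vs.sum_representation_eq[OF independent_basis_at[OF v], of x "basis_at M B v"] x
    by (simp add: span_basis_at[OF v])
  also have "\<dots> = vec v (co v x)"
    unfolding vec_def co_def basis_at_def
    by (subst sum.reindex[OF inj_bv[OF v]]) (auto intro: sum.cong)
  finally show ?thesis by simp
qed

lemma vec_cong: "(\<And>j p. (j, p) \<in> ix v \<Longrightarrow> c j p = c' j p) \<Longrightarrow> vec v c = vec v c'"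
  unfolding vec_def by (rule sum.cong) auto

lemma vec_eqD: "vec v c = vec v c' \<Longrightarrow> v < nv \<Longrightarrow> (j, p) \<in> ix v \<Longrightarrow> c j p = c' j p"
  by (metis co_vec)

lemma sp_obtain_vec:
  assumes "v < nv" "x \<in> sp M v" obtains c where "x = vec v c"
  using vec_co[OF assms] by metis

lemma vec_add: "vec v c + vec v c' = vec v (\<lambda>j p. c j p + c' j p)"
  by (simp add: vec_def sum.distrib[symmetric] vs.scale_left_distrib case_prod_unfold)

lemma vec_scale: "sc M a (vec v c) = vec v (\<lambda>j p. a * c j p)"
  by (simp add: vec_def vs.scale_sum_right case_prod_unfold)

lemma vec_0 [simp]: "vec v (\<lambda>j p. 0) = 0"
  by (simp add: vec_def)

lemma vec_sum: "(\<Sum>x\<in>S. vec v (c x)) = vec v (\<lambda>j p. \<Sum>x\<in>S. c x j p)"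
  by (induction S rule: infinite_finite_induct) (auto simp: vec_add)

definition unit_co :: "nat \<Rightarrow> nat \<Rightarrow> nat \<Rightarrow> nat \<Rightarrow> complex" where
  "unit_co j p j' p' = (if j' = j \<and> p' = p then 1 else 0)"

lemma vec_unit_co:
  assumes "(j, p) \<in> ix v" shows "vec v (unit_co j p) = bv B j p"
proof -
  have "vec v (unit_co j p) = (\<Sum>x\<in>ix v. if x = (j, p) then bv B j p else 0)"
    unfolding vec_def by (rule sum.cong) (auto simp: unit_co_def split: if_splits)
  then show ?thesis using assms by simp
qed

lemma lin_on_sum:
  assumes "lin_on (sc M) A A' \<phi>" "vs.subspace A" "finite S" "\<And>x. x \<in> S \<Longrightarrow> f x \<in> A"
  shows "\<phi> (\<Sum>x\<in>S. sc M (r x) (f x)) = (\<Sum>x\<in>S. sc M (r x) (\<phi> (f x)))"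
  using assms(3,4)
proof (induction S)
  case empty
  have "0 \<in> A" using assms(2) by (rule vs.subspace_0)
  then have "\<phi> (sc M 0 0) = sc M 0 (\<phi> 0)" using assms(1) unfolding lin_on_def by blast
  then show ?case by simp
next
  case (insert x S)
  have "sc M (r x) (f x) \<in> A" "(\<Sum>x\<in>S. sc M (r x) (f x)) \<in> A"
    using insert assms(2) by (auto intro: vs.subspace_sum vs.subspace_scale)
  then have "\<phi> (sc M (r x) (f x) + (\<Sum>x\<in>S. sc M (r x) (f x))) = \<phi> (sc M (r x) (f x)) + \<phi> (\<Sum>x\<in>S. sc M (r x) (f x))"
    using assms(1) unfolding lin_on_def by blast
  moreover have "\<phi> (sc M (r x) (f x)) = sc M (r x) (\<phi> (f x))"
    using assms(1) insert unfolding lin_on_def by blast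
  ultimately show ?case using insert by simp
qed

lemma lin_on_ar: "v < nv \<Longrightarrow> lin_on (sc M) (sp M v) (sp M (nxt M v)) (ar M v)"
  using cyc by (simp add: cyclic_rep_def)

lemma ar_bv: "(j, p) \<in> ix v \<Longrightarrow> ar M v (bv B j p) = (if Suc p < len B j then bv B j (Suc p) else 0)"
  using seg unfolding segment_basis_def idx_iff by auto

text \<open>There is no cut-off at \<open>len B j\<close>: a coordinate pushed past the end of its
  chain lies outside \<open>idx\<close>, where \<open>vec\<close> ignores it.\<close>

definition shift_co :: "(nat \<Rightarrow> nat \<Rightarrow> complex) \<Rightarrow> nat \<Rightarrow> nat \<Rightarrow> complex" where
  "shift_co c j p = (case p of 0 \<Rightarrow> 0 | Suc q \<Rightarrow> c j q)"

lemma ar_vec: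
  assumes v: "v < nv"
  shows "ar M v (vec v c) = vec (nxt M v) (shift_co c)"
proof -
  let ?I = "{(j, p) \<in> ix v. Suc p < len B j}"
  let ?f = "\<lambda>(j, p). sc M (shift_co c j p) (bv B j p)"
  have "ar M v (vec v c) = (\<Sum>x\<in>ix v. sc M (case_prod c x) (ar M v (case_prod (bv B) x)))"
    unfolding vec_def using lin_on_sum[OF lin_on_ar[OF v] subspace_sp[OF v] finite_idx, of v "case_prod (bv B)" "case_prod c"]
    by (auto simp: case_prod_unfold bv_in_sp v)
  also have "\<dots> = (\<Sum>(j, p)\<in>ix v. if Suc p < len B j then sc M (c j p) (bv B j (Suc p)) else 0)"
    by (rule sum.cong) (auto simp: ar_bv)
  also have "\<dots> = (\<Sum>(j, p)\<in>?I. sc M (c j p) (bv B j (Suc p)))"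
    by (rule sum.mono_neutral_cong_right) (auto split: if_splits)
  also have "\<dots> = sum ?f ((\<lambda>(j, p). (j, Suc p)) ` ?I)"
    by (subst sum.reindex) (auto simp: inj_on_def shift_co_def intro: sum.cong)
  also have "\<dots> = vec (nxt M v) (shift_co c)"
    unfolding vec_def
  proof (rule sum.mono_neutral_left)
    show "(\<lambda>(j, p). (j, Suc p)) ` ?I \<subseteq> ix (nxt M v)"
      by (auto simp: idx_iff vtx_Suc)
    \<comment> \<open>Only indices with \<open>p = 0\<close> are missed by the shift, and there
      \<open>shift_co\<close> is 0.\<close>
    have "(j, p) \<in> (\<lambda>(j, p). (j, Suc p)) ` ?I" if "(j, p) \<in> ix (nxt M v)" "p \<noteq> 0" for j p
    proof -
      obtain q where q: "p = Suc q" using \<open>p \<noteq> 0\<close> by (cases p) auto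
      with that v have "(j, q) \<in> ?I" by (auto simp: idx_iff vtx_Suc_eq_nxt_iff)
      then show ?thesis using q by force
    qed
    then show "\<forall>x\<in>ix (nxt M v) - (\<lambda>(j, p). (j, Suc p)) ` ?I. ?f x = 0"
      by (fastforce simp: shift_co_def split: nat.splits)
  qed simp
  finally show ?thesis .
qed

lemma lin_ext_vec:
  assumes v: "v < nv"
  shows "lext w v (vec v c) = (\<Sum>(j, p)\<in>ix v. sc M (c j p) (w j p))"
  unfolding lin_ext_def by (rule sum.cong) (auto simp: co_vec[OF v, unfolded co_def])

section \<open>Subspaces, dimensions and images under linear maps\<close>

lemma finite_basis_of_subspace:
  assumes v: "v < nv" and W: "W \<subseteq> sp M v"
  obtains X where "X \<subseteq> W" "vs.independent X" "W \<subseteq> vs.span X" "finite X" "card X = vs.dim W"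
proof -
  obtain X where X: "X \<subseteq> W" "vs.independent X" "W \<subseteq> vs.span X" "card X = vs.dim W"
    using vs.basis_exists by blast
  have "finite X"
    using vs.independent_span_bound[OF finite_basis_at X(2)] X(1) W span_basis_at[OF v] by blast
  then show thesis using X that by blast
qed

lemma lin_on_image_span:
  assumes v: "v < nv" and g: "lin_on (sc M) (sp M v) (sp M v') g"
    and X: "X \<subseteq> sp M v" "finite X"
  shows "g ` vs.span X \<subseteq> vs.span (g ` X)"
proof
  fix y assume "y \<in> g ` vs.span X"
  then obtain r where r: "y = g (\<Sum>a\<in>X. sc M (r a) a)"
    using vs.span_finite[OF X(2)] by auto
  have "y = (\<Sum>a\<in>X. sc M (r a) (g a))"
    unfolding r using lin_on_sum[OF g subspace_sp[OF v] X(2), of "\<lambda>a. a" r] X(1) by blast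
  then show "y \<in> vs.span (g ` X)"
    by (auto intro: vs.span_sum vs.span_scale vs.span_base)
qed

lemma dim_image_le:
  assumes v: "v < nv" and g: "lin_on (sc M) (sp M v) (sp M v') g"
    and W: "W \<subseteq> sp M v"
  shows "vs.dim (g ` W) \<le> vs.dim W"
proof -
  obtain X where X: "X \<subseteq> W" "vs.independent X" "W \<subseteq> vs.span X" "finite X" "card X = vs.dim W"
    using finite_basis_of_subspace[OF v W] .
  have "g ` W \<subseteq> vs.span (g ` X)"
    using lin_on_image_span[OF v g _ X(4)] X(1,3) W by blast
  then have "vs.dim (g ` W) \<le> card (g ` X)"
    using X(4) by (intro vs.dim_le_card) auto
  also have "\<dots> \<le> vs.dim W" using card_image_le[OF X(4), of g] X(5) by simp
  finally show ?thesis .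
qed

text \<open>Otherwise a vector outside \<open>W\<close>, added to a basis of \<open>W\<close>, would
  give more than \<open>card Y\<close> independent vectors in the span of \<open>Y\<close>.\<close>

lemma span_subset_if_card_le_dim:
  assumes W: "vs.subspace W" "W \<subseteq> vs.span Y" and Y: "finite Y" "card Y \<le> vs.dim W"
  shows "vs.span Y \<subseteq> W"
proof
  fix y assume y: "y \<in> vs.span Y"
  obtain X where X: "X \<subseteq> W" "vs.independent X" "W \<subseteq> vs.span X" "card X = vs.dim W"
    using vs.basis_exists by blast
  have fX: "finite X" using vs.independent_span_bound[OF Y(1) X(2)] X(1) W(2) by blast
  show "y \<in> W"
  proof (rule ccontr)
    assume "y \<notin> W"
    then have ny: "y \<notin> vs.span X" using vs.span_minimal[OF X(1) W(1)] by blast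
    then have "vs.independent (insert y X)" using X(2) by (rule vs.independent_insertI)
    moreover have "insert y X \<subseteq> vs.span Y" using y X(1) W(2) by blast
    ultimately have "card (insert y X) \<le> card Y" using vs.independent_span_bound[OF Y(1)] by blast
    moreover have "y \<notin> X" using ny vs.span_base by blast
    ultimately show False using fX X(4) Y(2) by simp
  qed
qed

lemma Gr_iff: "L \<in> Gr M e \<longleftrightarrow> L \<in> extensional {..<nv} \<and> (\<forall>v<nv.
     vs.subspace (L v) \<and> L v \<subseteq> sp M v \<and> vs.dim (L v) = e v \<and> ar M v ` L v \<subseteq> L (nxt M v))"
  by (simp add: Gr_def)

text \<open>Serves the torus and the permutations alike. The scalar \<open>k\<close> is there
  because the torus commutes with the arrows only up to a factor, which subspaces do not see. The
  left inverse \<open>h\<close> keeps the dimension from dropping.\<close>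

lemma Gr_image:
  assumes L: "L \<in> Gr M e"
    and g: "\<And>v. v < nv \<Longrightarrow> lin_on (sc M) (sp M v) (sp M v) (g v)"
    and h: "\<And>v. v < nv \<Longrightarrow> lin_on (sc M) (sp M v) (sp M v) (h v)"
    and hg: "\<And>v x. v < nv \<Longrightarrow> x \<in> sp M v \<Longrightarrow> h v (g v x) = x"
    and ar: "\<And>v x. v < nv \<Longrightarrow> x \<in> sp M v \<Longrightarrow> ar M v (g v x) = sc M k (g (nxt M v) (ar M v x))"
  shows "(\<lambda>v\<in>{..<nv}. g v ` L v) \<in> Gr M e"
proof -
  have key: "vs.subspace (g v ` L v) \<and> g v ` L v \<subseteq> sp M v \<and> vs.dim (g v ` L v) = e v
    \<and> ar M v ` g v ` L v \<subseteq> g (nxt M v) ` L (nxt M v)" if v: "v < nv" for v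
  proof -
  have L': "vs.subspace (L v)" "L v \<subseteq> sp M v" "vs.dim (L v) = e v" "ar M v ` L v \<subseteq> L (nxt M v)"
    using L v by (auto simp: Gr_iff)
  have gsp: "g v x \<in> sp M v" if "x \<in> L v" for x
    using g[OF v] that L'(2) by (auto simp: lin_on_def)
  have gs: "g v ` L v \<subseteq> sp M v" using gsp by blast
  have "vs.subspace (g v ` L v)"
  proof (rule vs.subspaceI)
    have "g v (sc M 0 0) = sc M 0 (g v 0)"
      using g[OF v] vs.subspace_0[OF subspace_sp[OF v]] unfolding lin_on_def by blast
    then have "g v 0 = 0" by simp
    then show "0 \<in> g v ` L v" using vs.subspace_0[OF L'(1)] image_iff by fastforce
  next
    fix x y assume "x \<in> g v ` L v" "y \<in> g v ` L v"
    then obtain a b where ab: "a \<in> L v" "b \<in> L v" "x = g v a" "y = g v b" by blast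
    then have "a \<in> sp M v" "b \<in> sp M v" using L'(2) by auto
    then have "g v (a + b) = g v a + g v b" using g[OF v] unfolding lin_on_def by blast
    then have "x + y = g v (a + b)" by (simp add: ab)
    then show "x + y \<in> g v ` L v" using ab vs.subspace_add[OF L'(1)] by blast
  next
    fix c x assume "x \<in> g v ` L v"
    then obtain a where a: "a \<in> L v" "x = g v a" by blast
    then have "a \<in> sp M v" using L'(2) by auto
    then have "g v (sc M c a) = sc M c (g v a)" using g[OF v] unfolding lin_on_def by blast
    then have "sc M c x = g v (sc M c a)" by (simp add: a)
    then show "sc M c x \<in> g v ` L v" using a vs.subspace_scale[OF L'(1)] by blast
  qed
  moreover have "vs.dim (g v ` L v) = e v"
  proof (rule antisym)
    show "vs.dim (g v ` L v) \<le> e v"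
      using dim_image_le[OF v g[OF v] L'(2)] L'(3) by simp
    have "h v ` (g v ` L v) = L v"
    proof -
      have "(\<lambda>x. h v (g v x)) ` L v = (\<lambda>x. x) ` L v"
        by (rule image_cong) (use hg[OF v] L'(2) in auto)
      then show ?thesis by (simp add: image_image)
    qed
    then show "e v \<le> vs.dim (g v ` L v)"
      using dim_image_le[OF v h[OF v] gs] L'(3) by simp
  qed
  moreover have "ar M v ` g v ` L v \<subseteq> g (nxt M v) ` L (nxt M v)"
  proof
    fix y assume "y \<in> ar M v ` g v ` L v"
    then obtain x where x: "x \<in> L v" "y = ar M v (g v x)" by blast
    have arx: "ar M v x \<in> L (nxt M v)" using x(1) L'(4) by blast
    have arx': "ar M v x \<in> sp M (nxt M v)"
      using x(1) L'(2) lin_on_ar[OF v] by (auto simp: lin_on_def)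
    have "y = sc M k (g (nxt M v) (ar M v x))" using x ar[OF v] L'(2) by auto
    also have "\<dots> = g (nxt M v) (sc M k (ar M v x))"
      using g[OF nxt_less[of v]] arx' unfolding lin_on_def by metis
    finally have "y = g (nxt M v) (sc M k (ar M v x))" .
    moreover have "sc M k (ar M v x) \<in> L (nxt M v)"
      using L arx nxt_less[of v] unfolding Gr_iff by (blast intro: vs.subspace_scale)
    ultimately show "y \<in> g (nxt M v) ` L (nxt M v)" by blast
  qed
  ultimately show ?thesis using gs by blast
  qed
  define R where "R = (\<lambda>v\<in>{..<nv}. g v ` L v)"
  have R: "R v = g v ` L v" if "v < nv" for v using that by (simp add: R_def)
  have "R \<in> extensional {..<nv}" by (simp add: R_def)
  moreover have "vs.subspace (R v) \<and> R v \<subseteq> sp M v \<and> vs.dim (R v) = e v \<and> ar M v ` R v \<subseteq> R (nxt M v)"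
    if v: "v < nv" for v
    unfolding R[OF v] R[OF nxt_less] using key[OF v] .
  ultimately have "R \<in> Gr M e" unfolding Gr_iff by blast
  then show ?thesis by (simp only: R_def)
qed

lemma lin_on_lin_ext:
  assumes v: "v < nv" and w: "\<And>j p. (j, p) \<in> ix v \<Longrightarrow> w j p \<in> sp M v"
  shows "lin_on (sc M) (sp M v) (sp M v) (lext w v)"
proof -
  have 1: "lext w v x \<in> sp M v" "lext w v (sc M c x) = sc M c (lext w v x)"
    if x: "x \<in> sp M v" for x c
  proof -
  obtain a where a: "x = vec v a" using sp_obtain_vec[OF v x] by blast
  show "lext w v x \<in> sp M v"
    unfolding a lin_ext_vec[OF v]
    by (rule vs.subspace_sum) (auto intro: subspace_sp vs.subspace_scale w v)
    show "lext w v (sc M c x) = sc M c (lext w v x)"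
      unfolding a vec_scale lin_ext_vec[OF v] by (simp add: vs.scale_sum_right case_prod_unfold)
  qed
  have 2: "lext w v (x + y) = lext w v x + lext w v y"
    if xy: "x \<in> sp M v" "y \<in> sp M v" for x y
  proof -
    obtain a b where a: "x = vec v a" "y = vec v b"
      using sp_obtain_vec[OF v xy(1)] sp_obtain_vec[OF v xy(2)] by metis
    show ?thesis
      unfolding a vec_add lin_ext_vec[OF v]
      by (simp add: vs.scale_left_distrib sum.distrib case_prod_unfold)
  qed
  show ?thesis unfolding lin_on_def using 1 2 by blast
qed

section \<open>The torus action in coordinates\<close>

abbreviation "tlin \<gamma> \<equiv> lext (\<lambda>j p. sc M (\<gamma> 0 ^ p * \<gamma> j) (bv B j p))"

lemma lin_ext_torus:
  assumes "v < nv"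
  shows "tlin \<gamma> v (vec v c) = vec v (\<lambda>j p. \<gamma> 0 ^ p * \<gamma> j * c j p)"
  unfolding lin_ext_vec[OF assms] by (simp add: vec_def mult.commute)

lemma torus_act_apply:
  "v < nv \<Longrightarrow> tact \<gamma> L v = tlin \<gamma> v ` L v"
  by (simp add: torus_act_def act_sub_def)

lemma vec_in_torus_act:
  assumes "v < nv" "vec v c \<in> L v"
  shows "vec v (\<lambda>j p. \<gamma> 0 ^ p * \<gamma> j * c j p) \<in> tact \<gamma> L v"
  unfolding torus_act_apply[OF assms(1)] lin_ext_torus[OF assms(1), symmetric]
  using assms(2) by (rule imageI)

text \<open>Just enough to compare families through coordinates. It holds for pencils with arbitrary
  parameters, before they are known to lie in the Grassmannian.\<close>

definition graded :: "(nat \<Rightarrow> 'v set) \<Rightarrow> bool" where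
  "graded N \<longleftrightarrow> N \<in> extensional {..<nv} \<and> (\<forall>v<nv. N v \<subseteq> sp M v)"

lemma graded_Gr: "N \<in> Gr M e \<Longrightarrow> graded N"
  by (simp add: graded_def Gr_iff)

lemma graded_eqI:
  assumes "graded N" "graded N'" "\<And>v c. v < nv \<Longrightarrow> vec v c \<in> N v \<longleftrightarrow> vec v c \<in> N' v"
  shows "N = N'"
proof (rule extensionalityI)
  show "N \<in> extensional {..<nv}" "N' \<in> extensional {..<nv}"
    using assms(1,2) by (auto simp: graded_def)
  fix v assume "v \<in> {..<nv}"
  then have v: "v < nv" by simp
  then have "N v \<subseteq> sp M v" "N' v \<subseteq> sp M v" using assms(1,2) by (auto simp: graded_def)
  then show "N v = N' v"
    using assms(3)[OF v] vec_co[OF v] by (metis subsetI subset_antisym subsetD)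
qed

lemma graded_torus_act:
  assumes N: "graded N" shows "graded (tact \<gamma> N)"
proof -
  have "lin_on (sc M) (sp M v) (sp M v) (tlin \<gamma> v)" if "v < nv" for v
    using that by (intro lin_on_lin_ext) (auto intro!: bv_in_sp vs.subspace_scale subspace_sp)
  then show ?thesis
    using N by (fastforce simp: graded_def torus_act_def act_sub_def lin_on_def)
qed

lemma torus_nonzero: "\<gamma> \<in> torus B \<Longrightarrow> j \<le> num B \<Longrightarrow> \<gamma> j \<noteq> 0"
  by (auto simp: torus_def)

lemma vec_in_torus_act_iff:
  assumes \<gamma>: "\<gamma> \<in> torus B" and v: "v < nv" and N: "graded N"
  shows "vec v c \<in> tact \<gamma> N v \<longleftrightarrow> vec v (\<lambda>j p. c j p / (\<gamma> 0 ^ p * \<gamma> j)) \<in> N v"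
proof
  assume "vec v c \<in> tact \<gamma> N v"
  then obtain x where x: "x \<in> N v" "vec v c = tlin \<gamma> v x"
    by (auto simp: torus_act_apply[OF v])
  then obtain d where d: "x = vec v d" using N v sp_obtain_vec by (metis graded_def subsetD)
  have eq: "vec v c = vec v (\<lambda>j p. \<gamma> 0 ^ p * \<gamma> j * d j p)" using x d lin_ext_torus[OF v] by simp
  have "vec v (\<lambda>j p. c j p / (\<gamma> 0 ^ p * \<gamma> j)) = vec v d"
  proof (rule vec_cong)
    fix j p assume jp: "(j, p) \<in> ix v"
    then show "c j p / (\<gamma> 0 ^ p * \<gamma> j) = d j p"
      unfolding vec_eqD[OF eq v jp] using torus_nonzero[OF \<gamma>] by (simp add: idx_iff)
  qed
  then show "vec v (\<lambda>j p. c j p / (\<gamma> 0 ^ p * \<gamma> j)) \<in> N v" using x d by simp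
next
  assume "vec v (\<lambda>j p. c j p / (\<gamma> 0 ^ p * \<gamma> j)) \<in> N v"
  with v have "vec v (\<lambda>j p. \<gamma> 0 ^ p * \<gamma> j * (c j p / (\<gamma> 0 ^ p * \<gamma> j))) \<in> tact \<gamma> N v"
    by (rule vec_in_torus_act)
  moreover have "vec v (\<lambda>j p. \<gamma> 0 ^ p * \<gamma> j * (c j p / (\<gamma> 0 ^ p * \<gamma> j))) = vec v c"
    using torus_nonzero[OF \<gamma>] by (intro vec_cong) (simp add: idx_iff)
  ultimately show "vec v c \<in> tact \<gamma> N v" by simp
qed

section \<open>Torus-invariant subrepresentations\<close>


text \<open>Composing the operators \<open>wt - \<nu>\<close> over the weights
  \<open>\<nu> \<noteq> \<mu>\<close> kills every other weight space and multiplies that of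
  \<open>\<mu>\<close> by a nonzero number, without leaving \<open>W\<close>.\<close>

lemma weight_component:
  assumes W: "vs.subspace W"
    and inv: "\<And>c. vec v c \<in> W \<Longrightarrow> vec v (\<lambda>j p. wt j p * c j p) \<in> W"
    and c: "vec v c \<in> W"
  shows "vec v (\<lambda>j p. if wt j p = \<mu> then c j p else 0) \<in> W"
proof -
  have prod: "vec v (\<lambda>j p. (\<Prod>\<nu>\<in>S. wt j p - \<nu>) * c j p) \<in> W" if "finite S" for S
    using that
  proof (induction S)
    case empty
    then show ?case using c by simp
  next
    case (insert \<nu> S)
    let ?d = "\<lambda>j p. (\<Prod>\<nu>\<in>S. wt j p - \<nu>) * c j p"
    have "vec v (\<lambda>j p. wt j p * ?d j p) + sc M (- \<nu>) (vec v ?d) \<in> W"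
      using insert inv W by (intro vs.subspace_add vs.subspace_scale) auto
    moreover have "vec v (\<lambda>j p. wt j p * ?d j p) + sc M (- \<nu>) (vec v ?d)
        = vec v (\<lambda>j p. (\<Prod>\<nu>\<in>insert \<nu> S. wt j p - \<nu>) * c j p)"
      unfolding vec_scale vec_add using insert by (intro vec_cong) (simp add: algebra_simps)
    ultimately show ?case by simp
  qed
  define S where "S = case_prod wt ` ix v - {\<mu>}"
  have fS: "finite S" by (simp add: S_def)
  have nz: "(\<Prod>\<nu>\<in>S. \<mu> - \<nu>) \<noteq> 0" using fS by (auto simp: S_def)
  have "sc M (1 / (\<Prod>\<nu>\<in>S. \<mu> - \<nu>)) (vec v (\<lambda>j p. (\<Prod>\<nu>\<in>S. wt j p - \<nu>) * c j p)) \<in> W"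
    using prod[OF fS] W by (intro vs.subspace_scale)
  also have "sc M (1 / (\<Prod>\<nu>\<in>S. \<mu> - \<nu>)) (vec v (\<lambda>j p. (\<Prod>\<nu>\<in>S. wt j p - \<nu>) * c j p))
      = vec v (\<lambda>j p. if wt j p = \<mu> then c j p else 0)"
    unfolding vec_scale
  proof (rule vec_cong)
    fix j p assume jp: "(j, p) \<in> ix v"
    show "1 / (\<Prod>\<nu>\<in>S. \<mu> - \<nu>) * ((\<Prod>\<nu>\<in>S. wt j p - \<nu>) * c j p) = (if wt j p = \<mu> then c j p else 0)"
    proof (cases "wt j p = \<mu>")
      case True
      then show ?thesis using nz by simp
    next
      case False
      then have "wt j p \<in> S" using jp by (force simp: S_def)
      then have "(\<Prod>\<nu>\<in>S. wt j p - \<nu>) = 0" using fS by (metis prod_zero_iff right_minus_eq)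
      then show ?thesis using False by simp
    qed
  qed
  finally show ?thesis .
qed

text \<open>The weight of \<open>bv B j p\<close> becomes a power of 2 with exponent
  \<open>p + l * \<kappa> j\<close>, where \<open>l\<close> exceeds every position, so that division
  by \<open>l\<close> recovers both \<open>p\<close> and \<open>\<kappa> j\<close>. Summands with
  the same \<open>\<kappa>\<close> are deliberately not separated, which allows the element to lie
  in a chosen subtorus.\<close>

definition generic_weight :: "(nat \<Rightarrow> nat) \<Rightarrow> nat \<Rightarrow> complex" where
  "generic_weight \<kappa> = (\<lambda>j\<in>{0..num B}. if j = 0 then 2 else 2 ^ (Suc (\<Sum>j\<in>{1..num B}. len B j) * \<kappa> j))"

lemma generic_weight_in_torus: "generic_weight \<kappa> \<in> torus B"
  by (auto simp: generic_weight_def torus_def)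

lemma generic_weight_eq_iff:
  assumes "(j, p) \<in> ix v" "(j', p') \<in> ix v"
  shows "generic_weight \<kappa> 0 ^ p * generic_weight \<kappa> j = generic_weight \<kappa> 0 ^ p' * generic_weight \<kappa> j'
    \<longleftrightarrow> \<kappa> j = \<kappa> j' \<and> p = p'"
proof -
  let ?l = "Suc (\<Sum>j\<in>{1..num B}. len B j)"
  have lt: "p < ?l" if "(j, p) \<in> ix v" for j p
  proof -
    have "len B j \<le> (\<Sum>j\<in>{1..num B}. len B j)"
      using that by (intro member_le_sum) (auto simp: idx_iff)
    then show ?thesis using that by (simp add: idx_iff)
  qed
  have w: "generic_weight \<kappa> 0 ^ p * generic_weight \<kappa> j = of_nat (2 ^ (p + ?l * \<kappa> j))"
    if "(j, p) \<in> ix v" for j p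
    using that by (simp add: generic_weight_def idx_iff power_add)
  have "generic_weight \<kappa> 0 ^ p * generic_weight \<kappa> j = generic_weight \<kappa> 0 ^ p' * generic_weight \<kappa> j'
    \<longleftrightarrow> p + ?l * \<kappa> j = p' + ?l * \<kappa> j'"
    unfolding w[OF assms(1)] w[OF assms(2)] of_nat_eq_iff by simp
  also have "\<dots> \<longleftrightarrow> \<kappa> j = \<kappa> j' \<and> p = p'"
  proof
    assume eq: "p + ?l * \<kappa> j = p' + ?l * \<kappa> j'"
    have "(p + ?l * \<kappa> j) mod ?l = p" "(p' + ?l * \<kappa> j') mod ?l = p'"
      using lt[OF assms(1)] lt[OF assms(2)] by (simp_all only: mod_mult_self2 mod_less)
    with eq have "p = p'" by simp
    moreover from this eq have "?l * \<kappa> j = ?l * \<kappa> j'" by (simp only: add_left_cancel)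
    then have "\<kappa> j = \<kappa> j'" by (simp only: mult_cancel1 Suc_not_Zero simp_thms nat.distinct)
    ultimately show "\<kappa> j = \<kappa> j' \<and> p = p'" by simp
  qed simp
  finally show ?thesis .
qed

definition comp_co :: "(nat \<Rightarrow> nat) \<Rightarrow> nat \<Rightarrow> nat \<Rightarrow> (nat \<Rightarrow> nat \<Rightarrow> complex) \<Rightarrow> nat \<Rightarrow> nat \<Rightarrow> complex" where
  "comp_co \<kappa> j0 p0 c j p = (if \<kappa> j = \<kappa> j0 \<and> p = p0 then c j p else 0)"

lemma fixed_component:
  assumes N: "N \<in> Gr M e" and fx: "tact (generic_weight \<kappa>) N = N"
    and v: "v < nv" and c: "vec v c \<in> N v" and jp: "(j0, p0) \<in> ix v"
  shows "vec v (comp_co \<kappa> j0 p0 c) \<in> N v"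
proof -
  let ?wt = "\<lambda>j p. generic_weight \<kappa> 0 ^ p * generic_weight \<kappa> j"
  have "vec v (\<lambda>j p. if ?wt j p = ?wt j0 p0 then c j p else 0) \<in> N v"
  proof (rule weight_component)
    show "vs.subspace (N v)" using N v by (simp add: Gr_iff)
    show "vec v (\<lambda>j p. ?wt j p * c j p) \<in> N v" if "vec v c \<in> N v" for c
      using vec_in_torus_act[of v c N "generic_weight \<kappa>"] that v fx by simp
  qed (rule c)
  moreover have "vec v (\<lambda>j p. if ?wt j p = ?wt j0 p0 then c j p else 0) = vec v (comp_co \<kappa> j0 p0 c)"
    using generic_weight_eq_iff[OF _ jp, of _ _ \<kappa>] by (intro vec_cong) (simp add: comp_co_def)
  ultimately show ?thesis by simp
qed

text \<open>The concrete form in which isomorphism of the neighbouring summands \<open>i\<close> and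
  \<open>Suc i\<close> is used: equal positions of the two chains sit at equal vertices.\<close>

definition twin :: "nat \<Rightarrow> bool" where
  "twin i \<longleftrightarrow> 1 \<le> i \<and> Suc i \<le> num B \<and> st B i = st B (Suc i) \<and> len B i = len B (Suc i)"

lemma twin_idx: "twin i \<Longrightarrow> (Suc i, p) \<in> ix v \<longleftrightarrow> (i, p) \<in> ix v"
  by (auto simp: twin_def idx_iff vtx_def)

text \<open>The coordinates of
  \<open>x b\<^sub>i\<^sub>p + y b\<^sub>i\<^sub>+\<^sub>1\<^sub>p\<close>.\<close>

definition pair_co :: "nat \<Rightarrow> nat \<Rightarrow> complex \<Rightarrow> complex \<Rightarrow> nat \<Rightarrow> nat \<Rightarrow> complex" where
  "pair_co i p x y j' p' = (if p' = p \<and> j' = i then x else if p' = p \<and> j' = Suc i then y else 0)"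

text \<open>Invariance under the subtorus on which
  \<open>\<epsilon>\<^sub>i\<^sub>+\<^sub>1 - \<epsilon>\<^sub>i\<close> is trivial. Torus-fixed
  points have it, and so do the points of an orbit whose character is proportional to this
  one.\<close>

definition partially_fixed :: "nat \<Rightarrow> (nat \<Rightarrow> 'v set) \<Rightarrow> bool" where
  "partially_fixed i N \<longleftrightarrow> (\<forall>\<gamma>\<in>torus B. \<gamma> i = \<gamma> (Suc i) \<longrightarrow> tact \<gamma> N = N)"

text \<open>A single element of the subtorus separates all basis vectors except
  \<open>b\<^sub>i\<^sub>p\<close> from \<open>b\<^sub>i\<^sub>+\<^sub>1\<^sub>p\<close>. As
  \<open>N\<close> is the sum of its weight spaces, it is described by the single basis vectors it
  contains and by its traces on these planes.\<close>

lemma partially_fixed_vec_iff: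
  assumes i: "twin i" and N: "N \<in> Gr M e" and fx: "partially_fixed i N" and v: "v < nv"
  shows "vec v c \<in> N v \<longleftrightarrow>
    (\<forall>(j, p)\<in>ix v. j \<noteq> i \<longrightarrow> j \<noteq> Suc i \<longrightarrow> c j p \<noteq> 0 \<longrightarrow> bv B j p \<in> N v)
    \<and> (\<forall>p. (i, p) \<in> ix v \<longrightarrow> vec v (pair_co i p (c i p) (c (Suc i) p)) \<in> N v)" (is "_ \<longleftrightarrow> ?R")
proof -
  define \<kappa> where "\<kappa> = (\<lambda>j. if j = Suc i then i else j)"
  have sub: "vs.subspace (N v)" using N v by (simp add: Gr_iff)
  have "generic_weight \<kappa> i = generic_weight \<kappa> (Suc i)"
    using i by (simp add: generic_weight_def \<kappa>_def twin_def)
  then have fx': "tact (generic_weight \<kappa>) N = N"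
    using fx generic_weight_in_torus by (simp add: partially_fixed_def)
  have single: "comp_co \<kappa> j p c = (\<lambda>j' p'. c j p * unit_co j p j' p')" if "j \<noteq> i" "j \<noteq> Suc i" for j p
    using that by (auto simp: fun_eq_iff comp_co_def \<kappa>_def unit_co_def)
  have pair: "comp_co \<kappa> i p c = pair_co i p (c i p) (c (Suc i) p)" for p
    by (auto simp: fun_eq_iff comp_co_def \<kappa>_def pair_co_def)
  have single': "vec v (comp_co \<kappa> j p c) = sc M (c j p) (bv B j p)"
    if "j \<noteq> i" "j \<noteq> Suc i" "(j, p) \<in> ix v" for j p
    unfolding single[OF that(1,2)] vec_scale[symmetric] vec_unit_co[OF that(3)] ..
  show ?thesis
  proof
    assume "vec v c \<in> N v"
    note comp = fixed_component[OF N fx' v this]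
    have "bv B j p \<in> N v" if jp: "(j, p) \<in> ix v" "j \<noteq> i" "j \<noteq> Suc i" "c j p \<noteq> 0" for j p
    proof -
      have "sc M (c j p) (bv B j p) \<in> N v"
        using comp[OF jp(1)] single'[OF jp(2,3,1)] by simp
      from vs.subspace_scale[OF sub this, of "1 / c j p"] jp show ?thesis by simp
    qed
    moreover have "vec v (pair_co i p (c i p) (c (Suc i) p)) \<in> N v" if "(i, p) \<in> ix v" for p
      using comp[OF that] by (simp add: pair)
    ultimately show ?R by blast
  next
    assume R: ?R
    \<comment> \<open>One representative for each weight: \<open>Suc i\<close> is represented by
      \<open>i\<close>.\<close>
    let ?I = "{(j, p) \<in> ix v. j \<noteq> Suc i}"
    have fI: "finite ?I" by (rule finite_subset[OF _ finite_idx[of v]]) auto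
    have "vec v c = vec v (\<lambda>j p. \<Sum>x\<in>?I. case_prod (comp_co \<kappa>) x c j p)"
    proof (rule vec_cong)
      fix j p assume jp: "(j, p) \<in> ix v"
      then have I: "(\<kappa> j, p) \<in> ?I" using twin_idx[OF i] by (auto simp: \<kappa>_def)
      have "(\<Sum>x\<in>?I. case_prod (comp_co \<kappa>) x c j p) = (\<Sum>x\<in>?I. if x = (\<kappa> j, p) then c j p else 0)"
        by (rule sum.cong) (auto simp: comp_co_def \<kappa>_def split: if_splits)
      then show "c j p = (\<Sum>x\<in>?I. case_prod (comp_co \<kappa>) x c j p)"
        using I fI by simp
    qed
    also have "\<dots> \<in> N v"
      unfolding vec_sum[symmetric]
    proof (rule vs.subspace_sum[OF sub])
      fix x assume x: "x \<in> ?I"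
      obtain j p where jp: "x = (j, p)" by (cases x)
      show "vec v (case_prod (comp_co \<kappa>) x c) \<in> N v"
      proof (cases "j = i")
        case True
        then show ?thesis using R x jp by (auto simp: pair)
      next
        case False
        then have "c j p = 0 \<or> bv B j p \<in> N v" using R x jp by auto
        then show ?thesis
          using single'[of j p] False x jp sub vs.subspace_0[OF sub] by (auto intro: vs.subspace_scale)
      qed
    qed
    finally show "vec v c \<in> N v" .
  qed
qed

section \<open>Pencils\<close>

text \<open>\<open>pen i A Q x y\<close> contains the basis vectors indexed by \<open>Q\<close> and, for \<open>p \<in> A\<close>, the line through
  \<open>x b\<^sub>i\<^sub>p + y b\<^sub>i\<^sub>+\<^sub>1\<^sub>p\<close>. The conditions in \<open>pencil\<close> make this a subrepresentation.\<close>

definition pcond :: "nat \<Rightarrow> nat set \<Rightarrow> (nat \<times> nat) set \<Rightarrow> complex \<Rightarrow> complex \<Rightarrow> nat \<Rightarrow> (nat \<Rightarrow> nat \<Rightarrow> complex) \<Rightarrow> bool" where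
  "pcond i A Q x y v c \<longleftrightarrow> (\<forall>j p. (j, p) \<in> ix v \<longrightarrow>
     (if (j = i \<or> j = Suc i) \<and> p \<in> A then x * c (Suc i) p = y * c i p else c j p \<noteq> 0 \<longrightarrow> (j, p) \<in> Q))"

definition pen :: "nat \<Rightarrow> nat set \<Rightarrow> (nat \<times> nat) set \<Rightarrow> complex \<Rightarrow> complex \<Rightarrow> nat \<Rightarrow> 'v set" where
  "pen i A Q x y = (\<lambda>v\<in>{..<nv}. {vec v c |c. pcond i A Q x y v c})"

text \<open>The last condition, symmetry of \<open>Q\<close> in \<open>i\<close> and
  \<open>Suc i\<close>, is what makes the swap of the two summands act on the pencil by exchanging
  \<open>x\<close> and \<open>y\<close>.\<close>

definition pencil :: "nat \<Rightarrow> nat set \<Rightarrow> (nat \<times> nat) set \<Rightarrow> bool" where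
  "pencil i A Q \<longleftrightarrow> twin i \<and> (\<forall>p\<in>A. p < len B i \<and> (i, p) \<notin> Q \<and> (Suc i, p) \<notin> Q)
     \<and> (\<forall>j p. (j, p) \<in> Q \<longrightarrow> Suc p < len B j \<longrightarrow> (j, Suc p) \<in> Q)
     \<and> (\<forall>p\<in>A. Suc p < len B i \<longrightarrow> Suc p \<in> A \<or> (i, Suc p) \<in> Q \<and> (Suc i, Suc p) \<in> Q)
     \<and> (\<forall>p. (i, p) \<in> Q \<longleftrightarrow> (Suc i, p) \<in> Q)"

lemma pencil_twin: "pencil i A Q \<Longrightarrow> twin i"
  by (simp add: pencil_def)

lemma pencil_disjoint: "pencil i A Q \<Longrightarrow> p \<in> A \<Longrightarrow> (i, p) \<notin> Q \<and> (Suc i, p) \<notin> Q"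
  by (simp add: pencil_def)

lemma pcond_cong:
  assumes "twin i" "\<And>j p. (j, p) \<in> ix v \<Longrightarrow> c j p = c' j p"
  shows "pcond i A Q x y v c \<longleftrightarrow> pcond i A Q x y v c'"
proof -
  have "pcond i A Q x y v d'" if d: "pcond i A Q x y v d" "\<And>j p. (j, p) \<in> ix v \<Longrightarrow> d j p = d' j p" for d d'
    unfolding pcond_def
  proof (intro allI impI)
    fix j p assume jp: "(j, p) \<in> ix v"
    then have "d i p = d' i p" "d (Suc i) p = d' (Suc i) p" if "j = i \<or> j = Suc i"
      using that d(2) twin_idx[OF assms(1)] by auto
    then show "if (j = i \<or> j = Suc i) \<and> p \<in> A then x * d' (Suc i) p = y * d' i p
        else d' j p \<noteq> 0 \<longrightarrow> (j, p) \<in> Q"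
      using d(1)[unfolded pcond_def, rule_format, OF jp] d(2)[OF jp] by auto
  qed
  from this[of c c'] this[of c' c] assms(2) show ?thesis by metis
qed

lemma vec_in_pen:
  assumes i: "twin i" and v: "v < nv"
  shows "vec v c \<in> pen i A Q x y v \<longleftrightarrow> pcond i A Q x y v c"
proof
  assume "vec v c \<in> pen i A Q x y v"
  then obtain c' where c': "vec v c = vec v c'" "pcond i A Q x y v c'" using v by (auto simp: pen_def)
  then show "pcond i A Q x y v c"
    using pcond_cong[OF i, of v c c'] vec_eqD[OF c'(1) v] by blast
qed (use v in \<open>auto simp: pen_def\<close>)

lemma pen_ext [simp]: "pen i A Q x y \<in> extensional {..<nv}"
  by (simp add: pen_def)

lemma pen_subset_sp: "v < nv \<Longrightarrow> pen i A Q x y v \<subseteq> sp M v"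
  by (auto simp: pen_def)

lemma pen_obtain:
  assumes "v < nv" "a \<in> pen i A Q x y v" obtains c where "a = vec v c" "pcond i A Q x y v c"
  using assms by (auto simp: pen_def)

lemma graded_pen [simp]: "graded (pen i A Q x y)"
  by (simp add: graded_def pen_subset_sp)

lemma pen_eqI:
  assumes "graded N" "twin i" "\<And>v c. v < nv \<Longrightarrow> vec v c \<in> N v \<longleftrightarrow> pcond i A Q x y v c"
  shows "N = pen i A Q x y"
  using assms by (intro graded_eqI) (simp_all add: vec_in_pen)

lemma subspace_pen:
  assumes v: "v < nv" shows "vs.subspace (pen i A Q x y v)"
proof (rule vs.subspaceI)
  show "0 \<in> pen i A Q x y v"
    using v vec_0[of v] by (force simp: pen_def pcond_def)
next
  fix a b assume "a \<in> pen i A Q x y v" "b \<in> pen i A Q x y v"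
  then obtain c c' where c: "a = vec v c" "pcond i A Q x y v c" "b = vec v c'" "pcond i A Q x y v c'"
    using pen_obtain[OF v] by metis
  have "pcond i A Q x y v (\<lambda>j p. c j p + c' j p)"
    unfolding pcond_def
  proof (intro allI impI)
    fix j p assume jp: "(j, p) \<in> ix v"
    show "if (j = i \<or> j = Suc i) \<and> p \<in> A then x * (c (Suc i) p + c' (Suc i) p) = y * (c i p + c' i p)
        else c j p + c' j p \<noteq> 0 \<longrightarrow> (j, p) \<in> Q"
      using c(2)[unfolded pcond_def, rule_format, OF jp] c(4)[unfolded pcond_def, rule_format, OF jp]
      by (auto simp: distrib_left split: if_splits)
  qed
  then show "a + b \<in> pen i A Q x y v" using v c by (auto simp: pen_def vec_add)
next
  fix k a assume "a \<in> pen i A Q x y v"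
  then obtain c where c: "a = vec v c" "pcond i A Q x y v c" using pen_obtain[OF v] by metis
  have "pcond i A Q x y v (\<lambda>j p. k * c j p)"
    using c(2) unfolding pcond_def by (auto simp: mult.left_commute split: if_splits)
  then show "sc M k a \<in> pen i A Q x y v" using v c by (auto simp: pen_def vec_scale)
qed

lemma ar_pen:
  assumes P: "pencil i A Q" and v: "v < nv"
  shows "ar M v ` pen i A Q x y v \<subseteq> pen i A Q x y (nxt M v)"
proof
  fix b assume "b \<in> ar M v ` pen i A Q x y v"
  then obtain c where c: "b = ar M v (vec v c)" "pcond i A Q x y v c" using pen_obtain[OF v] by blast
  have "pcond i A Q x y (nxt M v) (shift_co c)"
    unfolding pcond_def
  proof (intro allI impI)
    fix j p assume jp: "(j, p) \<in> ix (nxt M v)"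
    show "if (j = i \<or> j = Suc i) \<and> p \<in> A then x * shift_co c (Suc i) p = y * shift_co c i p
        else shift_co c j p \<noteq> 0 \<longrightarrow> (j, p) \<in> Q"
    proof (cases p)
      case 0
      then show ?thesis by (simp add: shift_co_def)
    next
      case (Suc q)
      then have q: "(j, q) \<in> ix v" using jp v by (auto simp: idx_iff vtx_Suc_eq_nxt_iff)
      then have tq: "(i, q) \<in> ix v" "(Suc i, q) \<in> ix v" if "j = i \<or> j = Suc i"
        using that twin_idx[OF pencil_twin[OF P]] by auto
      have lt: "Suc q < len B j" using jp Suc by (simp add: idx_iff)
      have li: "len B (Suc i) = len B i" using P by (simp add: pencil_def twin_def)
      note cq = c(2)[unfolded pcond_def, rule_format]
      show ?thesis
      proof (cases "(j = i \<or> j = Suc i) \<and> p \<in> A")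
        case True
        \<comment> \<open>Off \<open>A\<close>, a nonzero coordinate at \<open>q\<close> would put
          \<open>q\<close>, hence also the next position \<open>p\<close>, into \<open>Q\<close>,
          which is disjoint from \<open>A\<close>. So the line condition at \<open>p\<close> is
          either inherited from \<open>q\<close> or trivial.\<close>
        have "q \<in> A \<or> (c i q = 0 \<and> c (Suc i) q = 0)"
        proof (rule ccontr)
          assume a: "\<not> (q \<in> A \<or> (c i q = 0 \<and> c (Suc i) q = 0))"
          then have "(i, q) \<in> Q \<or> (Suc i, q) \<in> Q"
            using cq[OF tq(1)] cq[OF tq(2)] True by auto
          then have "(i, p) \<in> Q \<or> (Suc i, p) \<in> Q"
            using P lt li True Suc unfolding pencil_def by auto
          then show False using P True unfolding pencil_def by auto
        qed
        then show ?thesis using True cq[OF q] Suc by (auto simp: shift_co_def)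
      next
        case False
        have "(j, p) \<in> Q" if "c j q \<noteq> 0"
        proof (cases "(j = i \<or> j = Suc i) \<and> q \<in> A")
          case True
          then show ?thesis using P False lt li Suc unfolding pencil_def by auto
        next
          case F: False
          then have "(j, q) \<in> Q" using cq[OF q] that by (simp split: if_splits)
          then show ?thesis using P lt Suc unfolding pencil_def by auto
        qed
        then show ?thesis using False Suc by (auto simp: shift_co_def)
      qed
    qed
  qed
  then show "b \<in> pen i A Q x y (nxt M v)" unfolding c(1) ar_vec[OF v] by (simp add: vec_in_pen pencil_twin[OF P])
qed

text \<open>Labels of a basis, the line at position \<open>p\<close> carrying the label
  \<open>(i, p)\<close>. They do not depend on the parameters, so all members with
  \<open>(x, y) \<noteq> (0, 0)\<close> have the same dimension vector.\<close>

definition pen_idx :: "nat \<Rightarrow> nat set \<Rightarrow> (nat \<times> nat) set \<Rightarrow> nat \<Rightarrow> (nat \<times> nat) set" where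
  "pen_idx i A Q v = {(j, p) \<in> ix v. (j, p) \<in> Q \<or> j = i \<and> p \<in> A}"

lemma finite_pen_idx [simp]: "finite (pen_idx i A Q v)"
  by (rule finite_subset[OF _ finite_idx[of v]]) (auto simp: pen_idx_def)

text \<open>A basis whose coordinates are constant or linear in \<open>x\<close> and
  \<open>y\<close>; this yields the continuity of the pencil.\<close>

definition pen_co :: "nat \<Rightarrow> nat set \<Rightarrow> complex \<Rightarrow> complex \<Rightarrow> nat \<times> nat \<Rightarrow> nat \<Rightarrow> nat \<Rightarrow> complex" where
  "pen_co i A x y a = (if fst a = i \<and> snd a \<in> A then pair_co i (snd a) x y else unit_co (fst a) (snd a))"

lemma pen_co_in_pen:
  assumes P: "pencil i A Q" and v: "v < nv" and a: "a \<in> pen_idx i A Q v"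
  shows "vec v (pen_co i A x y a) \<in> pen i A Q x y v"
proof -
  obtain j p where jp: "a = (j, p)" by (cases a)
  note Q = pencil_disjoint[OF P]
  have "pcond i A Q x y v (pen_co i A x y a)"
  proof (cases "j = i \<and> p \<in> A")
    case True
    then show ?thesis by (simp add: pcond_def pen_co_def jp pair_co_def)
  next
    case False
    then have "(j, p) \<in> Q" using a by (auto simp: jp pen_idx_def)
    then show ?thesis using False Q by (auto simp: pcond_def pen_co_def jp unit_co_def)
  qed
  then show ?thesis by (simp add: vec_in_pen[OF pencil_twin[OF P] v])
qed

lemma pen_eq_span:
  assumes P: "pencil i A Q" and v: "v < nv" and xy: "(x, y) \<noteq> (0, 0)"
  shows "pen i A Q x y v = vs.span ((\<lambda>a. vec v (pen_co i A x y a)) ` pen_idx i A Q v)"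
proof
  show "vs.span ((\<lambda>a. vec v (pen_co i A x y a)) ` pen_idx i A Q v) \<subseteq> pen i A Q x y v"
    using pen_co_in_pen[OF P v] by (intro vs.span_minimal subspace_pen v) auto
  show "pen i A Q x y v \<subseteq> vs.span ((\<lambda>a. vec v (pen_co i A x y a)) ` pen_idx i A Q v)"
  proof
    fix b assume "b \<in> pen i A Q x y v"
    then obtain c where c: "b = vec v c" "pcond i A Q x y v c" using pen_obtain[OF v] by metis
    \<comment> \<open>On a line, the coefficient is read off at whichever of the two parameters is
      nonzero.\<close>
    define r where "r = (\<lambda>(j, p). if j = i \<and> p \<in> A then if x \<noteq> 0 then c i p / x else c (Suc i) p / y else c j p)"
    have "vec v c = vec v (\<lambda>j p. \<Sum>a\<in>pen_idx i A Q v. r a * pen_co i A x y a j p)"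
    proof (rule vec_cong)
      fix j p assume jp: "(j, p) \<in> ix v"
      note cjp = c(2)[unfolded pcond_def, rule_format, OF jp]
      show "c j p = (\<Sum>a\<in>pen_idx i A Q v. r a * pen_co i A x y a j p)"
      proof (cases "(j = i \<or> j = Suc i) \<and> p \<in> A")
        case True
        then have ip: "(i, p) \<in> pen_idx i A Q v"
          using jp twin_idx[OF pencil_twin[OF P]] by (auto simp: pen_idx_def)
        have "(\<Sum>a\<in>pen_idx i A Q v. r a * pen_co i A x y a j p)
            = (\<Sum>a\<in>pen_idx i A Q v. if a = (i, p) then r a * pair_co i p x y j p else 0)"
          using True pencil_disjoint[OF P]
          by (intro sum.cong) (auto simp: pen_co_def pair_co_def unit_co_def pen_idx_def)
        also have "\<dots> = r (i, p) * pair_co i p x y j p" using ip by simp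
        also have "\<dots> = c j p"
          using True cjp xy by (auto simp: r_def pair_co_def field_simps split: if_splits)
        finally show ?thesis by simp
      next
        case False
        have "(\<Sum>a\<in>pen_idx i A Q v. r a * pen_co i A x y a j p)
            = (\<Sum>a\<in>pen_idx i A Q v. if a = (j, p) then c j p else 0)"
          using False
          by (intro sum.cong) (auto simp: pen_co_def pair_co_def unit_co_def r_def)
        also have "\<dots> = (if (j, p) \<in> pen_idx i A Q v then c j p else 0)" by simp
        also have "\<dots> = c j p"
          using False cjp jp by (auto simp: pen_idx_def)
        finally show ?thesis by simp
      qed
    qed
    also have "\<dots> = (\<Sum>a\<in>pen_idx i A Q v. sc M (r a) (vec v (pen_co i A x y a)))"
      by (simp add: vec_scale vec_sum)
    finally show "b \<in> vs.span ((\<lambda>a. vec v (pen_co i A x y a)) ` pen_idx i A Q v)"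
      unfolding c(1) by (auto intro!: vs.span_sum vs.span_scale intro: vs.span_base)
  qed
qed

lemma dim_pen:
  assumes P: "pencil i A Q" and v: "v < nv" and xy: "(x, y) \<noteq> (0, 0)"
  shows "vs.dim (pen i A Q x y v) = card (pen_idx i A Q v)"
proof -
  let ?u = "\<lambda>a. vec v (pen_co i A x y a)" and ?I = "pen_idx i A Q v"
  \<comment> \<open>A pivot: among the basis vectors, only the one labelled \<open>a\<close> has a
    nonzero coordinate at \<open>k a\<close>. For \<open>x = 0\<close> a line has no component at
    \<open>i\<close>, so its pivot moves to \<open>Suc i\<close>.\<close>
  define k where "k = (\<lambda>a::nat \<times> nat. if fst a = i \<and> snd a \<in> A \<and> x = 0 then (Suc i, snd a) else a)"
  have kI: "k a \<in> ix v" if "a \<in> ?I" for a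
    using that twin_idx[OF pencil_twin[OF P]] by (auto simp: pen_idx_def k_def)
  have k1: "pen_co i A x y a (fst (k a)) (snd (k a)) \<noteq> 0" if "a \<in> ?I" for a
    using that xy by (auto simp: pen_co_def k_def pair_co_def unit_co_def)
  have k0: "pen_co i A x y b (fst (k a)) (snd (k a)) = 0" if "a \<in> ?I" "b \<in> ?I" "b \<noteq> a" for a b
    using that pencil_disjoint[OF P]
    by (cases a; cases b) (auto simp: pen_co_def k_def pair_co_def unit_co_def pen_idx_def split: if_splits)
  have inj: "inj_on ?u ?I"
  proof (rule inj_onI, rule ccontr)
    fix a b assume ab: "a \<in> ?I" "b \<in> ?I" "?u a = ?u b" "a \<noteq> b"
    then have "pen_co i A x y a (fst (k a)) (snd (k a)) = pen_co i A x y b (fst (k a)) (snd (k a))"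
      using vec_eqD[OF ab(3) v] kI[OF ab(1)] by (cases "k a") auto
    then show False using k0[of a b] k1[of a] ab by simp
  qed
  have "vs.independent (?u ` ?I)"
  proof (rule vs.independent_if_scalars_zero)
    show "finite (?u ` ?I)" by simp
    fix f b assume z: "(\<Sum>z\<in>?u ` ?I. sc M (f z) z) = 0" and "b \<in> ?u ` ?I"
    then obtain a where a: "b = ?u a" "a \<in> ?I" by blast
    have "vec v (\<lambda>j p. \<Sum>z\<in>?I. f (?u z) * pen_co i A x y z j p) = vec v (\<lambda>j p. 0)"
      using z by (simp add: sum.reindex[OF inj] vec_scale vec_sum)
    from vec_eqD[OF this v, of "fst (k a)" "snd (k a)"] kI[OF a(2)]
    have "(\<Sum>z\<in>?I. f (?u z) * pen_co i A x y z (fst (k a)) (snd (k a))) = 0" by simp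
    moreover have "(\<Sum>z\<in>?I. f (?u z) * pen_co i A x y z (fst (k a)) (snd (k a)))
        = (\<Sum>z\<in>?I. if z = a then f b * pen_co i A x y a (fst (k a)) (snd (k a)) else 0)"
      using k0[OF a(2)] a by (intro sum.cong) auto
    ultimately show "f b = 0" using a k1[OF a(2)] by simp
  qed
  then have "vs.dim (vs.span (?u ` ?I)) = card (?u ` ?I)" by (rule vs.dim_span_eq_card_independent)
  then show ?thesis using pen_eq_span[OF P v xy] card_image[OF inj] by simp
qed

lemma pen_in_Gr:
  assumes P: "pencil i A Q" and card: "\<And>v. v < nv \<Longrightarrow> card (pen_idx i A Q v) = e v"
    and xy: "(x, y) \<noteq> (0, 0)"
  shows "pen i A Q x y \<in> Gr M e"
  unfolding Gr_iff
proof (intro conjI allI impI)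
  fix v assume v: "v < nv"
  show "vs.subspace (pen i A Q x y v)" using v by (rule subspace_pen)
  show "pen i A Q x y v \<subseteq> sp M v" using v by (rule pen_subset_sp)
  show "vs.dim (pen i A Q x y v) = e v"
    using dim_pen[OF P v xy] card[OF v] by simp
  show "ar M v ` pen i A Q x y v \<subseteq> pen i A Q x y (nxt M v)" using P v by (rule ar_pen)
qed simp

lemma pen_scale: "a \<noteq> 0 \<Longrightarrow> pen i A Q (a * x) (a * y) = pen i A Q x y"
  by (simp add: pen_def pcond_def)

lemma pen_eq_imp:
  assumes P: "pencil i A Q" and eq: "pen i A Q x y = pen i A Q x' y'" and A: "A \<noteq> {}"
  shows "x * y' = x' * y"
proof -
  obtain p where p: "p \<in> A" using A by blast
  let ?v = "vx i p"
  have ip: "(i, p) \<in> pen_idx i A Q ?v" using P p by (auto simp: pen_idx_def idx_iff pencil_def twin_def)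
  have "vec ?v (pair_co i p x y) \<in> pen i A Q x y ?v"
    using pen_co_in_pen[OF P _ ip, of x y] p by (simp add: pen_co_def)
  then have "pcond i A Q x' y' ?v (pair_co i p x y)"
    unfolding eq by (simp add: vec_in_pen pencil_twin[OF P])
  then have "x' * pair_co i p x y (Suc i) p = y' * pair_co i p x y i p"
    using ip p unfolding pcond_def pen_idx_def by auto
  then show ?thesis by (simp add: pair_co_def mult.commute)
qed

text \<open>Both vectors spanning the plane at position \<open>p\<close> carry the factor
  \<open>\<gamma> 0 ^ p\<close>, so only the ratio of \<open>\<gamma> i\<close> and
  \<open>\<gamma> (Suc i)\<close> moves a line, and it moves the lines at all positions in the same
  way.\<close>

lemma torus_act_pen:
  assumes i: "twin i" and \<gamma>: "\<gamma> \<in> torus B"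
  shows "tact \<gamma> (pen i A Q x y) = pen i A Q (\<gamma> i * x) (\<gamma> (Suc i) * y)"
proof (rule pen_eqI[OF graded_torus_act[OF graded_pen] i])
  fix v and c :: "nat \<Rightarrow> nat \<Rightarrow> complex" assume v: "v < nv"
  let ?c = "\<lambda>j p. c j p / (\<gamma> 0 ^ p * \<gamma> j)"
  have line: "x * ?c (Suc i) p = y * ?c i p \<longleftrightarrow> \<gamma> i * x * c (Suc i) p = \<gamma> (Suc i) * y * c i p" for p
    using torus_nonzero[OF \<gamma>] i by (simp add: twin_def field_simps)
  have nz: "?c j p \<noteq> 0 \<longleftrightarrow> c j p \<noteq> 0" if "(j, p) \<in> ix v" for j p
    using that torus_nonzero[OF \<gamma>] by (simp add: idx_iff)
  have "pcond i A Q x y v ?c \<longleftrightarrow> pcond i A Q (\<gamma> i * x) (\<gamma> (Suc i) * y) v c"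
    unfolding pcond_def line using nz by auto
  then show "vec v c \<in> tact \<gamma> (pen i A Q x y) v \<longleftrightarrow> pcond i A Q (\<gamma> i * x) (\<gamma> (Suc i) * y) v c"
    by (simp only: vec_in_torus_act_iff[OF \<gamma> v graded_pen] vec_in_pen[OF i v])
qed

end

section \<open>Subrepresentations invariant under the kernel of a root\<close>

lemma subspace_complex2_line:
  fixes F :: "(complex \<times> complex) set"
  assumes 0: "(0, 0) \<in> F"
    and add: "\<And>s t s' t'. (s, t) \<in> F \<Longrightarrow> (s', t') \<in> F \<Longrightarrow> (s + s', t + t') \<in> F"
    and scale: "\<And>k s t. (s, t) \<in> F \<Longrightarrow> (k * s, k * t) \<in> F"
    and proper: "F \<noteq> {(0, 0)}" "F \<noteq> UNIV"
  shows "\<exists>x y. (x, y) \<in> F \<and> (x, y) \<noteq> (0, 0)"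
    and "(x, y) \<in> F \<Longrightarrow> (x, y) \<noteq> (0, 0) \<Longrightarrow> F = {(s, t). x * t = y * s}"
proof -
  show "\<exists>x y. (x, y) \<in> F \<and> (x, y) \<noteq> (0, 0)" using proper(1) 0 by auto
  assume xy: "(x, y) \<in> F" "(x, y) \<noteq> (0, 0)"
  show "F = {(s, t). x * t = y * s}"
  proof
    show "F \<subseteq> {(s, t). x * t = y * s}"
    proof (clarify, rule ccontr)
      fix s t assume st: "(s, t) \<in> F" "x * t \<noteq> y * s"
      define D where "D = x * t - y * s"
      have D: "D \<noteq> 0" using st by (simp add: D_def)
      have "(a, b) \<in> F" for a b
      proof -
        \<comment> \<open>The coefficients come from Cramer's rule.\<close>
        have "((a * t - b * s) / D * x + (x * b - y * a) / D * s,
            (a * t - b * s) / D * y + (x * b - y * a) / D * t) \<in> F"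
          by (intro add scale xy st)
        moreover have "(a * t - b * s) / D * x + (x * b - y * a) / D * s = a"
          using D by (simp add: divide_simps) (simp add: D_def algebra_simps)
        moreover have "(a * t - b * s) / D * y + (x * b - y * a) / D * t = b"
          using D by (simp add: divide_simps) (simp add: D_def algebra_simps)
        ultimately show ?thesis by simp
      qed
      then have "F = UNIV" by auto
      then show False using proper(2) by blast
    qed
    show "{(s, t). x * t = y * s} \<subseteq> F"
    proof clarify
      fix s t assume eq: "x * t = y * s"
      show "(s, t) \<in> F"
      proof (cases "x = 0")
        case True
        then have "(t / y * x, t / y * y) = (s, t)" using xy eq by auto
        then show ?thesis using scale[OF xy(1), of "t / y"] by simp
      next
        case x: False
        then have "(s / x * x, s / x * y) = (s, t)" using eq by (simp add: field_simps)
        then show ?thesis using scale[OF xy(1), of "s / x"] by simp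
      qed
    qed
  qed
qed

context seg_rep
begin

lemma shift_pair_co: "shift_co (pair_co i p x y) = pair_co i (Suc p) x y"
  by (auto simp: fun_eq_iff shift_co_def pair_co_def split: nat.splits)

lemma vec_pair_co_add: "vec v (pair_co i p x y) + vec v (pair_co i p x' y') = vec v (pair_co i p (x + x') (y + y'))"
  unfolding vec_add by (intro vec_cong) (simp add: pair_co_def)

lemma vec_pair_co_scale: "sc M k (vec v (pair_co i p x y)) = vec v (pair_co i p (k * x) (k * y))"
  unfolding vec_scale by (intro vec_cong) (simp add: pair_co_def)

text \<open>The trace of \<open>N\<close> on the plane at position \<open>p\<close>. For twins and
  \<open>p\<close> beyond their length the vector in question is 0, so the fiber of a
  subrepresentation is everything and the inclusions along the chain hold for all
  \<open>p\<close>.\<close>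

definition fiber :: "nat \<Rightarrow> (nat \<Rightarrow> 'v set) \<Rightarrow> nat \<Rightarrow> (complex \<times> complex) set" where
  "fiber i N p = {(x, y). vec (vx i p) (pair_co i p x y) \<in> N (vx i p)}"

lemma fiber_line:
  assumes N: "N \<in> Gr M e" and "fiber i N p \<noteq> {(0, 0)}" "fiber i N p \<noteq> UNIV"
  shows "\<exists>x y. (x, y) \<in> fiber i N p \<and> (x, y) \<noteq> (0, 0)"
    and "(x, y) \<in> fiber i N p \<Longrightarrow> (x, y) \<noteq> (0, 0) \<Longrightarrow> fiber i N p = {(s, t). x * t = y * s}"
proof -
  let ?v = "vx i p"
  have sub: "vs.subspace (N ?v)" using N by (simp add: Gr_iff)
  have "vec ?v (pair_co i p 0 0) = vec ?v (\<lambda>j p. 0)" by (rule vec_cong) (simp add: pair_co_def)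
  then have 0: "(0, 0) \<in> fiber i N p" using vs.subspace_0[OF sub] by (simp add: fiber_def)
  have add: "(s + s', t + t') \<in> fiber i N p" if "(s, t) \<in> fiber i N p" "(s', t') \<in> fiber i N p" for s t s' t'
    using that vs.subspace_add[OF sub] by (simp add: fiber_def vec_pair_co_add[symmetric])
  have scale: "(k * s, k * t) \<in> fiber i N p" if "(s, t) \<in> fiber i N p" for k s t
    using that vs.subspace_scale[OF sub] by (simp add: fiber_def vec_pair_co_scale[symmetric])
  note line = subspace_complex2_line[OF 0 add scale assms(2,3)]
  show "\<exists>x y. (x, y) \<in> fiber i N p \<and> (x, y) \<noteq> (0, 0)" by (rule line(1))
  show "(x, y) \<in> fiber i N p \<Longrightarrow> (x, y) \<noteq> (0, 0) \<Longrightarrow> fiber i N p = {(s, t). x * t = y * s}"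
    by (rule line(2))
qed

lemma fiber_Suc:
  assumes N: "N \<in> Gr M e" shows "fiber i N p \<subseteq> fiber i N (Suc p)"
proof clarify
  fix x y assume "(x, y) \<in> fiber i N p"
  then have "ar M (vx i p) (vec (vx i p) (pair_co i p x y)) \<in> N (nxt M (vx i p))"
    using N by (auto simp: Gr_iff fiber_def image_subset_iff)
  then show "(x, y) \<in> fiber i N (Suc p)"
    by (simp add: ar_vec shift_pair_co fiber_def vtx_Suc)
qed

lemma fiber_mono: "N \<in> Gr M e \<Longrightarrow> p \<le> p' \<Longrightarrow> fiber i N p \<subseteq> fiber i N p'"
  using lift_Suc_mono_le[of "fiber i N" p p'] fiber_Suc by blast

text \<open>Fibers grow along the arrows, and a line contained in a line equals it. Hence one
  parameter serves all positions.\<close>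

lemma fiber_line_eq:
  assumes N: "N \<in> Gr M e"
    and p: "fiber i N p \<noteq> {(0, 0)}" "fiber i N p \<noteq> UNIV"
    and p': "fiber i N p' \<noteq> {(0, 0)}" "fiber i N p' \<noteq> UNIV"
  shows "fiber i N p = fiber i N p'"
proof -
  have "fiber i N p = fiber i N p'"
    if le: "p \<le> p'" and p: "fiber i N p \<noteq> {(0, 0)}" "fiber i N p \<noteq> UNIV"
      and p': "fiber i N p' \<noteq> {(0, 0)}" "fiber i N p' \<noteq> UNIV" for p p'
  proof -
    obtain x y where xy: "(x, y) \<in> fiber i N p" "(x, y) \<noteq> (0, 0)"
      using fiber_line(1)[OF N p] by blast
    then have xy': "(x, y) \<in> fiber i N p'" using fiber_mono[OF N le] by blast
    show ?thesis
      unfolding fiber_line(2)[OF N p xy] fiber_line(2)[OF N p' xy' xy(2)] ..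
  qed
  from this[of p p'] this[of p' p] p p' show ?thesis using nat_le_linear by metis
qed

text \<open>\<open>A\<close> collects the positions where the fiber is a line, \<open>Q\<close>
  those where it is the whole plane, together with the basis vectors of the other summands that lie
  in \<open>N\<close>.\<close>

lemma partially_fixed_imp_pen:
  assumes i: "twin i" and N: "N \<in> Gr M e" and pf: "partially_fixed i N"
  obtains A Q x y where "pencil i A Q" "(x, y) \<noteq> (0, 0)" "N = pen i A Q x y"
proof -
  let ?F = "fiber i N"
  define A where "A = {p. p < len B i \<and> ?F p \<noteq> {(0, 0)} \<and> ?F p \<noteq> UNIV}"
  define Q where "Q = {(j, p). 1 \<le> j \<and> j \<le> num B \<and> p < len B j \<and>
    (if j = i \<or> j = Suc i then ?F p = UNIV else bv B j p \<in> N (vx j p))}"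
  have "\<exists>x y. (x, y) \<noteq> (0, 0) \<and> (\<forall>p\<in>A. ?F p = {(s, t). x * t = y * s})"
  proof (cases "A = {}")
    case True
    \<comment> \<open>Without lines the parameter is arbitrary.\<close>
    then show ?thesis by (intro exI[of _ 1]) auto
  next
    case False
    then obtain p0 where p0: "p0 \<in> A" by blast
    then have "?F p0 \<noteq> {(0, 0)}" "?F p0 \<noteq> UNIV" by (simp_all add: A_def)
    note cases = fiber_line[OF N this]
    obtain x y where xy: "(x, y) \<in> ?F p0" "(x, y) \<noteq> (0, 0)" using cases(1) by blast
    note line = cases(2)[OF xy]
    have "?F p = ?F p0" if "p \<in> A" for p
      using fiber_line_eq[OF N, of i p p0] that p0 by (simp add: A_def)
    then show ?thesis using xy(2) line by metis
  qed
  then obtain x y where xy: "(x, y) \<noteq> (0, 0)" and line: "\<And>p. p \<in> A \<Longrightarrow> ?F p = {(s, t). x * t = y * s}"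
    by blast
  have leni: "len B (Suc i) = len B i" "1 \<le> i" "Suc i \<le> num B" using i by (auto simp: twin_def)
  have bvQ: "bv B j (Suc p) \<in> N (vx j (Suc p))"
    if "bv B j p \<in> N (vx j p)" "1 \<le> j" "j \<le> num B" "Suc p < len B j" for j p
  proof -
    have "ar M (vx j p) (bv B j p) \<in> N (nxt M (vx j p))"
      using N that(1) by (auto simp: Gr_iff image_subset_iff)
    moreover have "(j, p) \<in> ix (vx j p)" using that by (simp add: idx_iff)
    ultimately show ?thesis using that(4) by (simp add: ar_bv vtx_Suc)
  qed
  have P: "pencil i A Q"
    unfolding pencil_def
  proof (intro conjI allI ballI impI)
    show "twin i" by (rule i)
    fix p assume p: "p \<in> A"
    then show "p < len B i" "(i, p) \<notin> Q" "(Suc i, p) \<notin> Q" by (auto simp: A_def Q_def)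
    assume lt: "Suc p < len B i"
    \<comment> \<open>Since fibers grow, a line is followed by a line or by the whole plane.\<close>
    have "?F (Suc p) \<noteq> {(0, 0)}"
    proof
      assume "?F (Suc p) = {(0, 0)}"
      then have "?F p \<subseteq> {(0, 0)}" using fiber_Suc[OF N, of i p] by simp
      moreover have "(x, y) \<in> ?F p" using line[OF p] by simp
      ultimately show False using xy by auto
    qed
    then show "Suc p \<in> A \<or> (i, Suc p) \<in> Q \<and> (Suc i, Suc p) \<in> Q"
      using lt leni by (auto simp: A_def Q_def)
  next
    fix j p assume jp: "(j, p) \<in> Q" and lt: "Suc p < len B j"
    show "(j, Suc p) \<in> Q"
    proof (cases "j = i \<or> j = Suc i")
      case True
      then have "?F p = UNIV" using jp by (auto simp: Q_def split: if_splits)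
      then have "?F (Suc p) = UNIV" using fiber_Suc[OF N, of i p] by blast
      then show ?thesis using jp lt True by (auto simp: Q_def)
    next
      case False
      then show ?thesis using jp lt bvQ by (auto simp: Q_def)
    qed
  next
    fix p show "(i, p) \<in> Q \<longleftrightarrow> (Suc i, p) \<in> Q" using leni by (auto simp: Q_def)
  qed
  have "N = pen i A Q x y"
  proof (rule pen_eqI[OF graded_Gr[OF N] i])
    fix v and c :: "nat \<Rightarrow> nat \<Rightarrow> complex" assume v: "v < nv"
    let ?pair = "\<lambda>p. if p \<in> A then x * c (Suc i) p = y * c i p
      else (c i p \<noteq> 0 \<longrightarrow> (i, p) \<in> Q) \<and> (c (Suc i) p \<noteq> 0 \<longrightarrow> (Suc i, p) \<in> Q)"
    let ?rest = "\<forall>(j, p)\<in>ix v. j \<noteq> i \<longrightarrow> j \<noteq> Suc i \<longrightarrow> c j p \<noteq> 0 \<longrightarrow> (j, p) \<in> Q"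
    have 1: "(\<forall>p. (i, p) \<in> ix v \<longrightarrow> vec v (pair_co i p (c i p) (c (Suc i) p)) \<in> N v)
        \<longleftrightarrow> (\<forall>p. (i, p) \<in> ix v \<longrightarrow> ?pair p)"
    proof (intro all_cong)
      fix p assume p: "(i, p) \<in> ix v"
      have "vec v (pair_co i p (c i p) (c (Suc i) p)) \<in> N v \<longleftrightarrow> (c i p, c (Suc i) p) \<in> ?F p"
        using p by (auto simp: fiber_def idx_iff)
      also have "\<dots> \<longleftrightarrow> ?pair p"
      proof (cases "p \<in> A")
        case True
        then show ?thesis using line[OF True] by simp
      next
        case False
        then have "?F p = {(0, 0)} \<or> ?F p = UNIV" using p by (auto simp: A_def idx_iff)
        moreover have "(i, p) \<in> Q \<longleftrightarrow> ?F p = UNIV" "(Suc i, p) \<in> Q \<longleftrightarrow> ?F p = UNIV"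
          using p leni by (auto simp: Q_def idx_iff)
        moreover have "(UNIV :: (complex \<times> complex) set) \<noteq> {(0, 0)}"
        proof
          assume "(UNIV :: (complex \<times> complex) set) = {(0, 0)}"
          then have "(1, 1) \<in> {(0 :: complex, 0 :: complex)}" by blast
          then show False by simp
        qed
        ultimately show ?thesis using False by auto
      qed
      finally show "vec v (pair_co i p (c i p) (c (Suc i) p)) \<in> N v \<longleftrightarrow> ?pair p" .
    qed
    have 2: "(\<forall>(j, p)\<in>ix v. j \<noteq> i \<longrightarrow> j \<noteq> Suc i \<longrightarrow> c j p \<noteq> 0 \<longrightarrow> bv B j p \<in> N v)
        \<longleftrightarrow> ?rest"
    proof -
      have "bv B j p \<in> N v \<longleftrightarrow> (j, p) \<in> Q" if "(j, p) \<in> ix v" "j \<noteq> i" "j \<noteq> Suc i" for j p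
        using that by (simp add: Q_def idx_iff)
      then show ?thesis by blast
    qed
    show "vec v c \<in> N v \<longleftrightarrow> pcond i A Q x y v c"
      unfolding partially_fixed_vec_iff[OF i N pf v, of c] 1 2
    proof
      assume a: "?rest \<and>
        (\<forall>p. (i, p) \<in> ix v \<longrightarrow> ?pair p)"
      show "pcond i A Q x y v c"
        unfolding pcond_def
      proof (intro allI impI)
        fix j p assume jp: "(j, p) \<in> ix v"
        show "if (j = i \<or> j = Suc i) \<and> p \<in> A then x * c (Suc i) p = y * c i p else c j p \<noteq> 0 \<longrightarrow> (j, p) \<in> Q"
        proof (cases "j = i \<or> j = Suc i")
          case True
          then have "(i, p) \<in> ix v" using jp twin_idx[OF i] by auto
          with a have "?pair p" by blast
          then show ?thesis using True by (auto split: if_splits)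
        next
          case False
          then show ?thesis using a jp by auto
        qed
      qed
    next
      assume a: "pcond i A Q x y v c"
      have "?pair p"
        if ip: "(i, p) \<in> ix v" for p
        using a[unfolded pcond_def, rule_format, OF ip] a[unfolded pcond_def, rule_format, of "Suc i" p]
          ip twin_idx[OF i] by auto
      moreover have "(j, p) \<in> Q" if "(j, p) \<in> ix v" "j \<noteq> i" "j \<noteq> Suc i" "c j p \<noteq> 0" for j p
        using a[unfolded pcond_def, rule_format, OF that(1)] that by simp
      ultimately show "?rest \<and>
        (\<forall>p. (i, p) \<in> ix v \<longrightarrow> ?pair p)" by blast
    qed
  qed
  then show thesis using that P xy by blast
qed

section \<open>The topology of the closure of an orbit\<close>

lemma topspace_Gr_top [simp]: "topspace (Top e) = Gr M e"
proof
  show "topspace (Top e) \<subseteq> Gr M e"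
    using openin_topspace[of "Top e"] unfolding openin_Gr_top by blast
  have "{c \<in> Frm e. fspan e c \<in> Gr M e} = Frm e"
    by (auto simp: frames_def)
  then have "openin (Top e) (Gr M e)"
    unfolding openin_Gr_top by simp
  then show "Gr M e \<subseteq> topspace (Top e)" by (rule openin_subset)
qed

lemma frame_span_apply:
  "v < nv \<Longrightarrow> fspan e c v = vs.span ((\<lambda>k. vec v (c v k)) ` {..<e v})"
  by (simp add: frame_span_def vec_def)

lemma frame_span_ext [simp]: "fspan e c \<in> extensional {..<nv}"
  by (simp add: frame_span_def)

lemma continuous_on_frame_coord:
  "continuous_on S (\<lambda>c :: nat \<Rightarrow> nat \<Rightarrow> nat \<Rightarrow> nat \<Rightarrow> complex. c v k j p)"
proof -
  have 1: "continuous_on S (\<lambda>c :: nat \<Rightarrow> nat \<Rightarrow> nat \<Rightarrow> nat \<Rightarrow> complex. c v)"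
    by (rule continuous_on_product_then_coordinatewise[OF continuous_on_id])
  show ?thesis
    by (rule continuous_on_product_then_coordinatewise[OF
      continuous_on_product_then_coordinatewise[OF continuous_on_product_then_coordinatewise[OF 1]]])
qed

text \<open>A pencil that really varies and whose members have dimension vector \<open>e\<close>,
  the latter being expressed without reference to the parameters.\<close>

definition full_pencil :: "(nat \<Rightarrow> nat) \<Rightarrow> nat \<Rightarrow> nat set \<Rightarrow> (nat \<times> nat) set \<Rightarrow> bool" where
  "full_pencil e i A Q \<longleftrightarrow> pencil i A Q \<and> A \<noteq> {} \<and> (\<forall>v<nv. card (pen_idx i A Q v) = e v)"

lemma full_pencilD: "full_pencil e i A Q \<Longrightarrow> pencil i A Q"
  by (simp add: full_pencil_def)

lemma full_pencilI:
  assumes P: "pencil i A Q" and "A \<noteq> {}" and N: "pen i A Q x y \<in> Gr M e" "(x, y) \<noteq> (0, 0)"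
  shows "full_pencil e i A Q"
  using assms dim_pen[OF P _ N(2)] by (simp add: full_pencil_def Gr_iff)

lemma full_pencil_Gr: "full_pencil e i A Q \<Longrightarrow> (x, y) \<noteq> (0, 0) \<Longrightarrow> pen i A Q x y \<in> Gr M e"
  by (rule pen_in_Gr) (simp_all add: full_pencil_def)

text \<open>Continuity of the pencil in its parameters. The topology is a quotient of the space of
  frames, so the parametrisation is lifted to frames by enumerating the labels of the basis.\<close>

lemma open_pen_vimage:
  assumes P: "full_pencil e i A Q" and U: "openin (Top e) U"
  shows "open {z. z \<noteq> (0, 0) \<and> pen i A Q (fst z) (snd z) \<in> U}"
proof -
  have "\<forall>v. \<exists>h. v < nv \<longrightarrow> h ` {..<e v} = pen_idx i A Q v"
  proof
    fix v
    have "\<exists>h. h ` {..<e v} = pen_idx i A Q v" if "v < nv"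
      using ex_bij_betw_nat_finite[OF finite_pen_idx[of i A Q v]] P that
      by (auto simp: full_pencil_def bij_betw_def lessThan_atLeast0)
    then show "\<exists>h. v < nv \<longrightarrow> h ` {..<e v} = pen_idx i A Q v" by blast
  qed
  then obtain h where h: "\<And>v. v < nv \<Longrightarrow> h v ` {..<e v} = pen_idx i A Q v" by metis
  define fr where "fr = (\<lambda>z v k. pen_co i A (fst z) (snd z) (h v k))"
  have span: "fspan e (fr z) = pen i A Q (fst z) (snd z)" if "z \<noteq> (0, 0)" for z
  proof (rule extensionalityI[OF frame_span_ext pen_ext])
    fix v assume "v \<in> {..<nv}"
    then have v: "v < nv" by simp
    have "(\<lambda>k. vec v (fr z v k)) ` {..<e v} = (\<lambda>a. vec v (pen_co i A (fst z) (snd z) a)) ` pen_idx i A Q v"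
      unfolding h[OF v, symmetric] by (simp add: fr_def image_image)
    then show "fspan e (fr z) v = pen i A Q (fst z) (snd z) v"
      using that by (simp add: frame_span_apply[OF v] pen_eq_span[OF full_pencilD[OF P] v] prod_eq_iff)
  qed
  have cont: "continuous_on UNIV fr"
  proof (intro continuous_on_coordinatewise_then_product)
    fix v k j p
    show "continuous_on UNIV (\<lambda>z. fr z v k j p)"
    proof (cases "fst (h v k) = i \<and> snd (h v k) \<in> A")
      case True
      then show ?thesis
        by (cases "p = snd (h v k) \<and> j = i"; cases "p = snd (h v k) \<and> j = Suc i")
          (auto simp: fr_def pen_co_def pair_co_def intro!: continuous_intros)
    next
      case False
      then have eq: "(\<lambda>z. fr z v k j p) = (\<lambda>z. unit_co (fst (h v k)) (snd (h v k)) j p)"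
        by (auto simp: fr_def pen_co_def)
      show ?thesis unfolding eq by (rule continuous_on_const)
    qed
  qed
  obtain T where T: "open T" "{c \<in> Frm e. fspan e c \<in> U} = Frm e \<inter> T"
    using U unfolding openin_Gr_top openin_open by blast
  have fr: "fr z \<in> Frm e" if "z \<noteq> (0, 0)" for z
    using full_pencil_Gr[OF P, of "fst z" "snd z"] that span[OF that] by (simp add: frames_def prod_eq_iff)
  have "{z. z \<noteq> (0, 0) \<and> pen i A Q (fst z) (snd z) \<in> U} = fr -` T \<inter> (- {(0, 0)})"
  proof (rule Set.set_eqI)
    fix z :: "complex \<times> complex"
    show "z \<in> {z. z \<noteq> (0, 0) \<and> pen i A Q (fst z) (snd z) \<in> U} \<longleftrightarrow> z \<in> fr -` T \<inter> (- {(0, 0)})"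
    proof (cases "z = (0, 0)")
      case False
      then have "fspan e (fr z) \<in> U \<longleftrightarrow> fr z \<in> T" using T(2) fr[OF False] by blast
      then show ?thesis using False span[OF False] by simp
    qed simp
  qed
  moreover have "open (fr -` T)" using T(1) cont by (rule open_vimage)
  ultimately show ?thesis by (simp add: open_Int open_delete open_Compl)
qed

text \<open>Both sides have dimension \<open>e v\<close> at \<open>v\<close>. This is why testing
  the vectors of a frame by \<open>pcond\<close> suffices to recognise a member of the
  pencil.\<close>

lemma pen_eqI_subset:
  assumes P: "full_pencil e i A Q" and xy: "(x, y) \<noteq> (0, 0)" and N: "N \<in> Gr M e"
    and sub: "\<And>v. v < nv \<Longrightarrow> N v \<subseteq> pen i A Q x y v"
  shows "N = pen i A Q x y"
proof (rule extensionalityI[OF _ pen_ext])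
  show "N \<in> extensional {..<nv}" using N by (simp add: Gr_iff)
  fix v assume "v \<in> {..<nv}"
  then have v: "v < nv" by simp
  let ?Y = "(\<lambda>a. vec v (pen_co i A x y a)) ` pen_idx i A Q v"
  note eq = pen_eq_span[OF full_pencilD[OF P] v xy]
  have "card ?Y \<le> e v" using card_image_le[OF finite_pen_idx] P v by (metis full_pencil_def)
  then have "vs.span ?Y \<subseteq> N v"
    using N v sub[OF v] unfolding eq by (intro span_subset_if_card_le_dim) (auto simp: Gr_iff)
  then show "N v = pen i A Q x y v" using sub[OF v] eq by blast
qed

lemma frame_span_eq_pen_iff:
  assumes P: "full_pencil e i A Q" and xy: "(x, y) \<noteq> (0, 0)" and c: "c \<in> Frm e"
  shows "fspan e c = pen i A Q x y \<longleftrightarrow> (\<forall>v k. v < nv \<longrightarrow> k < e v \<longrightarrow> pcond i A Q x y v (c v k))"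
proof
  note i = pencil_twin[OF full_pencilD[OF P]]
  assume eq: "fspan e c = pen i A Q x y"
  show "\<forall>v k. v < nv \<longrightarrow> k < e v \<longrightarrow> pcond i A Q x y v (c v k)"
  proof (intro allI impI)
    fix v k assume v: "v < nv" "k < e v"
    then have "vec v (c v k) \<in> fspan e c v"
      by (auto simp: frame_span_apply intro: vs.span_base)
    then show "pcond i A Q x y v (c v k)" unfolding eq by (simp add: vec_in_pen[OF i v(1)])
  qed
next
  note i = pencil_twin[OF full_pencilD[OF P]]
  assume a: "\<forall>v k. v < nv \<longrightarrow> k < e v \<longrightarrow> pcond i A Q x y v (c v k)"
  show "fspan e c = pen i A Q x y"
  proof (rule pen_eqI_subset[OF P xy])
    show "fspan e c \<in> Gr M e" using c by (simp add: frames_def)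
    fix v assume v: "v < nv"
    show "fspan e c v \<subseteq> pen i A Q x y v"
      unfolding frame_span_apply[OF v]
      using a v by (intro vs.span_minimal subspace_pen) (auto simp: vec_in_pen[OF i v])
  qed
qed

text \<open>The members of the pencil over a closed set of parameters \<open>y / x\<close> containing \<open>0\<close> and \<open>\<infinity>\<close> are cut
  out by the vanishing of coordinates and of the \<open>2 \<times> 2\<close> minors formed by the coordinates at \<open>b\<^sub>i\<^sub>p\<close> and
  \<open>b\<^sub>i\<^sub>+\<^sub>1\<^sub>p\<close>, together with the condition on the parameter.\<close>

lemma openin_complement_pen:
  assumes P: "full_pencil e i A Q" and W: "open W"
  shows "openin (Top e) (Gr M e - {N. \<exists>x y. (x, y) \<noteq> (0, 0) \<and> (x = 0 \<or> y = 0 \<or> y / x \<notin> W) \<and> N = pen i A Q x y})"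
proof -
  note i = pencil_twin[OF full_pencilD[OF P]]
  let ?Z = "{N. \<exists>x y. (x, y) \<noteq> (0, 0) \<and> (x = 0 \<or> y = 0 \<or> y / x \<notin> W) \<and> N = pen i A Q x y}"
  let ?ok = "\<lambda>v k. v < nv \<and> k < e v"
  let ?pr = "\<lambda>v k p. v < nv \<and> k < e v \<and> (i, p) \<in> ix v \<and> p \<in> A"
  define C1 where "C1 = {c :: nat \<Rightarrow> nat \<Rightarrow> nat \<Rightarrow> nat \<Rightarrow> complex. \<forall>v k j p. ?ok v k \<and> (j, p) \<in> ix v
    \<and> \<not> ((j = i \<or> j = Suc i) \<and> p \<in> A) \<and> (j, p) \<notin> Q \<longrightarrow> c v k j p = 0}"
  define C2 where "C2 = {c :: nat \<Rightarrow> nat \<Rightarrow> nat \<Rightarrow> nat \<Rightarrow> complex. \<forall>v k p. ?pr v k p \<longrightarrow>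
    (c v k i p, c v k (Suc i) p) \<in> {z. fst z = 0 \<or> snd z = 0 \<or> snd z / fst z \<notin> W}}"
  define C3 where "C3 = {c :: nat \<Rightarrow> nat \<Rightarrow> nat \<Rightarrow> nat \<Rightarrow> complex. \<forall>v k p v' k' p'. ?pr v k p \<and> ?pr v' k' p' \<longrightarrow>
    c v k i p * c v' k' (Suc i) p' = c v k (Suc i) p * c v' k' i p'}"
  have "closed C1"
    unfolding C1_def
    by (intro closed_Collect_all closed_Collect_imp open_Collect_const closed_Collect_eq
      continuous_on_frame_coord continuous_on_const)
  moreover have "closed C3"
    unfolding C3_def
    by (intro closed_Collect_all closed_Collect_imp open_Collect_const closed_Collect_eq
      continuous_on_frame_coord continuous_on_mult)
  moreover have "closed C2"
  proof -
    have "open {z :: complex \<times> complex. z \<in> - {z. fst z = 0} \<and> snd z / fst z \<in> W}"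
    proof -
      have o: "open (- {z :: complex \<times> complex. fst z = 0})"
        by (intro open_Compl closed_Collect_eq continuous_intros)
      have "open ((\<lambda>z. snd z / fst z) -` W \<inter> (- {z :: complex \<times> complex. fst z = 0}))"
        using W o by (intro continuous_on_open_vimage[OF o, THEN iffD1, rule_format]) (auto intro!: continuous_intros)
      then show ?thesis by (simp add: vimage_def Int_def conj_commute)
    qed
    moreover have "open (- {z :: complex \<times> complex. snd z = 0})"
      by (intro open_Compl closed_Collect_eq continuous_intros)
    ultimately have "open ({z :: complex \<times> complex. z \<in> - {z. fst z = 0} \<and> snd z / fst z \<in> W} \<inter> - {z. snd z = 0})"
      by (rule open_Int)
    then have cl: "closed {z :: complex \<times> complex. fst z = 0 \<or> snd z = 0 \<or> snd z / fst z \<notin> W}"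
    proof -
      assume "open ({z :: complex \<times> complex. z \<in> - {z. fst z = 0} \<and> snd z / fst z \<in> W} \<inter> - {z. snd z = 0})"
      moreover have "{z :: complex \<times> complex. z \<in> - {z. fst z = 0} \<and> snd z / fst z \<in> W} \<inter> - {z. snd z = 0}
          = - {z. fst z = 0 \<or> snd z = 0 \<or> snd z / fst z \<notin> W}" by auto
      ultimately show ?thesis by (simp only: closed_def)
    qed
    have "closed {c :: nat \<Rightarrow> nat \<Rightarrow> nat \<Rightarrow> nat \<Rightarrow> complex. (c v k i p, c v k (Suc i) p) \<in> {z. fst z = 0 \<or> snd z = 0 \<or> snd z / fst z \<notin> W}}" for v k p
      using closed_vimage[OF cl, of "\<lambda>c. (c v k i p, c v k (Suc i) p)"]
      by (simp add: vimage_def continuous_on_Pair continuous_on_frame_coord)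
    then show ?thesis
      unfolding C2_def by (intro closed_Collect_all closed_Collect_imp open_Collect_const)
  qed
  ultimately have closed: "closed (C1 \<inter> C2 \<inter> C3)" by (intro closed_Int)
  have eq: "fspan e c \<in> ?Z \<longleftrightarrow> c \<in> C1 \<inter> C2 \<inter> C3" if c: "c \<in> Frm e" for c
  proof
    assume "fspan e c \<in> ?Z"
    then obtain x y where xy: "(x, y) \<noteq> (0, 0)" "x = 0 \<or> y = 0 \<or> y / x \<notin> W" "fspan e c = pen i A Q x y"
      by blast
    then have pc: "pcond i A Q x y v (c v k)" if "?ok v k" for v k
      using frame_span_eq_pen_iff[OF P xy(1) c] that by blast
    have pr: "x * c v k (Suc i) p = y * c v k i p" if "?pr v k p" for v k p
      using pc[of v k] that unfolding pcond_def by (metis (no_types, lifting))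
    have "c \<in> C1" using pc unfolding C1_def pcond_def by (simp split: if_splits) metis
    moreover have "c \<in> C2"
      unfolding C2_def
    proof (intro CollectI allI impI)
      fix v k p assume "?pr v k p"
      then have eq: "x * c v k (Suc i) p = y * c v k i p" by (rule pr)
      have "c v k (Suc i) p / c v k i p = y / x" if "c v k i p \<noteq> 0" "c v k (Suc i) p \<noteq> 0" "x \<noteq> 0" "y \<noteq> 0"
        using eq that by (simp add: field_simps)
      then show "fst (c v k i p, c v k (Suc i) p) = 0 \<or> snd (c v k i p, c v k (Suc i) p) = 0 \<or>
          snd (c v k i p, c v k (Suc i) p) / fst (c v k i p, c v k (Suc i) p) \<notin> W"
        using eq xy by (cases "x = 0"; cases "y = 0") auto
    qed
    moreover have "c \<in> C3"
      unfolding C3_def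
    proof (intro CollectI allI impI)
      fix v k p v' k' p' assume "?pr v k p \<and> ?pr v' k' p'"
      then have eqs: "x * c v k (Suc i) p = y * c v k i p" "x * c v' k' (Suc i) p' = y * c v' k' i p'"
        using pr by blast+
      have "x * (c v k i p * c v' k' (Suc i) p') = c v k i p * (y * c v' k' i p')"
        unfolding eqs(2)[symmetric] by simp
      also have "\<dots> = x * (c v k (Suc i) p * c v' k' i p')"
        using eqs(1) by (simp add: mult.assoc[symmetric])
      finally show "c v k i p * c v' k' (Suc i) p' = c v k (Suc i) p * c v' k' i p'"
        using xy(1) eqs by (cases "x = 0") auto
    qed
    ultimately show "c \<in> C1 \<inter> C2 \<inter> C3" by blast
  next
    assume "c \<in> C1 \<inter> C2 \<inter> C3"
    then have C: "c \<in> C1" "c \<in> C2" "c \<in> C3" by auto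
    have pc: "pcond i A Q x y v (c v k)" if ok: "?ok v k" and
      line: "\<And>p. ?pr v k p \<Longrightarrow> x * c v k (Suc i) p = y * c v k i p" for x y v k
      unfolding pcond_def
    proof (intro allI impI)
      fix j p assume jp: "(j, p) \<in> ix v"
      show "if (j = i \<or> j = Suc i) \<and> p \<in> A then x * c v k (Suc i) p = y * c v k i p else c v k j p \<noteq> 0 \<longrightarrow> (j, p) \<in> Q"
      proof (cases "(j = i \<or> j = Suc i) \<and> p \<in> A")
        case True
        then have "?pr v k p" using ok jp twin_idx[OF i] by auto
        then show ?thesis using line True by simp
      next
        case False
        then show ?thesis using C(1) ok jp unfolding C1_def by auto
      qed
    qed
    have span: "fspan e c = pen i A Q x y" if xy: "(x, y) \<noteq> (0, 0)"
      and line: "\<And>v k p. ?pr v k p \<Longrightarrow> x * c v k (Suc i) p = y * c v k i p" for x y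
      using frame_span_eq_pen_iff[OF P xy c] pc line by blast
    \<comment> \<open>If all coordinates on the lines vanished, the frame would span both the member
      with parameter 0 and the one with parameter \<infinity>, which differ.\<close>
    have "\<exists>v k p. ?pr v k p \<and> (c v k i p, c v k (Suc i) p) \<noteq> (0, 0)"
    proof (rule ccontr)
      assume "\<not> ?thesis"
      then have z: "c v k i p = 0" "c v k (Suc i) p = 0" if "?pr v k p" for v k p using that by blast+
      have "pen i A Q 1 0 = pen i A Q 0 1" using span[of 1 0] span[of 0 1] z by auto
      then show False using pen_eq_imp[OF full_pencilD[OF P]] P by (fastforce simp: full_pencil_def)
    qed
    then obtain v k p where p: "?pr v k p" "(c v k i p, c v k (Suc i) p) \<noteq> (0, 0)" by blast
    \<comment> \<open>By the vanishing minors every other pair of coordinates on a line is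
      proportional to this one, which therefore is the parameter.\<close>
    let ?x = "c v k i p" and ?y = "c v k (Suc i) p"
    have "fspan e c = pen i A Q ?x ?y"
      using C(3) p(1) unfolding C3_def by (intro span p(2)) blast
    moreover have "?x = 0 \<or> ?y = 0 \<or> ?y / ?x \<notin> W"
      using C(2) p(1) unfolding C2_def by auto
    ultimately show "fspan e c \<in> ?Z" using p(2) by blast
  qed
  have "{c \<in> Frm e. fspan e c \<in> Gr M e - ?Z} = Frm e \<inter> - (C1 \<inter> C2 \<inter> C3)"
    using eq by (auto simp: frames_def)
  moreover have "open (- (C1 \<inter> C2 \<inter> C3))" using closed by (rule open_Compl)
  ultimately show ?thesis
    unfolding openin_Gr_top openin_open by blast
qed

section \<open>The open orbit of a pencil: chart, character and closure\<close>

definition pen_orbit :: "nat \<Rightarrow> nat set \<Rightarrow> (nat \<times> nat) set \<Rightarrow> (nat \<Rightarrow> 'v set) set" where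
  "pen_orbit i A Q = pen i A Q 1 ` (- {0})"

lemma full_pencil_twin: "full_pencil e i A Q \<Longrightarrow> twin i"
  by (simp add: full_pencil_def pencil_def)

lemma pen_1_div: "x \<noteq> 0 \<Longrightarrow> pen i A Q x y = pen i A Q 1 (y / x)"
  using pen_scale[of x i A Q 1 "y / x"] by simp

lemma pen_0_1: "y \<noteq> 0 \<Longrightarrow> pen i A Q 0 y = pen i A Q 0 1"
  using pen_scale[of y i A Q 0 1] by simp

lemma pen_in_orbit: "x \<noteq> 0 \<Longrightarrow> y \<noteq> 0 \<Longrightarrow> pen i A Q x y \<in> pen_orbit i A Q"
  using pen_1_div[of x i A Q y] by (auto simp: pen_orbit_def)

lemma inj_pen: "full_pencil e i A Q \<Longrightarrow> inj (pen i A Q 1)"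
  using pen_eq_imp[of i A Q 1 _ 1] by (auto simp: inj_def full_pencil_def)

lemma torus_orbit_pen:
  assumes i: "twin i" and xy: "x \<noteq> 0" "y \<noteq> 0"
  shows "(\<lambda>\<gamma>. tact \<gamma> (pen i A Q x y)) ` torus B = pen_orbit i A Q"
proof
  have "\<gamma> i \<noteq> 0 \<and> \<gamma> (Suc i) \<noteq> 0" if "\<gamma> \<in> torus B" for \<gamma>
    using that i by (auto simp: torus_def twin_def)
  then show "(\<lambda>\<gamma>. tact \<gamma> (pen i A Q x y)) ` torus B \<subseteq> pen_orbit i A Q"
    using xy by (auto simp: torus_act_pen[OF i] pen_in_orbit)
  show "pen_orbit i A Q \<subseteq> (\<lambda>\<gamma>. tact \<gamma> (pen i A Q x y)) ` torus B"
  proof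
    fix N assume "N \<in> pen_orbit i A Q"
    then obtain z where z: "z \<noteq> 0" "N = pen i A Q 1 z" by (auto simp: pen_orbit_def)
    \<comment> \<open>Only the summand \<open>Suc i\<close> is scaled, by the factor that turns the
      ratio \<open>y / x\<close> into \<open>z\<close>.\<close>
    define \<gamma> where "\<gamma> = (\<lambda>j\<in>{0..num B}. if j = Suc i then z * x / y else 1)"
    have \<gamma>: "\<gamma> \<in> torus B" using z xy by (auto simp: \<gamma>_def torus_def)
    have "\<gamma> i = 1" "\<gamma> (Suc i) = z * x / y" using i by (simp_all add: \<gamma>_def twin_def)
    then have "tact \<gamma> (pen i A Q x y) = pen i A Q x (z * x)"
      using xy by (simp add: torus_act_pen[OF i \<gamma>])
    also have "\<dots> = N" using z xy pen_1_div[of x i A Q "z * x"] by simp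
    finally show "N \<in> (\<lambda>\<gamma>. tact \<gamma> (pen i A Q x y)) ` torus B" using \<gamma> by blast
  qed
qed

lemma pen_orbit_subset_Gr: "full_pencil e i A Q \<Longrightarrow> pen_orbit i A Q \<subseteq> Gr M e"
  by (auto simp: pen_orbit_def full_pencil_Gr)

lemma pen_orbit_torus_orbit:
  assumes P: "full_pencil e i A Q" shows "pen_orbit i A Q \<in> Orb e"
  unfolding torus_orbits_def torus_orbit_pen[OF full_pencil_twin[OF P], of 1 1 A Q, simplified, symmetric]
  by (rule imageI) (simp add: full_pencil_Gr[OF P])

text \<open>Openness comes from closed sets: the members whose parameter lies outside an open set,
  together with the two ends, form a closed subset of the Grassmannian, and the image of the open
  set is the rest of the orbit.\<close>

lemma homeomorphic_map_pen:
  assumes P: "full_pencil e i A Q"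
  shows "homeomorphic_map (top_of_set (- {0})) (subtopology (Top e) (pen_orbit i A Q)) (pen i A Q 1)"
proof (rule bijective_open_imp_homeomorphic_map)
  show "continuous_map (top_of_set (- {0})) (subtopology (Top e) (pen_orbit i A Q)) (pen i A Q 1)"
  proof -
    have "openin (top_of_set (- {0})) {z \<in> - {0}. pen i A Q 1 z \<in> U}" if "openin (Top e) U" for U
    proof -
      have "open ((\<lambda>z. (1, z)) -` {z. z \<noteq> (0, 0) \<and> pen i A Q (fst z) (snd z) \<in> U})"
        using that by (intro open_vimage open_pen_vimage[OF P] continuous_intros)
      then show ?thesis
        unfolding openin_open by (intro exI conjI) (auto simp: vimage_def)
    qed
    then show ?thesis
      unfolding continuous_map_in_subtopology
      by (auto simp: continuous_map_def pen_orbit_def full_pencil_Gr[OF P])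
  qed
  show "open_map (top_of_set (- {0})) (subtopology (Top e) (pen_orbit i A Q)) (pen i A Q 1)"
    unfolding open_map_def
  proof (intro allI impI)
    fix U :: "complex set" assume "openin (top_of_set (- {0})) U"
    then obtain T where "open T" "U = - {0} \<inter> T" unfolding openin_open by blast
    then have U: "open U" "0 \<notin> U" by auto
    let ?Z = "{N. \<exists>x y. (x, y) \<noteq> (0, 0) \<and> (x = 0 \<or> y = 0 \<or> y / x \<notin> U) \<and> N = pen i A Q x y}"
    have "pen i A Q 1 z \<in> ?Z \<longleftrightarrow> z \<notin> U" if "z \<noteq> 0" for z
    proof
      assume "pen i A Q 1 z \<in> ?Z"
      then obtain x y where xy: "(x, y) \<noteq> (0, 0)" "x = 0 \<or> y = 0 \<or> y / x \<notin> U" "pen i A Q 1 z = pen i A Q x y"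
        by blast
      have "y = x * z" using pen_eq_imp[OF full_pencilD[OF P] xy(3)] P by (simp add: full_pencil_def)
      then show "z \<notin> U" using xy(1,2) that by auto
    next
      assume "z \<notin> U"
      then show "pen i A Q 1 z \<in> ?Z" by (intro CollectI exI[of _ 1] exI[of _ z]) auto
    qed
    note iff = this
    have "pen i A Q 1 ` U = (Gr M e - ?Z) \<inter> pen_orbit i A Q"
    proof (rule Set.set_eqI)
      fix N
      show "N \<in> pen i A Q 1 ` U \<longleftrightarrow> N \<in> (Gr M e - ?Z) \<inter> pen_orbit i A Q"
      proof (cases "N \<in> pen_orbit i A Q")
        case True
        then obtain z where z: "z \<noteq> 0" "N = pen i A Q 1 z" by (auto simp: pen_orbit_def)
        have "N \<in> pen i A Q 1 ` U \<longleftrightarrow> z \<in> U"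
          unfolding z(2) by (rule inj_image_mem_iff[OF inj_pen[OF P]])
        moreover have "N \<in> Gr M e" using z(2) by (simp add: full_pencil_Gr[OF P])
        ultimately show ?thesis using True iff[OF z(1)] unfolding z(2) by blast
      next
        case False
        then show ?thesis using U(2) by (auto simp: pen_orbit_def)
      qed
    qed
    then show "openin (subtopology (Top e) (pen_orbit i A Q)) (pen i A Q 1 ` U)"
      unfolding openin_subtopology using openin_complement_pen[OF P U(1)] by blast
  qed
  show "pen i A Q 1 ` topspace (top_of_set (- {0})) = topspace (subtopology (Top e) (pen_orbit i A Q))"
    using pen_orbit_subset_Gr[OF P] by (auto simp: topspace_subtopology pen_orbit_def)
  show "inj_on (pen i A Q 1) (topspace (top_of_set (- {0})))"
    using inj_pen[OF P] by (auto intro: inj_on_subset)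
qed

lemma one_dim_pen_orbit:
  assumes P: "full_pencil e i A Q" shows "pen_orbit i A Q \<in> Orb1 e"
proof -
  let ?E = "pen_orbit i A Q"
  have "openin (subtopology (Top e) ?E) ?E"
    using openin_topspace[of "subtopology (Top e) ?E"] pen_orbit_subset_Gr[OF P]
    by (simp add: topspace_subtopology Int_absorb1)
  moreover have "subtopology (Top e) ?E homeomorphic_space top_of_set (- {0 :: complex})"
    using homeomorphic_map_imp_homeomorphic_space[OF homeomorphic_map_pen[OF P]]
    by (rule homeomorphic_space_sym[THEN iffD1])
  moreover have "open (- {0 :: complex})" by auto
  ultimately show ?thesis
    unfolding one_dim_orbits_def
    by (intro CollectI conjI pen_orbit_torus_orbit[OF P] ballI exI[of _ ?E] exI[of _ "- {0}"])
qed

text \<open>The exponents of the character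
  \<open>\<epsilon>\<^sub>i\<^sub>+\<^sub>1 - \<epsilon>\<^sub>i\<close>.\<close>

definition simple_root :: "nat \<Rightarrow> nat \<Rightarrow> int" where
  "simple_root i j = (if j = Suc i then 1 else if j = i then - 1 else 0)"

lemma char_val_simple_root:
  assumes "twin i" shows "char_val B (simple_root i) \<gamma> = \<gamma> (Suc i) / \<gamma> i"
proof -
  have "char_val B (simple_root i) \<gamma> = (\<Prod>j\<in>{i, Suc i}. \<gamma> j powi simple_root i j)"
    unfolding char_val_def using assms
    by (intro prod.mono_neutral_right) (auto simp: twin_def simple_root_def)
  then show ?thesis by (simp add: simple_root_def power_int_minus field_simps)
qed

lemma orbit_char_pen_orbit:
  assumes P: "full_pencil e i A Q" shows "ochar e (pen_orbit i A Q) (simple_root i)"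
  unfolding orbit_char_def
proof (intro exI conjI ballI allI impI)
  show "homeomorphic_map (top_of_set (- {0})) (subtopology (Top e) (pen_orbit i A Q)) (pen i A Q 1)"
    using P by (rule homeomorphic_map_pen)
  fix \<gamma> z assume \<gamma>: "\<gamma> \<in> torus B" and "z \<noteq> (0 :: complex)"
  note i = full_pencil_twin[OF P]
  have "\<gamma> i \<noteq> 0" using \<gamma> i by (auto simp: torus_def twin_def)
  then show "tact \<gamma> (pen i A Q 1 z) = pen i A Q 1 (char_val B (simple_root i) \<gamma> * z)"
    using pen_1_div[of "\<gamma> i" i A Q "\<gamma> (Suc i) * z"]
    by (simp add: torus_act_pen[OF i \<gamma>] char_val_simple_root[OF i])
qed

lemma closure_pen_orbit:
  assumes P: "full_pencil e i A Q"
  shows "(Top e) closure_of (pen_orbit i A Q) = pen_orbit i A Q \<union> {pen i A Q 1 0, pen i A Q 0 1}"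
proof
  let ?E = "pen_orbit i A Q" and ?S = "pen_orbit i A Q \<union> {pen i A Q 1 0, pen i A Q 0 1}"
  \<comment> \<open>For the empty set the condition on the parameter is void, and \<open>?Z\<close>
    is the whole pencil, which is thus closed.\<close>
  let ?Z = "{N. \<exists>x y. (x, y) \<noteq> (0, 0) \<and> (x = 0 \<or> y = 0 \<or> y / x \<notin> {}) \<and> N = pen i A Q x y}"
  have Z: "?Z = ?S"
  proof
    show "?Z \<subseteq> ?S"
    proof
      fix N assume "N \<in> ?Z"
      then obtain x y where xy: "(x, y) \<noteq> (0, 0)" "N = pen i A Q x y" by blast
      consider "x = 0" "y \<noteq> 0" | "x \<noteq> 0" "y = 0" | "x \<noteq> 0" "y \<noteq> 0" using xy by blast
      then show "N \<in> ?S"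
        by cases (use xy pen_0_1[of y i A Q] pen_1_div[of x i A Q y] pen_in_orbit[of x y i A Q] in auto)
    qed
    show "?S \<subseteq> ?Z"
    proof
      fix N assume "N \<in> ?S"
      then consider z where "z \<noteq> 0" "N = pen i A Q 1 z" | "N = pen i A Q 1 0" | "N = pen i A Q 0 1"
        unfolding pen_orbit_def by blast
      then show "N \<in> ?Z"
      proof cases
        case 1
        then show ?thesis by (intro CollectI exI[of _ 1] exI[of _ z]) auto
      next
        case 2
        then show ?thesis by (intro CollectI exI[of _ 1] exI[of _ 0]) auto
      next
        case 3
        then show ?thesis by (intro CollectI exI[of _ 0] exI[of _ 1]) auto
      qed
    qed
  qed
  have SGr: "?S \<subseteq> Gr M e" using pen_orbit_subset_Gr[OF P] by (auto simp: full_pencil_Gr[OF P])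
  have "closedin (Top e) ?S"
    unfolding closedin_def using openin_complement_pen[OF P, of "{}"] SGr unfolding Z by simp
  then show "(Top e) closure_of ?E \<subseteq> ?S" by (intro closure_of_minimal) auto
  \<comment> \<open>A neighbourhood of the limit pulls back along the path \<open>g\<close> to an
    open set around 0. This is more than a point, so it meets nonzero \<open>t\<close>.\<close>
  have lim: "f 0 \<in> (Top e) closure_of ?E"
    if f: "continuous_on UNIV g" "\<And>t. g t \<noteq> (0, 0)" "\<And>t. f t = pen i A Q (fst (g t)) (snd (g t))"
      "\<And>t. t \<noteq> 0 \<Longrightarrow> f t \<in> ?E" for f and g :: "complex \<Rightarrow> complex \<times> complex"
    unfolding in_closure_of
  proof (intro conjI allI impI)
    show "f 0 \<in> topspace (Top e)"
      using f(2)[of 0] full_pencil_Gr[OF P, of "fst (g 0)" "snd (g 0)"] by (simp add: f(3) prod_eq_iff)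
    fix T assume T: "f 0 \<in> T \<and> openin (Top e) T"
    let ?V = "g -` {z. z \<noteq> (0, 0) \<and> pen i A Q (fst z) (snd z) \<in> T}"
    have "open ?V" using T f(1) open_pen_vimage[OF P] by (intro open_vimage) auto
    then have "?V \<noteq> {0}" using not_open_singleton by metis
    moreover have "0 \<in> ?V" using T f(2)[of 0] f(3)[of 0] by simp
    ultimately obtain t where "t \<in> ?V" "t \<noteq> 0" by blast
    then show "\<exists>N. N \<in> ?E \<and> N \<in> T" using f(3,4) by (intro exI[of _ "f t"]) simp
  qed
  have "pen i A Q 1 0 \<in> (Top e) closure_of ?E"
    by (rule lim[of "\<lambda>t. (1, t)"]) (auto intro!: continuous_intros simp: pen_in_orbit)
  moreover have "pen i A Q 0 1 \<in> (Top e) closure_of ?E"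
    by (rule lim[of "\<lambda>t. (t, 1)" "\<lambda>t. pen i A Q t 1"]) (auto intro!: continuous_intros simp: pen_in_orbit)
  moreover have "?E \<subseteq> (Top e) closure_of ?E"
    using pen_orbit_subset_Gr[OF P] by (intro closure_of_subset) simp
  ultimately show "?S \<subseteq> (Top e) closure_of ?E" by simp
qed

section \<open>The action of permutations\<close>

abbreviation tr :: "nat \<Rightarrow> nat \<Rightarrow> nat" where
  "tr i \<equiv> Transposition.transpose i (Suc i)"

abbreviation pinv :: "(nat \<Rightarrow> nat) \<Rightarrow> nat \<Rightarrow> nat" where
  "pinv w \<equiv> inv_into UNIV w"

text \<open>Such permutations act on \<open>M\<close> by automorphisms, are closed under composition
  and inverses, and include the transpositions of twins.\<close>

definition perm_ok :: "(nat \<Rightarrow> nat) \<Rightarrow> bool" where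
  "perm_ok w \<longleftrightarrow> w permutes {1..num B} \<and> (\<forall>j. st B (w j) = st B j \<and> len B (w j) = len B j)"

lemma perm_ok_permutes: "perm_ok w \<Longrightarrow> w permutes {1..num B}"
  by (simp add: perm_ok_def)

lemma perm_ok_inv: "perm_ok w \<Longrightarrow> perm_ok (pinv w)"
  unfolding perm_ok_def by (metis permutes_inv permutes_inverses(1))

lemma perm_ok_comp: "perm_ok w \<Longrightarrow> perm_ok u \<Longrightarrow> perm_ok (w \<circ> u)"
  by (simp add: perm_ok_def permutes_compose)

lemma perm_ok_id [simp]: "perm_ok id"
  by (simp add: perm_ok_def permutes_id)

lemma perm_ok_transpose: "twin i \<Longrightarrow> perm_ok (tr i)"
  by (auto simp: perm_ok_def twin_def permutes_swap_id Transposition.transpose_def)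

lemma perm_ok_0: "perm_ok w \<Longrightarrow> w 0 = 0"
  using permutes_not_in[of w "{1..num B}" 0] by (simp add: perm_ok_def)

lemma perm_ok_inv_simps [simp]: "perm_ok w \<Longrightarrow> w (pinv w j) = j" "perm_ok w \<Longrightarrow> pinv w (w j) = j"
  using permutes_inverses[of w "{1..num B}"] by (simp_all add: perm_ok_def)

lemma perm_ok_inv_inv: "perm_ok w \<Longrightarrow> pinv (pinv w) = w"
  using permutes_inv_inv[of w] by (auto simp: perm_ok_def)

lemma perm_ok_idx: "perm_ok w \<Longrightarrow> (w j, p) \<in> ix v \<longleftrightarrow> (j, p) \<in> ix v"
  using permutes_in_image[of w "{1..num B}" j] by (auto simp: idx_iff perm_ok_def vtx_def)

text \<open>Without the inverse that occurs in \<open>perm_act\<close>, the action is compatible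
  with ordinary composition, see \<open>pact_pact\<close>. The two conventions agree on
  transpositions.\<close>

definition pact :: "(nat \<Rightarrow> nat) \<Rightarrow> (nat \<Rightarrow> 'v set) \<Rightarrow> nat \<Rightarrow> 'v set" where
  "pact w = act_sub M B (\<lambda>j p. bv B (w j) p)"

lemma perm_act_eq_pact: "perm_act M B w = pact (pinv w)"
  by (simp add: fun_eq_iff perm_act_def pact_def)

abbreviation "plin w \<equiv> lext (\<lambda>j p. bv B (w j) p)"

lemma lin_ext_perm:
  assumes w: "perm_ok w" and v: "v < nv"
  shows "plin w v (vec v c) = vec v (\<lambda>j p. c (pinv w j) p)"
proof -
  have "vec v (\<lambda>j p. c (pinv w j) p) = (\<Sum>(j, p)\<in>ix v. sc M (c j p) (bv B (w j) p))"
    unfolding vec_def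
    by (rule sum.reindex_bij_witness[of _ "\<lambda>(j, p). (w j, p)" "\<lambda>(j, p). (pinv w j, p)"])
      (auto simp: perm_ok_idx w perm_ok_inv)
  then show ?thesis by (simp add: lin_ext_vec[OF v])
qed

lemma pact_apply: "v < nv \<Longrightarrow> pact w N v = plin w v ` N v"
  by (simp add: pact_def act_sub_def)

lemma pact_ext [simp]: "pact w N \<in> extensional {..<nv}"
  by (simp add: pact_def act_sub_def)

lemma lin_on_perm:
  "perm_ok w \<Longrightarrow> v < nv \<Longrightarrow> lin_on (sc M) (sp M v) (sp M v) (plin w v)"
  by (rule lin_on_lin_ext) (auto intro!: bv_in_sp simp: perm_ok_idx)

lemma graded_pact: "perm_ok w \<Longrightarrow> graded N \<Longrightarrow> graded (pact w N)"
  using lin_on_perm[of w] by (fastforce simp: graded_def pact_apply lin_on_def)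

lemma vec_in_pact:
  assumes w: "perm_ok w" and v: "v < nv" and N: "graded N"
  shows "vec v c \<in> pact w N v \<longleftrightarrow> vec v (\<lambda>j p. c (w j) p) \<in> N v"
proof
  assume "vec v c \<in> pact w N v"
  then obtain x where x: "x \<in> N v" "vec v c = plin w v x"
    by (auto simp: pact_apply[OF v])
  then obtain d where d: "x = vec v d" using N v sp_obtain_vec by (metis graded_def subsetD)
  have eq: "vec v c = vec v (\<lambda>j p. d (pinv w j) p)" using x d lin_ext_perm[OF w v] by simp
  have "vec v (\<lambda>j p. c (w j) p) = vec v d"
    using vec_eqD[OF eq v] w by (intro vec_cong) (simp add: perm_ok_idx)
  then show "vec v (\<lambda>j p. c (w j) p) \<in> N v" using x d by simp
next
  assume "vec v (\<lambda>j p. c (w j) p) \<in> N v"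
  then have "plin w v (vec v (\<lambda>j p. c (w j) p)) \<in> pact w N v"
    unfolding pact_apply[OF v] by (rule imageI)
  then show "vec v c \<in> pact w N v" using w by (simp add: lin_ext_perm[OF w v])
qed

lemma pact_pact:
  assumes "perm_ok w" "perm_ok u" "graded N" shows "pact w (pact u N) = pact (w \<circ> u) N"
  using assms by (intro graded_eqI) (auto simp: graded_pact perm_ok_comp vec_in_pact)

lemma pact_id: "graded N \<Longrightarrow> pact id N = N"
  by (intro graded_eqI) (auto simp: graded_pact vec_in_pact)

lemma pact_inv:
  assumes "perm_ok w" "graded N" shows "pact (pinv w) (pact w N) = N" "pact w (pact (pinv w) N) = N"
proof -
  have "pinv w \<circ> w = id" "w \<circ> pinv w = id" using assms(1) by (auto simp: fun_eq_iff)
  then show "pact (pinv w) (pact w N) = N" "pact w (pact (pinv w) N) = N"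
    using assms by (simp_all add: pact_pact perm_ok_inv pact_id)
qed

lemma pact_Gr:
  assumes w: "perm_ok w" and N: "N \<in> Gr M e" shows "pact w N \<in> Gr M e"
proof -
  let ?g = "\<lambda>v. plin w v"
  let ?h = "\<lambda>v. plin (pinv w) v"
  have "(\<lambda>v\<in>{..<nv}. ?g v ` N v) \<in> Gr M e"
  proof (rule Gr_image[OF N, where k = 1])
    fix v assume v: "v < nv"
    show "lin_on (sc M) (sp M v) (sp M v) (?g v)" "lin_on (sc M) (sp M v) (sp M v) (?h v)"
      using lin_on_perm[OF w v] lin_on_perm[OF perm_ok_inv[OF w] v] by auto
    fix x assume "x \<in> sp M v"
    then obtain c where x: "x = vec v c" using sp_obtain_vec[OF v] by blast
    show "?h v (?g v x) = x"
      unfolding x using w by (simp add: lin_ext_perm v perm_ok_inv perm_ok_inv_inv)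
    have "shift_co (\<lambda>j p. c (pinv w j) p) = (\<lambda>j p. shift_co c (pinv w j) p)"
      by (auto simp: fun_eq_iff shift_co_def)
    then show "ar M v (?g v x) = sc M 1 (?g (nxt M v) (ar M v x))"
      unfolding x using w by (simp add: lin_ext_perm v ar_vec)
  qed
  then show ?thesis by (simp add: pact_def act_sub_def)
qed

lemma torus_act_Gr:
  assumes \<gamma>: "\<gamma> \<in> torus B" and N: "N \<in> Gr M e" shows "tact \<gamma> N \<in> Gr M e"
proof -
  let ?g = "\<lambda>v. tlin \<gamma> v"
  let ?h = "\<lambda>v. tlin (\<lambda>j. inverse (\<gamma> j)) v"
  have "(\<lambda>v\<in>{..<nv}. ?g v ` N v) \<in> Gr M e"
  \<comment> \<open>An arrow raises \<open>p\<close> by one, which costs one factor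
    \<open>\<gamma> 0\<close>.\<close>
  proof (rule Gr_image[OF N, where k = "inverse (\<gamma> 0)"])
    fix v assume v: "v < nv"
    show "lin_on (sc M) (sp M v) (sp M v) (?g v)" "lin_on (sc M) (sp M v) (sp M v) (?h v)"
      using v by (auto intro!: lin_on_lin_ext bv_in_sp vs.subspace_scale subspace_sp)
    fix x assume "x \<in> sp M v"
    then obtain c where x: "x = vec v c" using sp_obtain_vec[OF v] by blast
    have "vec v (\<lambda>j p. inverse (\<gamma> 0) ^ p * inverse (\<gamma> j) * (\<gamma> 0 ^ p * \<gamma> j * c j p)) = vec v c"
      using torus_nonzero[OF \<gamma>] by (intro vec_cong) (auto simp: idx_iff field_simps power_inverse)
    then show "?h v (?g v x) = x"
      unfolding x lin_ext_torus[OF v]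
      using lin_ext_torus[OF v, of "\<lambda>j. inverse (\<gamma> j)"] by simp
    have "inverse (\<gamma> 0) * (\<gamma> 0 ^ p * \<gamma> j * shift_co c j p) = shift_co (\<lambda>j p. \<gamma> 0 ^ p * \<gamma> j * c j p) j p" for j p
      using torus_nonzero[OF \<gamma>, of 0] by (cases p) (simp_all add: shift_co_def)
    then show "ar M v (?g v x) = sc M (inverse (\<gamma> 0)) (?g (nxt M v) (ar M v x))"
      unfolding x by (simp add: lin_ext_torus v ar_vec vec_scale)
  qed
  then show ?thesis by (simp add: torus_act_def act_sub_def)
qed

lemma torus_comp_perm:
  assumes w: "perm_ok w" and \<gamma>: "\<gamma> \<in> torus B" shows "\<gamma> \<circ> w \<in> torus B"
proof -
  have "w permutes {0..num B}"
    using perm_ok_permutes[OF w] by (rule permutes_subset) auto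
  then have "w j \<in> {0..num B} \<longleftrightarrow> j \<in> {0..num B}" for j
    by (rule permutes_in_image)
  then show ?thesis using \<gamma> by (auto simp: torus_def PiE_iff extensional_def)
qed

text \<open>Permuting the summands permutes the coordinates of the torus; \<open>\<gamma> 0\<close>
  stays in place because \<open>w\<close> fixes 0.\<close>

lemma torus_act_pact:
  assumes w: "perm_ok w" and \<gamma>: "\<gamma> \<in> torus B" and N: "graded N"
  shows "tact \<gamma> (pact w N) = pact w (tact (\<gamma> \<circ> w) N)"
proof (rule graded_eqI)
  show "graded (tact \<gamma> (pact w N))" "graded (pact w (tact (\<gamma> \<circ> w) N))"
    using w N by (simp_all add: graded_pact graded_torus_act)
  show "vec v c \<in> tact \<gamma> (pact w N) v \<longleftrightarrow> vec v c \<in> pact w (tact (\<gamma> \<circ> w) N) v"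
    if v: "v < nv" for v c
    using w N by (simp add: vec_in_torus_act_iff \<gamma> v graded_pact vec_in_pact torus_comp_perm
        graded_torus_act perm_ok_0)
qed

lemma pact_fixed_points:
  assumes w: "perm_ok w" and L: "L \<in> Fix e" shows "pact w L \<in> Fix e"
  using L pact_Gr[OF w, of L e] torus_act_pact[OF w _ graded_Gr[of L e]] torus_comp_perm[OF w]
  by (simp add: fixed_points_def)

section \<open>Permutations as homeomorphisms of the Grassmannian\<close>

lemma pact_frame_span:
  assumes w: "perm_ok w"
  shows "pact w (fspan e c) = fspan e (\<lambda>v k j p. c v k (pinv w j) p)"
proof (rule extensionalityI[OF pact_ext frame_span_ext])
  fix v assume "v \<in> {..<nv}"
  then have v: "v < nv" by simp
  let ?g = "\<lambda>w. plin w v"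
  let ?X = "(\<lambda>k. vec v (c v k)) ` {..<e v}"
  let ?Y = "(\<lambda>k. vec v (\<lambda>j p. c v k (pinv w j) p)) ` {..<e v}"
  have gX: "?g w ` ?X = ?Y" by (simp add: image_image lin_ext_perm[OF w v])
  have hY: "?g (pinv w) ` ?Y = ?X"
    using w by (simp add: image_image lin_ext_perm[OF perm_ok_inv[OF w] v] perm_ok_inv_inv)
  have X: "?X \<subseteq> sp M v" "finite ?X" and Y: "?Y \<subseteq> sp M v" "finite ?Y" using v by auto
  have gh: "?g w (?g (pinv w) y) = y" if "y \<in> sp M v" for y
  proof -
    have "y = vec v (co v y)" using vec_co[OF v that] by simp
    then obtain d where "y = vec v d" by blast
    then show ?thesis using w v by (simp add: lin_ext_perm perm_ok_inv perm_ok_inv_inv)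
  qed
  have "?g w ` vs.span ?X = vs.span ?Y"
  proof
    show "?g w ` vs.span ?X \<subseteq> vs.span ?Y"
      using lin_on_image_span[OF v lin_on_perm[OF w v] X] gX by simp
    have 1: "?g (pinv w) ` vs.span ?Y \<subseteq> vs.span ?X"
      using lin_on_image_span[OF v lin_on_perm[OF perm_ok_inv[OF w] v] Y] hY by simp
    have 2: "vs.span ?Y \<subseteq> sp M v" using Y(1) subspace_sp[OF v] by (rule vs.span_minimal)
    show "vs.span ?Y \<subseteq> ?g w ` vs.span ?X"
    proof
      fix y assume y: "y \<in> vs.span ?Y"
      then have "?g (pinv w) y \<in> vs.span ?X" using 1 by blast
      moreover have "y = ?g w (?g (pinv w) y)" using y 2 gh by auto
      ultimately show "y \<in> ?g w ` vs.span ?X" by blast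
    qed
  qed
  then show "pact w (fspan e c) v = fspan e (\<lambda>v k j p. c v k (pinv w j) p) v"
    by (simp add: pact_apply[OF v] frame_span_apply[OF v])
qed

text \<open>On frames a permutation merely rearranges coordinates, which is continuous, and the
  quotient topology inherits this.\<close>

lemma continuous_map_pact:
  assumes w: "perm_ok w" shows "continuous_map (Top e) (Top e) (pact w)"
  unfolding continuous_map_def
proof (intro conjI allI impI)
  show "pact w \<in> topspace (Top e) \<rightarrow> topspace (Top e)"
    using pact_Gr[OF w] by auto
  fix U assume U: "openin (Top e) U"
  define s where "s = (\<lambda>(c :: nat \<Rightarrow> nat \<Rightarrow> nat \<Rightarrow> nat \<Rightarrow> complex) v k j p. c v k (pinv w j) p)"
  have s: "fspan e (s c) = pact w (fspan e c)" for c
    by (simp add: s_def pact_frame_span[OF w])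
  obtain T where T: "open T" "{c \<in> Frm e. fspan e c \<in> U} = Frm e \<inter> T"
    using U unfolding openin_Gr_top openin_open by blast
  have cont: "continuous_on UNIV s"
    unfolding s_def by (intro continuous_on_coordinatewise_then_product continuous_on_frame_coord)
  have "pact w (fspan e c) \<in> U \<longleftrightarrow> s c \<in> T" if c: "c \<in> Frm e" for c
  proof -
    have "s c \<in> Frm e" using c pact_Gr[OF w] by (simp add: frames_def s)
    then show ?thesis using T(2) unfolding s[symmetric] by blast
  qed
  then have "{c \<in> Frm e. fspan e c \<in> {N \<in> Gr M e. pact w N \<in> U}} = Frm e \<inter> s -` T"
    by (auto simp: frames_def)
  moreover have "open (s -` T)" using T(1) cont by (rule open_vimage)
  ultimately show "openin (Top e) {N \<in> topspace (Top e). pact w N \<in> U}"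
    unfolding openin_Gr_top openin_open by auto
qed

lemma homeomorphic_map_pact:
  assumes w: "perm_ok w" shows "homeomorphic_map (Top e) (Top e) (pact w)"
proof -
  have "homeomorphic_maps (Top e) (Top e) (pact w) (pact (pinv w))"
    unfolding homeomorphic_maps_def
    using continuous_map_pact w perm_ok_inv pact_inv graded_Gr by auto
  then show ?thesis by (rule homeomorphic_maps_imp_map)
qed

section \<open>Orbits, characters and closures under permutations\<close>

lemma pact_image_orbit:
  assumes w: "perm_ok w" and N: "graded N"
  shows "pact w ` (\<lambda>\<gamma>. tact \<gamma> N) ` torus B = (\<lambda>\<gamma>. tact \<gamma> (pact w N)) ` torus B"
proof
  have 1: "pact w (tact \<gamma> N) = tact (\<gamma> \<circ> pinv w) (pact w N)" if "\<gamma> \<in> torus B" for \<gamma>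
  proof -
    have "(\<gamma> \<circ> pinv w) \<circ> w = \<gamma>" using w by (auto simp: fun_eq_iff)
    then show ?thesis
      using torus_act_pact[OF w torus_comp_perm[OF perm_ok_inv[OF w] that] N] by simp
  qed
  then show "pact w ` (\<lambda>\<gamma>. tact \<gamma> N) ` torus B \<subseteq> (\<lambda>\<gamma>. tact \<gamma> (pact w N)) ` torus B"
    using torus_comp_perm[OF perm_ok_inv[OF w]] by auto
  show "(\<lambda>\<gamma>. tact \<gamma> (pact w N)) ` torus B \<subseteq> pact w ` (\<lambda>\<gamma>. tact \<gamma> N) ` torus B"
    using torus_act_pact[OF w _ N] torus_comp_perm[OF w] by auto
qed

lemma torus_orbits_subset_Gr: "E \<in> Orb e \<Longrightarrow> E \<subseteq> Gr M e"
  by (auto simp: torus_orbits_def torus_act_Gr)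

lemma subtopology_pact_homeomorphic:
  assumes w: "perm_ok w" and S: "S \<subseteq> Gr M e"
  shows "homeomorphic_map (subtopology (Top e) S) (subtopology (Top e) (pact w ` S)) (pact w)"
  using S by (intro homeomorphic_map_subtopologies homeomorphic_map_pact w) (auto simp: Int_absorb1 pact_Gr[OF w] image_subset_iff subset_iff)

lemma one_dim_orbits_subset_Gr: "E \<in> Orb1 e \<Longrightarrow> E \<subseteq> Gr M e"
  using torus_orbits_subset_Gr by (auto simp: one_dim_orbits_def)

lemma one_dim_orbits_pact:
  assumes w: "perm_ok w" and E: "E \<in> Orb1 e"
  shows "pact w ` E \<in> Orb1 e"
proof -
  obtain N where N: "N \<in> Gr M e" "E = (\<lambda>\<gamma>. tact \<gamma> N) ` torus B"
    using E by (auto simp: one_dim_orbits_def torus_orbits_def)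
  have orb: "pact w ` E \<in> Orb e"
    unfolding N(2) pact_image_orbit[OF w graded_Gr[OF N(1)]] torus_orbits_def
    using pact_Gr[OF w N(1)] by blast
  let ?T = "Top e"
  note EGr = one_dim_orbits_subset_Gr[OF E]
  have "\<exists>U'. \<exists>W::complex set. openin (subtopology ?T (pact w ` E)) U' \<and> pact w L \<in> U' \<and> open W
      \<and> subtopology ?T U' homeomorphic_space top_of_set W" if LE: "L \<in> E" for L
  proof -
    obtain U and W :: "complex set" where U: "openin (subtopology ?T E) U" "L \<in> U" "open W"
      "subtopology ?T U homeomorphic_space top_of_set W"
      using E LE unfolding one_dim_orbits_def by blast
    have UE: "U \<subseteq> Gr M e \<inter> E" using openin_subset[OF U(1)] by (simp add: topspace_subtopology)
    then have UGr: "U \<subseteq> Gr M e" by blast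
    have "openin (subtopology ?T (pact w ` E)) (pact w ` U)"
      using homeomorphic_map_openness[OF subtopology_pact_homeomorphic[OF w EGr], of U] U(1) UE
      by (simp add: topspace_subtopology)
    moreover have "subtopology ?T (pact w ` U) homeomorphic_space top_of_set W"
      using homeomorphic_map_imp_homeomorphic_space[OF subtopology_pact_homeomorphic[OF w UGr]] U(4)
        homeomorphic_space_sym homeomorphic_space_trans by blast
    ultimately show ?thesis using U(2,3) by blast
  qed
  then show ?thesis using orb unfolding one_dim_orbits_def by blast
qed

lemma orbit_char_pact:
  assumes w: "perm_ok w" and E: "E \<subseteq> Gr M e" and a: "ochar e E a"
  shows "ochar e (pact w ` E) (a \<circ> pinv w)"
proof -
  obtain \<phi> where \<phi>: "homeomorphic_map (top_of_set (- {0})) (subtopology (Top e) E) \<phi>"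
    "\<And>\<gamma> z. \<gamma> \<in> torus B \<Longrightarrow> z \<noteq> 0 \<Longrightarrow> tact \<gamma> (\<phi> z) = \<phi> (char_val B a \<gamma> * z)"
    using a by (auto simp: orbit_char_def)
  have \<phi>E: "\<phi> z \<in> Gr M e" if "z \<noteq> 0" for z
    using homeomorphic_imp_surjective_map[OF \<phi>(1)] that E by auto
  have char: "char_val B a (\<gamma> \<circ> w) = char_val B (a \<circ> pinv w) \<gamma>" for \<gamma>
  proof -
    have "w permutes {..num B}"
      using perm_ok_permutes[OF w] by (rule permutes_subset) auto
    from prod.permute[OF this, of "\<lambda>j. \<gamma> j powi a (pinv w j)"]
    show ?thesis using w by (simp add: char_val_def comp_def)
  qed
  show ?thesis
    unfolding orbit_char_def
  proof (intro exI conjI ballI allI impI)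
    show "homeomorphic_map (top_of_set (- {0})) (subtopology (Top e) (pact w ` E)) (pact w \<circ> \<phi>)"
      using \<phi>(1) subtopology_pact_homeomorphic[OF w E] by (rule homeomorphic_map_compose)
    fix \<gamma> z assume \<gamma>: "\<gamma> \<in> torus B" and z: "z \<noteq> (0 :: complex)"
    show "tact \<gamma> ((pact w \<circ> \<phi>) z) = (pact w \<circ> \<phi>) (char_val B (a \<circ> pinv w) \<gamma> * z)"
      using torus_act_pact[OF w \<gamma> graded_Gr[OF \<phi>E[OF z]]] \<phi>(2)[OF torus_comp_perm[OF w \<gamma>] z]
      by (simp add: char)
  qed
qed

lemma closure_pact:
  assumes w: "perm_ok w" and E: "E \<subseteq> Gr M e"
  shows "(Top e) closure_of (pact w ` E) = pact w ` ((Top e) closure_of E)"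
  by (rule homeomorphic_map_closure_of[OF homeomorphic_map_pact[OF w]]) (simp add: E)

text \<open>In particular the two ends are exchanged, which identifies the second fixed point in the
  closure of the orbit.\<close>

lemma pact_transpose_pen:
  assumes P: "pencil i A Q"
  shows "pact (tr i) (pen i A Q x y) = pen i A Q y x"
proof -
  note i = pencil_twin[OF P]
  note w = perm_ok_transpose[OF i]
  show ?thesis
  proof (rule graded_eqI)
    show "graded (pact (tr i) (pen i A Q x y))" "graded (pen i A Q y x)"
      using w by (simp_all add: graded_pact)
    fix v and c :: "nat \<Rightarrow> nat \<Rightarrow> complex" assume v: "v < nv"
    let ?c = "\<lambda>j p. c (tr i j) p"
    have Q: "(i, p) \<in> Q \<longleftrightarrow> (Suc i, p) \<in> Q" for p using P by (simp add: pencil_def)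
    have 1: "pcond i A Q y x v c" if c: "pcond i A Q x y v (\<lambda>j p. c (tr i j) p)"
      for x y and c :: "nat \<Rightarrow> nat \<Rightarrow> complex"
      unfolding pcond_def
    proof (intro allI impI)
      fix j p assume jp: "(j, p) \<in> ix v"
      then have jp': "(tr i j, p) \<in> ix v" by (simp add: perm_ok_idx[OF w])
      consider "j = i" | "j = Suc i" | "j \<noteq> i" "j \<noteq> Suc i" by blast
      then show "if (j = i \<or> j = Suc i) \<and> p \<in> A then y * c (Suc i) p = x * c i p else c j p \<noteq> 0 \<longrightarrow> (j, p) \<in> Q"
        using c[unfolded pcond_def, rule_format, OF jp'] Q[of p]
        by cases (auto split: if_splits)
    qed
    have "vec v c \<in> pact (tr i) (pen i A Q x y) v \<longleftrightarrow> pcond i A Q x y v ?c"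
      by (simp add: vec_in_pact[OF w v graded_pen] vec_in_pen[OF i v])
    also have "\<dots> \<longleftrightarrow> pcond i A Q y x v c"
      using 1[of x y c] 1[of y x ?c] by auto
    finally show "vec v c \<in> pact (tr i) (pen i A Q x y) v \<longleftrightarrow> vec v c \<in> pen i A Q y x v"
      by (simp add: vec_in_pen[OF i v])
  qed
qed

lemma pen_fixed_imp:
  assumes P: "pencil i A Q" and A: "A \<noteq> {}"
    and fx: "\<And>\<gamma>. \<gamma> \<in> torus B \<Longrightarrow> tact \<gamma> (pen i A Q x y) = pen i A Q x y"
  shows "x = 0 \<or> y = 0"
proof -
  note i = pencil_twin[OF P]
  \<comment> \<open>Doubling the summand \<open>Suc i\<close> doubles the ratio of the parameters,
    which only 0 and \<infinity> survive.\<close>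
  define \<gamma> where "\<gamma> = (\<lambda>j\<in>{0..num B}. if j = Suc i then 2 else (1 :: complex))"
  have \<gamma>: "\<gamma> \<in> torus B" by (auto simp: \<gamma>_def torus_def)
  have "\<gamma> i = 1" "\<gamma> (Suc i) = 2" using i by (simp_all add: \<gamma>_def twin_def)
  then have "pen i A Q x (2 * y) = pen i A Q x y"
    using fx[OF \<gamma>] by (simp add: torus_act_pen[OF i \<gamma>])
  from pen_eq_imp[OF P this A] show ?thesis by simp
qed

lemma fixed_pointsD:
  assumes "L \<in> Fix e"
  shows "L \<in> Gr M e" "\<And>\<gamma>. \<gamma> \<in> torus B \<Longrightarrow> tact \<gamma> L = L" "partially_fixed i L"
  using assms by (auto simp: fixed_points_def partially_fixed_def)

lemma pen_empty: "pen i {} Q x y = pen i {} Q x' y'"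
  by (simp add: pen_def pcond_def)

text \<open>A torus-fixed point is a member of some pencil. Being moved by \<open>tr i\<close>
  excludes a constant pencil, being fixed by the torus puts it at an end, and \<open>tr i\<close>
  leads to the other end.\<close>

lemma fixed_point_edge:
  assumes i: "twin i" and L: "L \<in> Fix e"
    and ne: "pact (tr i) L \<noteq> L"
  shows "\<exists>E\<in>Orb1 e. ochar e E (simple_root i)
    \<and> (Top e) closure_of E = E \<union> {L, pact (tr i) L}"
proof -
  obtain A Q x y where P: "pencil i A Q" and xy: "(x, y) \<noteq> (0, 0)" and Leq: "L = pen i A Q x y"
    using partially_fixed_imp_pen[OF i fixed_pointsD(1)[OF L] fixed_pointsD(3)[OF L]] .
  have A: "A \<noteq> {}" using ne pact_transpose_pen[OF P] pen_empty unfolding Leq by metis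
  have F: "full_pencil e i A Q"
    using full_pencilI[OF P A _ xy] fixed_pointsD(1)[OF L] Leq by simp
  have "x = 0 \<or> y = 0" using pen_fixed_imp[OF P A] fixed_pointsD(2)[OF L] Leq by blast
  then have "L = pen i A Q 1 0 \<or> L = pen i A Q 0 1"
    using pen_1_div[of x i A Q y] pen_0_1[of y i A Q] xy unfolding Leq by auto
  then have "{L, pact (tr i) L} = {pen i A Q 1 0, pen i A Q 0 1}"
    using pact_transpose_pen[OF P] by auto
  then show ?thesis
    using one_dim_pen_orbit[OF F] orbit_char_pen_orbit[OF F] closure_pen_orbit[OF F] by metis
qed

lemma torus_one:
  "(\<lambda>j\<in>{0..num B}. 1) \<in> torus B" "graded N \<Longrightarrow> tact (\<lambda>j\<in>{0..num B}. 1) N = N"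
proof -
  show one: "(\<lambda>j\<in>{0..num B}. 1) \<in> torus B" by (auto simp: torus_def)
  assume N: "graded N"
  show "tact (\<lambda>j\<in>{0..num B}. 1) N = N"
  proof (rule graded_eqI[OF graded_torus_act[OF N] N])
    fix v and c :: "nat \<Rightarrow> nat \<Rightarrow> complex" assume v: "v < nv"
    have "vec v (\<lambda>j p. c j p / ((\<lambda>j\<in>{0..num B}. 1) 0 ^ p * (\<lambda>j\<in>{0..num B}. 1) j)) = vec v c"
      by (rule vec_cong) (simp add: idx_iff)
    then show "vec v c \<in> tact (\<lambda>j\<in>{0..num B}. 1) N v \<longleftrightarrow> vec v c \<in> N v"
      by (simp only: vec_in_torus_act_iff[OF one v N])
  qed
qed

text \<open>An orbit on which \<open>T\<close> acts through a multiple of \<open>\<epsilon>\<^sub>i\<^sub>+\<^sub>1 - \<epsilon>\<^sub>i\<close> is fixed by the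
  subtorus \<open>\<gamma>\<^sub>i = \<gamma>\<^sub>i\<^sub>+\<^sub>1\<close>, so it is the open part of a pencil.\<close>

lemma parallel_edge:
  assumes i: "twin i" and E: "E \<in> Orb1 e" and a: "ochar e E a"
    and par: "\<And>j. j \<le> num B \<Longrightarrow> j \<noteq> i \<Longrightarrow> j \<noteq> Suc i \<Longrightarrow> a j = 0" "a i + a (Suc i) = 0"
    and cl: "(Top e) closure_of E = E \<union> {L, L'}"
    and L: "L \<in> Fix e" and L': "L' \<in> Fix e"
  shows "L' = L \<or> L' = pact (tr i) L"
proof -
  obtain N where N: "N \<in> Gr M e" "E = (\<lambda>\<gamma>. tact \<gamma> N) ` torus B"
    using E by (auto simp: one_dim_orbits_def torus_orbits_def)
  note EGr = one_dim_orbits_subset_Gr[OF E]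
  obtain \<phi> where \<phi>: "homeomorphic_map (top_of_set (- {0})) (subtopology (Top e) E) \<phi>"
    "\<And>\<gamma> z. \<gamma> \<in> torus B \<Longrightarrow> z \<noteq> 0 \<Longrightarrow> tact \<gamma> (\<phi> z) = \<phi> (char_val B a \<gamma> * z)"
    using a by (auto simp: orbit_char_def)
  have surj: "\<phi> ` (- {0}) = E"
    using homeomorphic_imp_surjective_map[OF \<phi>(1)] EGr by (simp add: Int_absorb1)
  have inj: "inj_on \<phi> (- {0})" using homeomorphic_imp_injective_map[OF \<phi>(1)] by simp
  \<comment> \<open>On the subtorus the character is a power of \<open>\<gamma> i\<close> whose
    exponent \<open>a i + a (Suc i)\<close> is 0.\<close>
  have char: "char_val B a \<gamma> = 1" if \<gamma>: "\<gamma> \<in> torus B" "\<gamma> i = \<gamma> (Suc i)" for \<gamma>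
  proof -
    have "char_val B a \<gamma> = (\<Prod>j\<in>{i, Suc i}. \<gamma> j powi a j)"
      unfolding char_val_def using i par(1)
      by (intro prod.mono_neutral_right) (auto simp: twin_def)
    also have "\<dots> = \<gamma> i powi (a i + a (Suc i))"
      using \<gamma> i torus_nonzero[OF \<gamma>(1), of i] by (simp add: twin_def power_int_add)
    finally show ?thesis using par(2) by simp
  qed
  have NE: "N \<in> E" using torus_one(1) torus_one(2)[OF graded_Gr[OF N(1)]] unfolding N(2) by (metis imageI)
  then obtain z where z: "z \<noteq> 0" "N = \<phi> z" using surj by auto
  have "partially_fixed i N" using \<phi>(2) z char by (simp add: partially_fixed_def)
  then obtain A Q x y where P: "pencil i A Q" and xy: "(x, y) \<noteq> (0, 0)" and Neq: "N = pen i A Q x y"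
    using partially_fixed_imp_pen[OF i N(1)] by metis
  \<comment> \<open>An orbit homeomorphic to the punctured plane has more than one point. This
    excludes both a constant pencil and the two ends.\<close>
  have not_fixed: "\<exists>\<gamma>\<in>torus B. tact \<gamma> N \<noteq> N"
  proof (rule ccontr)
    assume "\<not> ?thesis"
    then have "E \<subseteq> {N}" unfolding N(2) by blast
    moreover have "\<phi> 1 \<in> E" "\<phi> 2 \<in> E" using surj by auto
    ultimately have "\<phi> 1 = \<phi> 2" by blast
    then show False using inj_onD[OF inj, of 1 2] by simp
  qed
  have A: "A \<noteq> {}"
    using not_fixed torus_act_pen[OF i] pen_empty unfolding Neq by metis
  have nz: "x \<noteq> 0" "y \<noteq> 0"
    using not_fixed torus_act_pen[OF i] pen_0_1[of _ i A Q] pen_1_div[of _ i A Q 0] xy torus_nonzero i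
    unfolding Neq twin_def by (metis Suc_leD mult_zero_right mult_eq_0_iff div_0 prod.inject)+
  have F: "full_pencil e i A Q" using full_pencilI[OF P A _ xy] N(1) Neq by simp
  have Eeq: "E = pen_orbit i A Q" unfolding N(2) Neq by (rule torus_orbit_pen[OF i nz])
  \<comment> \<open>Torus-fixed points avoid the orbit, so they are among the points that the
    closure adds to it.\<close>
  have "K \<in> {pen i A Q 1 0, pen i A Q 0 1}" if K: "K \<in> Fix e" "K \<in> {L, L'}" for K
  proof -
    have "K \<notin> E"
      using pen_fixed_imp[OF P A] fixed_pointsD(2)[OF K(1)] unfolding Eeq pen_orbit_def by force
    then show ?thesis using K(2) cl closure_pen_orbit[OF F] unfolding Eeq by blast
  qed
  then have "L \<in> {pen i A Q 1 0, pen i A Q 0 1}" "L' \<in> {pen i A Q 1 0, pen i A Q 0 1}"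
    using L L' by auto
  then show ?thesis using pact_transpose_pen[OF P] by auto
qed

section \<open>Operators on equivariant cohomology\<close>


lemma summand_support:
  assumes v: "v < nv" and i: "1 \<le> i" "i \<le> num B" and x: "x \<in> summand M B i v"
  shows "\<exists>c. x = vec v c \<and> (\<forall>j p. j \<noteq> i \<longrightarrow> c j p = 0)"
proof -
  let ?W = "{vec v c |c. \<forall>j p. j \<noteq> i \<longrightarrow> c j p = 0}"
  have "vs.subspace ?W"
  proof (rule vs.subspaceI)
    show "0 \<in> ?W" using vec_0[of v] by force
  next
    fix a b assume "a \<in> ?W" "b \<in> ?W"
    then obtain c d where "a = vec v c" "b = vec v d" "\<forall>j p. j \<noteq> i \<longrightarrow> c j p = 0" "\<forall>j p. j \<noteq> i \<longrightarrow> d j p = 0"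
      by blast
    then show "a + b \<in> ?W" by (intro CollectI exI[of _ "\<lambda>j p. c j p + d j p"]) (simp add: vec_add)
  next
    fix k a assume "a \<in> ?W"
    then obtain c where "a = vec v c" "\<forall>j p. j \<noteq> i \<longrightarrow> c j p = 0" by blast
    then show "sc M k a \<in> ?W" by (intro CollectI exI[of _ "\<lambda>j p. k * c j p"]) (simp add: vec_scale)
  qed
  moreover have "bv B i p \<in> ?W" if "p < len B i" "vx i p = v" for p
    using that i by (intro CollectI exI[of _ "unit_co i p"]) (simp add: vec_unit_co idx_iff, simp add: unit_co_def)
  ultimately have "summand M B i v \<subseteq> ?W"
    unfolding summand_def by (intro vs.span_minimal) auto
  then show ?thesis using x by blast
qed

lemma vtx_eq_imp_st_eq:
  assumes "vx j p = vx j' p" "st B j < nv" "st B j' < nv"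
  shows "st B j = st B j'"
  using assms(1)
proof (induction p)
  case 0
  then show ?case using assms by (simp add: vtx_def)
next
  case (Suc p)
  then show ?case using vtx_Suc_eq_nxt_iff[of "vx j' p" j p] by (simp add: vtx_Suc)
qed

text \<open>Follow the generator \<open>bv B i 0\<close>: after \<open>len B i - 1\<close> arrows
  its image is still nonzero, so the chain \<open>i'\<close> has, at the same vertex, a position at
  least that large. For equal lengths this must be the last position, and going back along both
  chains compares the starts.\<close>

lemma rep_iso_summands:
  assumes iso: "rep_iso M (summand M B i) (summand M B i')"
    and i: "1 \<le> i" "i \<le> num B" and i': "1 \<le> i'" "i' \<le> num B"
  shows "len B i \<le> len B i'" and "len B i = len B i' \<Longrightarrow> st B i = st B i'"
proof -
  obtain \<phi> where \<phi>: "\<And>v. v < nv \<Longrightarrow> lin_on (sc M) (summand M B i v) (summand M B i' v) (\<phi> v)"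
    "\<And>v. v < nv \<Longrightarrow> bij_betw (\<phi> v) (summand M B i v) (summand M B i' v)"
    "\<And>v x. v < nv \<Longrightarrow> x \<in> summand M B i v \<Longrightarrow> \<phi> (nxt M v) (ar M v x) = ar M v (\<phi> v x)"
    using iso unfolding rep_iso_def by blast
  have st: "st B j < nv" "1 \<le> len B j" if "1 \<le> j" "j \<le> num B" for j
    using seg that by (auto simp: segment_basis_def)
  have bvU: "bv B i p \<in> summand M B i (vx i p)" if "p < len B i" for p
    unfolding summand_def using that by (intro vs.span_base) auto
  let ?y = "\<lambda>p. \<phi> (vx i p) (bv B i p)"
  have "?y 0 \<in> summand M B i' (vx i 0)"
    using \<phi>(1)[OF vtx_less[of i 0]] bvU[of 0] st(2)[OF i] unfolding lin_on_def Pi_def by simp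
  then obtain c where c: "?y 0 = vec (vx i 0) c" "\<And>j p. j \<noteq> i' \<Longrightarrow> c j p = 0"
    using summand_support[OF vtx_less i'] by blast
  have y: "?y p = vec (vx i p) ((shift_co ^^ p) c)" if "p < len B i" for p
    using that
  proof (induction p)
    case (Suc p)
    have "(i, p) \<in> ix (vx i p)" using Suc.prems i by (simp add: idx_iff)
    then have "ar M (vx i p) (bv B i p) = bv B i (Suc p)" using Suc.prems by (simp add: ar_bv)
    then have "?y (Suc p) = ar M (vx i p) (?y p)"
      using \<phi>(3)[OF vtx_less bvU[of p]] Suc.prems by (simp add: vtx_Suc)
    then show ?case using Suc by (simp add: ar_vec vtx_Suc)
  qed (simp add: c)
  have shift: "(shift_co ^^ p) c j q = (if p \<le> q then c j (q - p) else 0)" for p j q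
    by (induction p arbitrary: q) (auto simp: shift_co_def split: nat.splits)
  define l where "l = len B i - 1"
  have l: "l < len B i" using st(2)[OF i] by (simp add: l_def)
  have "?y l \<noteq> 0"
  proof
    assume y0: "?y l = 0"
    have sub: "0 \<in> summand M B i (vx i l)" by (simp add: summand_def vs.span_zero)
    then have "\<phi> (vx i l) (sc M 0 0) = sc M 0 (\<phi> (vx i l) 0)"
      using \<phi>(1)[OF vtx_less] unfolding lin_on_def by blast
    then have "\<phi> (vx i l) 0 = ?y l" using y0 by simp
    then have "bv B i l = 0"
      using inj_onD[OF bij_betw_imp_inj_on[OF \<phi>(2)[OF vtx_less]] _ sub bvU[OF l]] by simp
    moreover have il: "(i, l) \<in> ix (vx i l)" using l i by (simp add: idx_iff)
    ultimately have "vec (vx i l) (unit_co i l) = vec (vx i l) (\<lambda>j p. 0)"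
      by (simp add: vec_unit_co)
    from vec_eqD[OF this vtx_less il] show False by (simp add: unit_co_def)
  qed
  then have "\<exists>j q. (j, q) \<in> ix (vx i l) \<and> (shift_co ^^ l) c j q \<noteq> 0"
    using y[OF l] vec_cong[of "vx i l" "(shift_co ^^ l) c" "\<lambda>j p. 0"] by auto
  then obtain q where q: "(i', q) \<in> ix (vx i l)" "l \<le> q"
    using c(2) unfolding shift by (metis (no_types, lifting))
  then show "len B i \<le> len B i'" by (auto simp: idx_iff l_def)
  assume "len B i = len B i'"
  then have "q = l" using q by (auto simp: idx_iff l_def)
  then have "vx i' l = vx i l" using q by (simp add: idx_iff)
  then show "st B i = st B i'" using vtx_eq_imp_st_eq st(1) i i' by metis
qed

lemma rep_iso_refl: "rep_iso M U U"
  unfolding rep_iso_def by (intro exI[of _ "\<lambda>v x. x"]) (auto simp: lin_on_def bij_betw_def inj_on_def)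

lemma simple_idx_twin:
  assumes nb: "numbered_by M B ks" and i: "i \<in> simple_idx (num B) ks"
  shows "twin i"
proof -
  let ?blk = "\<lambda>i i'. \<exists>j\<in>{1..length ks}. i \<in> {partial_sum ks (j - 1)<..partial_sum ks j}
             \<and> i' \<in> {partial_sum ks (j - 1)<..partial_sum ks j}"
  have iso: "rep_iso M (summand M B i) (summand M B i') \<longleftrightarrow> ?blk i i'"
    if "1 \<le> i" "i \<le> num B" "1 \<le> i'" "i' \<le> num B" for i i'
    using nb that unfolding numbered_by_def by simp
  have i1: "1 \<le> i" "i \<le> num B" "i \<notin> block_ends ks" using i by (auto simp: simple_idx_def)
  \<comment> \<open>Reflexivity of isomorphism, read through \<open>numbered_by\<close>, provides
    the block containing \<open>i\<close>.\<close>
  obtain j where j: "j \<in> {1..length ks}" "i \<in> {partial_sum ks (j - 1)<..partial_sum ks j}"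
    using iso[of i i] i1 rep_iso_refl by blast
  \<comment> \<open>Not being the end of its block, \<open>i\<close> is followed by
    \<open>Suc i\<close> within the same block.\<close>
  have "i \<noteq> partial_sum ks j" using i1(3) j(1) by (auto simp: block_ends_def)
  then have Si: "Suc i \<in> {partial_sum ks (j - 1)<..partial_sum ks j}" using j(2) by auto
  have "partial_sum ks j \<le> num B"
  proof -
    have "sum_list (take j ks) + sum_list (drop j ks) = num B"
      using nb unfolding numbered_by_def by (metis append_take_drop_id sum_list_append)
    then show ?thesis by (simp add: partial_sum_def)
  qed
  then have d: "Suc i \<le> num B" using Si by auto
  have "?blk i (Suc i)" "?blk (Suc i) i" using j Si by blast+
  then have 1: "rep_iso M (summand M B i) (summand M B (Suc i))" and 2: "rep_iso M (summand M B (Suc i)) (summand M B i)"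
    using iso i1 d by simp_all
  have "len B i = len B (Suc i)"
    using rep_iso_summands(1)[OF 1] rep_iso_summands(1)[OF 2] i1 d by (simp add: antisym)
  moreover have "st B i = st B (Suc i)"
    using rep_iso_summands(2)[OF 1] i1 d calculation by simp
  ultimately show ?thesis using i1 d by (simp add: twin_def)
qed

section \<open>Permutations acting on polynomials and characters\<close>

definition pp :: "(nat \<Rightarrow> nat) \<Rightarrow> cpoly \<Rightarrow> cpoly" where
  "pp w = psubst (\<lambda>i. pvar (w i))"

lemma pp_simps: "pp w (p + q) = pp w p + pp w q" "pp w (p - q) = pp w p - pp w q" "pp w (p * q) = pp w p * pp w q"
  "pp w 0 = 0" "pp w (pconst c) = pconst c" "pp w (pvar i) = pvar (w i)" "pp w (p ^ k) = pp w p ^ k"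
  "pp w (sum f S) = (\<Sum>x\<in>S. pp w (f x))" "pp w (prod f S) = (\<Prod>x\<in>S. pp w (f x))"
  by (simp_all add: pp_def psubst_add psubst_diff psubst_mult psubst_power psubst_sum psubst_prod)

lemma pp_comp: "pp u (pp w p) = pp (u \<circ> w) p"
  by (simp add: pp_def psubst_psubst)

lemma pp_id [simp]: "pp id p = p"
  by (simp add: pp_def psubst_id)

lemma perm_poly_eq_pp: "perm_ok w \<Longrightarrow> perm_poly w = pp (pinv w)"
  using perm_ok_0[OF perm_ok_inv, of w]
  by (auto simp: fun_eq_iff perm_poly_def pp_def intro!: arg_cong2[where f = psubst])

lemma perm_ok_permutes0: "perm_ok w \<Longrightarrow> w permutes {..num B}"
  by (rule permutes_subset[OF perm_ok_permutes]) auto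

abbreviation "RT \<equiv> polys {0..num B}"

lemma pp_polys: "perm_ok w \<Longrightarrow> p \<in> RT \<Longrightarrow> pp w p \<in> RT"
  unfolding pp_def using permutes_in_image[OF perm_ok_permutes0[of w]]
  by (auto intro!: psubst_in_polys simp: atLeast0AtMost)

lemma pp_homog: "p \<in> homog q \<Longrightarrow> pp w p \<in> homog q"
  unfolding pp_def by (rule homog_psubst) auto

abbreviation root :: "nat \<Rightarrow> cpoly" where
  "root i \<equiv> pvar (Suc i) - pvar i"

lemma root_nonzero: "root i \<noteq> 0"
  by simp

lemma pp_tr_root: "pp (tr i) (root i) = - root i"
  by (simp add: pp_simps)

text \<open>Modulo \<open>root i\<close> the two exchanged variables coincide.\<close>

lemma root_dvd_diff:
  assumes "p \<in> polys A" "i \<in> A" "Suc i \<in> A"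
  shows "\<exists>r\<in>polys A. p - pp (tr i) p = root i * r"
  unfolding pp_def using assms(1)
proof (rule psubst_cong_mod)
  fix j assume "j \<in> A"
  consider "j = i" | "j = Suc i" | "j \<noteq> i" "j \<noteq> Suc i" by blast
  then show "pvar (tr i j) \<in> polys A \<and> (\<exists>r\<in>polys A. pvar j - pvar (tr i j) = root i * r)"
  proof cases
    case 1
    then show ?thesis using assms by (intro conjI bexI[of _ "- 1"]) auto
  next
    case 2
    then show ?thesis using assms by (intro conjI bexI[of _ 1]) auto
  next
    case 3
    then show ?thesis using \<open>j \<in> A\<close> by (intro conjI bexI[of _ 0]) auto
  qed
qed

lemma char_poly_eq: "char_poly B a = (\<Sum>i\<le>num B. pconst (of_int (a i)) * pvar i)"
  by (simp add: char_poly_def of_int_eq_pconst)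

lemma char_poly_parallel:
  assumes i: "twin i" and "\<And>j. j \<le> num B \<Longrightarrow> j \<noteq> i \<Longrightarrow> j \<noteq> Suc i \<Longrightarrow> a j = 0" "a i + a (Suc i) = 0"
  shows "char_poly B a = pconst (of_int (a (Suc i))) * root i"
proof -
  have "char_poly B a = (\<Sum>j\<in>{i, Suc i}. pconst (of_int (a j)) * pvar j)"
    unfolding char_poly_eq using i assms(2) by (intro sum.mono_neutral_right) (auto simp: twin_def)
  moreover have "a i = - a (Suc i)" using assms(3) by simp
  ultimately show ?thesis by (simp add: pconst_minus algebra_simps)
qed

lemma pp_char_poly:
  assumes w: "perm_ok w" shows "pp w (char_poly B (a \<circ> w)) = char_poly B a"
  unfolding char_poly_eq using sum.permute[OF perm_ok_permutes0[OF w], of "\<lambda>j. pconst (of_int (a j)) * pvar j"]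
  by (simp add: pp_simps comp_def)

text \<open>The counterpart of \<open>perm_HT\<close> in the convention of \<open>pp\<close> and
  \<open>pact\<close>. Both \<open>pp\<close> and \<open>hact\<close> multiply like the permutations
  themselves, so one formula can serve polynomials and cohomology.\<close>

definition hact :: "(nat \<Rightarrow> nat) \<Rightarrow> (nat \<Rightarrow> nat) \<Rightarrow> ((nat \<Rightarrow> 'v set) \<Rightarrow> cpoly) \<Rightarrow> (nat \<Rightarrow> 'v set) \<Rightarrow> cpoly" where
  "hact e w f = (\<lambda>L. if L \<in> Fix e then pp w (f (pact (pinv w) L)) else 0)"

lemma perm_HT_eq_hact: "perm_ok w \<Longrightarrow> perm_HT M B e w = hact e (pinv w)"
  by (simp add: fun_eq_iff perm_HT_def hact_def perm_poly_eq_pp perm_act_eq_pact)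

lemma pinv_tr [simp]: "pinv (tr i) = tr i"
  by (rule inv_unique_comp) (auto simp: fun_eq_iff)

section \<open>The congruences defining cohomology\<close>

lemma HT_I:
  assumes "\<And>L. L \<notin> Fix e \<Longrightarrow> f L = 0"
    and "\<And>L. L \<in> Fix e \<Longrightarrow> f L \<in> RT"
    and "\<And>E a L L'. E \<in> Orb1 e \<Longrightarrow> L \<in> Fix e \<Longrightarrow> L' \<in> Fix e \<Longrightarrow>
      ochar e E a \<Longrightarrow> (Top e) closure_of E = E \<union> {L, L'} \<Longrightarrow>
      \<exists>r\<in>RT. f L - f L' = char_poly B a * r"
  shows "f \<in> H e"
  using assms unfolding HT_def by blast

lemma HT_D:
  assumes "f \<in> H e"
  shows "L \<notin> Fix e \<Longrightarrow> f L = 0" "f L \<in> RT"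
    and "E \<in> Orb1 e \<Longrightarrow> L \<in> Fix e \<Longrightarrow> L' \<in> Fix e \<Longrightarrow>
      ochar e E a \<Longrightarrow> (Top e) closure_of E = E \<union> {L, L'} \<Longrightarrow>
      \<exists>r\<in>RT. f L - f L' = char_poly B a * r"
proof -
  show 1: "L \<notin> Fix e \<Longrightarrow> f L = 0" using assms unfolding HT_def by blast
  show "f L \<in> RT"
    using assms 1 unfolding HT_def by (cases "L \<in> Fix e") auto
qed (use assms in \<open>unfold HT_def, blast\<close>)

lemma HT_add:
  assumes f: "f \<in> H e" and g: "g \<in> H e" shows "f + g \<in> H e"
proof (rule HT_I)
  fix E a L L'
  assume *: "E \<in> Orb1 e" "L \<in> Fix e" "L' \<in> Fix e"
    "ochar e E a" "(Top e) closure_of E = E \<union> {L, L'}"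
  obtain r s where r: "r \<in> RT" "f L - f L' = char_poly B a * r"
    and s: "s \<in> RT" "g L - g L' = char_poly B a * s"
    using HT_D(3)[OF f *] HT_D(3)[OF g *] by blast
  have "(f + g) L - (f + g) L' = (f L - f L') + (g L - g L')" by simp
  also have "\<dots> = char_poly B a * (r + s)" unfolding r s by (simp add: distrib_left)
  finally show "\<exists>r\<in>RT. (f + g) L - (f + g) L' = char_poly B a * r" using r s by blast
qed (use HT_D[OF f] HT_D[OF g] in auto)

lemma HT_scale:
  assumes f: "f \<in> H e" shows "(\<lambda>L. pconst c * f L) \<in> H e"
proof (rule HT_I)
  fix E a L L'
  assume *: "E \<in> Orb1 e" "L \<in> Fix e" "L' \<in> Fix e"
    "ochar e E a" "(Top e) closure_of E = E \<union> {L, L'}"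
  obtain r where r: "r \<in> RT" "f L - f L' = char_poly B a * r"
    using HT_D(3)[OF f *] by blast
  have "pconst c * f L - pconst c * f L' = char_poly B a * (pconst c * r)"
    unfolding right_diff_distrib[symmetric] r(2) by simp
  then show "\<exists>r\<in>RT. pconst c * f L - pconst c * f L' = char_poly B a * r"
    using r(1) by (intro bexI[of _ "pconst c * r"]) auto
qed (use HT_D[OF f] in auto)

text \<open>The congruence along the orbit that joins the two fixed points; if \<open>tr i\<close>
  does not move \<open>L\<close>, the difference is 0.\<close>

lemma HT_edge:
  assumes i: "twin i" and f: "f \<in> H e" and L: "L \<in> Fix e"
  shows "\<exists>r\<in>RT. f L - f (pact (tr i) L) = root i * r"
proof (cases "pact (tr i) L = L")
  case True
  then show ?thesis by (intro bexI[of _ 0]) auto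
next
  case False
  obtain E where E: "E \<in> Orb1 e" "ochar e E (simple_root i)"
    "(Top e) closure_of E = E \<union> {L, pact (tr i) L}"
    using fixed_point_edge[OF i L False] by blast
  have "char_poly B (simple_root i) = root i"
    using char_poly_parallel[OF i, of "simple_root i"] by (simp add: simple_root_def)
  then show ?thesis
    using HT_D(3)[OF f E(1) L pact_fixed_points[OF perm_ok_transpose[OF i] L] E(2,3)] by simp
qed

text \<open>The congruence along \<open>E\<close> is obtained from the one along its image under the
  inverse of \<open>w\<close>. The character there is \<open>a \<circ> w\<close>, and
  \<open>pp w\<close> turns it back into \<open>a\<close>.\<close>

lemma hact_HT:
  assumes w: "perm_ok w" and f: "f \<in> H e" shows "hact e w f \<in> H e"
proof (rule HT_I)
  fix E a L L'
  assume E: "E \<in> Orb1 e" and L: "L \<in> Fix e" "L' \<in> Fix e"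
    and a: "ochar e E a" and cl: "(Top e) closure_of E = E \<union> {L, L'}"
  note w' = perm_ok_inv[OF w]
  note EGr = one_dim_orbits_subset_Gr[OF E]
  let ?E = "pact (pinv w) ` E"
  have "ochar e ?E (a \<circ> w)"
    using orbit_char_pact[OF w' EGr a] by (simp add: perm_ok_inv_inv[OF w])
  moreover have "(Top e) closure_of ?E = ?E \<union> {pact (pinv w) L, pact (pinv w) L'}"
    unfolding closure_pact[OF w' EGr] cl by (simp add: image_Un)
  ultimately obtain r where r: "r \<in> RT"
    "f (pact (pinv w) L) - f (pact (pinv w) L') = char_poly B (a \<circ> w) * r"
    using HT_D(3)[OF f one_dim_orbits_pact[OF w' E] pact_fixed_points[OF w' L(1)] pact_fixed_points[OF w' L(2)]]
    by blast
  have "hact e w f L - hact e w f L' = pp w (f (pact (pinv w) L) - f (pact (pinv w) L'))"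
    using L by (simp add: hact_def pp_simps)
  also have "\<dots> = char_poly B a * pp w r" unfolding r(2) by (simp add: pp_simps pp_char_poly[OF w])
  finally show "\<exists>r\<in>RT. hact e w f L - hact e w f L' = char_poly B a * r"
    using pp_polys[OF w r(1)] by blast
qed (use HT_D[OF f] pp_polys[OF w] in \<open>auto simp: hact_def\<close>)

text \<open>As \<open>pquot\<close> is a definite description, a quotient has to be exhibited before
  anything can be said about it. Afterwards the first equation determines the operator, since
  \<open>root i\<close> can be cancelled.\<close>

lemma demazure_HT_spec:
  assumes i: "twin i" and f: "f \<in> H e"
  shows "root i * DH e i f L = f L - hact e (tr i) f L"
    and "DH e i f L \<in> RT"
    and "L \<notin> Fix e \<Longrightarrow> DH e i f L = 0"
proof -
  note w = perm_ok_transpose[OF i]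
  have D: "DH e i f L = pquot (f L - hact e (tr i) f L) (root i)"
    using f perm_HT_eq_hact[OF w] by (simp add: demazure_HT_def)
  have "\<exists>r\<in>RT. f L - hact e (tr i) f L = root i * r"
  proof (cases "L \<in> Fix e")
    case True
    let ?K = "pact (tr i) L"
    obtain r where r: "r \<in> RT" "f L - f ?K = root i * r" using HT_edge[OF i f True] by blast
    obtain s where s: "s \<in> RT" "f ?K - pp (tr i) (f ?K) = root i * s"
      using root_dvd_diff[OF HT_D(2)[OF f], of i] i by (auto simp: twin_def)
    \<comment> \<open>First the fixed point is changed, by the congruence along an orbit, and then
      the variables.\<close>
    have "f L - hact e (tr i) f L = (f L - f ?K) + (f ?K - pp (tr i) (f ?K))"
      using True by (simp add: hact_def)
    also have "\<dots> = root i * (r + s)" unfolding r s by (simp only: distrib_left)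
    finally show ?thesis using r s by blast
  next
    case False
    then show ?thesis using HT_D(1)[OF f] by (intro bexI[of _ 0]) (auto simp: hact_def)
  qed
  then obtain r where r: "r \<in> RT" "f L - hact e (tr i) f L = root i * r" by blast
  have "DH e i f L = r" unfolding D r(2) by (rule pquot_eq) auto
  then show 1: "root i * DH e i f L = f L - hact e (tr i) f L" "DH e i f L \<in> RT"
    using r by simp_all
  assume "L \<notin> Fix e"
  then have "root i * DH e i f L = 0" using 1(1) HT_D(1)[OF f] by (simp add: hact_def)
  then show "DH e i f L = 0" using root_nonzero[of i] by (metis mult_eq_0_iff)
qed

lemma hact_D: "L \<in> Fix e \<Longrightarrow> hact e w f L = pp w (f (pact (pinv w) L))"
  by (simp add: hact_def)

lemma pact_tr_tr:
  assumes i: "twin i" and L: "L \<in> Fix e" shows "pact (tr i) (pact (tr i) L) = L"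
  using pact_inv(2)[OF perm_ok_transpose[OF i] graded_Gr[OF fixed_pointsD(1)[OF L]]] by simp

lemma demazure_HT_HT:
  assumes i: "twin i" and f: "f \<in> H e"
  shows "DH e i f \<in> H e"
proof (rule HT_I)
  fix E a L L'
  let ?g = "DH e i f"
  assume E: "E \<in> Orb1 e" and L: "L \<in> Fix e" "L' \<in> Fix e"
    and a: "ochar e E a" and cl: "(Top e) closure_of E = E \<union> {L, L'}"
  note w = perm_ok_transpose[OF i]
  obtain r where r: "r \<in> RT" "f L - f L' = char_poly B a * r"
    using HT_D(3)[OF f E L a cl] by blast
  note spec = demazure_HT_spec[OF i f]
  show "\<exists>r\<in>RT. ?g L - ?g L' = char_poly B a * r"
  \<comment> \<open>The alternative is whether the character is a multiple of \<open>root i\<close>,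
    the zero character being counted as one. If not, \<open>root i\<close> can be cancelled from the
    congruence for the numerator.\<close>
  proof (cases "(\<exists>j\<le>num B. j \<noteq> i \<and> j \<noteq> Suc i \<and> a j \<noteq> 0) \<or> a i + a (Suc i) \<noteq> 0")
    case True
    obtain s where s: "s \<in> RT" "hact e (tr i) f L - hact e (tr i) f L' = char_poly B a * s"
      using HT_D(3)[OF hact_HT[OF w f] E L a cl] by blast
    have "root i * (?g L - ?g L') = (f L - f L') - (hact e (tr i) f L - hact e (tr i) f L')"
      by (simp only: right_diff_distrib spec(1)) simp
    also have "\<dots> = char_poly B a * (r - s)" unfolding r s by (simp only: right_diff_distrib)
    finally have "root i * (?g L - ?g L') = (\<Sum>j\<le>num B. pconst (of_int (a j)) * pvar j) * (r - s)"
      by (simp only: char_poly_eq)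
    moreover have "?g L - ?g L' \<in> RT" using spec(2) by blast
    moreover have "(\<exists>j\<le>num B. j \<noteq> i \<and> j \<noteq> Suc i \<and> complex_of_int (a j) \<noteq> 0)
        \<or> complex_of_int (a i) + complex_of_int (a (Suc i)) \<noteq> 0 \<or> (\<forall>j\<le>num B. complex_of_int (a j) = 0)"
      using True by (auto simp flip: of_int_add)
    ultimately show ?thesis
      unfolding char_poly_eq using linear_form_dvd_cancel[of i "num B" "\<lambda>j. of_int (a j)"] i
      by (simp add: twin_def)
  next
    case False
    then have par: "\<And>j. j \<le> num B \<Longrightarrow> j \<noteq> i \<Longrightarrow> j \<noteq> Suc i \<Longrightarrow> a j = 0" "a i + a (Suc i) = 0" by auto
    consider "L' = L" | "L' = pact (tr i) L" using parallel_edge[OF i E a par cl L] by blast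
    then show ?thesis
    proof cases
      case 1
      then show ?thesis by (intro bexI[of _ 0]) auto
    next
      case 2
      let ?k = "pconst (of_int (a (Suc i)))"
      have cp: "char_poly B a = ?k * root i" using par by (rule char_poly_parallel[OF i])
      have r': "f L - f L' = ?k * root i * r" using r(2) cp by simp
      obtain s where s: "s \<in> RT" "r - pp (tr i) r = root i * s"
        using root_dvd_diff[OF r(1), of i] i by (auto simp: twin_def)
      \<comment> \<open>As \<open>L\<close> and \<open>L'\<close> are exchanged by
        \<open>tr i\<close>, the subtracted terms reappear with a plus sign. Since
        \<open>tr i\<close> negates \<open>root i\<close>, the sum is \<open>root i\<close> times a
        multiple of \<open>r - pp (tr i) r\<close>, and this difference supplies the second factor
        \<open>root i\<close>.\<close>
      have "root i * (?g L - ?g L') = (f L - f L') + pp (tr i) (f L - f L')"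
        using L 2 pact_tr_tr[OF i L(1)]
        by (simp only: right_diff_distrib spec(1)) (simp add: hact_D pp_simps)
      also have "\<dots> = root i * (?k * (r - pp (tr i) r))"
        unfolding r' pp_simps(3,5) pp_tr_root by (simp add: algebra_simps)
      finally have "?g L - ?g L' = ?k * (r - pp (tr i) r)"
        using root_nonzero[of i] by (metis mult_left_cancel)
      also have "\<dots> = char_poly B a * s" by (simp add: s(2) cp)
      finally show ?thesis using s(1) by blast
    qed
  qed
qed (use demazure_HT_spec[OF i f] in auto)

lemma demazure_HT_deg:
  assumes i: "twin i" and f: "f \<in> Hdeg e q"
  shows "DH e i f \<in> Hdeg e (q - 2)"
proof -
  have f': "f \<in> H e" "\<And>L. f L \<in> homog q" using f by (auto simp: HT_deg_def)
  have "DH e i f L \<in> homog (q - 2)" for L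
  proof (rule homog_cancel)
    show "root i \<in> homog 2" by (intro homog_diff homog_pvar)
    have "hact e (tr i) f L \<in> homog q" using f'(2) by (simp add: hact_def pp_homog)
    then show "root i * DH e i f L \<in> homog q"
      unfolding demazure_HT_spec(1)[OF i f'(1)] using f'(2) by blast
  qed simp
  then show ?thesis using demazure_HT_HT[OF i f'(1)] by (simp add: HT_deg_def)
qed

lemma demazure_spec:
  assumes i: "twin i" and p: "p \<in> polys {1..num B}"
  shows "root i * demazure (num B) i p = p - pp (tr i) p" "demazure (num B) i p \<in> polys {1..num B}"
proof -
  obtain r where r: "r \<in> polys {1..num B}" "p - pp (tr i) p = root i * r"
    using root_dvd_diff[OF p, of i] i by (auto simp: twin_def)
  have "demazure (num B) i p = pquot (p - pp (tr i) p) (root i)"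
    using p perm_poly_eq_pp[OF perm_ok_transpose[OF i]] by (simp add: demazure_def)
  then have "demazure (num B) i p = r" unfolding r(2) by (simp add: pquot_eq)
  then show "root i * demazure (num B) i p = p - pp (tr i) p" "demazure (num B) i p \<in> polys {1..num B}"
    using r by simp_all
qed

end

section \<open>The homomorphism\<close>

lemma End_alg_simps:
  "\<phi> \<in> carrier (End_alg s V) \<longleftrightarrow> \<phi> \<in> extensional V \<and> lin_on s V V \<phi>"
  "\<phi> \<otimes>\<^bsub>End_alg s V\<^esub> \<psi> = compose V \<phi> \<psi>" "\<one>\<^bsub>End_alg s V\<^esub> = (\<lambda>x\<in>V. x)" "\<zero>\<^bsub>End_alg s V\<^esub> = (\<lambda>x\<in>V. 0)"
  "\<phi> \<oplus>\<^bsub>End_alg s V\<^esub> \<psi> = (\<lambda>x\<in>V. \<phi> x + \<psi> x)" "c \<odot>\<^bsub>End_alg s V\<^esub> \<phi> = (\<lambda>x\<in>V. s c (\<phi> x))"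
  by (simp_all add: End_alg_def)

lemma End_alg_closed:
  fixes s :: "complex \<Rightarrow> 'a \<Rightarrow> 'a::ab_group_add"
  assumes add: "\<And>x y. x \<in> V \<Longrightarrow> y \<in> V \<Longrightarrow> x + y \<in> V" and scale: "\<And>c x. x \<in> V \<Longrightarrow> s c x \<in> V"
    and distr: "\<And>c x y. s c (x + y) = s c x + s c y" and comm: "\<And>c c' x. s c (s c' x) = s c' (s c x)"
  shows "\<one>\<^bsub>End_alg s V\<^esub> \<in> carrier (End_alg s V)"
    and "\<phi> \<in> carrier (End_alg s V) \<Longrightarrow> \<psi> \<in> carrier (End_alg s V) \<Longrightarrow> \<phi> \<otimes>\<^bsub>End_alg s V\<^esub> \<psi> \<in> carrier (End_alg s V)"
    and "\<phi> \<in> carrier (End_alg s V) \<Longrightarrow> \<psi> \<in> carrier (End_alg s V) \<Longrightarrow> \<phi> \<oplus>\<^bsub>End_alg s V\<^esub> \<psi> \<in> carrier (End_alg s V)"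
    and "\<phi> \<in> carrier (End_alg s V) \<Longrightarrow> c \<odot>\<^bsub>End_alg s V\<^esub> \<phi> \<in> carrier (End_alg s V)"
  unfolding End_alg_simps lin_on_def
  by (auto simp: compose_def Pi_iff add scale distr comm)

context seg_rep
begin

abbreviation "polyring \<equiv> polys {1..num B}"

lemma carrier_End_HT:
  "y \<in> carrier (EndH e) \<longleftrightarrow> y \<in> extensional (H e) \<and> lin_on (\<lambda>c f L. pconst c * f L) (H e) (H e) y"
  by (simp add: End_HT_def End_alg_simps)

lemma End_HT_simps:
  "y \<otimes>\<^bsub>EndH e\<^esub> y' = compose (H e) y y'" "\<one>\<^bsub>EndH e\<^esub> = (\<lambda>f\<in>H e. f)"
  "y \<oplus>\<^bsub>EndH e\<^esub> y' = (\<lambda>f\<in>H e. y f + y' f)" "c \<odot>\<^bsub>EndH e\<^esub> y = (\<lambda>f\<in>H e. \<lambda>L. pconst c * y f L)"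
  by (simp_all add: End_HT_def End_alg_simps)

lemma End_HT_closed:
  "\<one>\<^bsub>EndH e\<^esub> \<in> carrier (EndH e)"
  "y \<in> carrier (EndH e) \<Longrightarrow> y' \<in> carrier (EndH e) \<Longrightarrow> y \<otimes>\<^bsub>EndH e\<^esub> y' \<in> carrier (EndH e)"
  "y \<in> carrier (EndH e) \<Longrightarrow> y' \<in> carrier (EndH e) \<Longrightarrow> y \<oplus>\<^bsub>EndH e\<^esub> y' \<in> carrier (EndH e)"
  "y \<in> carrier (EndH e) \<Longrightarrow> c \<odot>\<^bsub>EndH e\<^esub> y \<in> carrier (EndH e)"
proof -
  note closed = End_alg_closed[of "H e" "\<lambda>c f L. pconst c * f L", OF HT_add HT_scale]
  have distr: "(\<lambda>L. pconst c * (f + g) L) = (\<lambda>L. pconst c * f L) + (\<lambda>L. pconst c * g L)"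
    for c and f g :: "(nat \<Rightarrow> 'v set) \<Rightarrow> cpoly"
    by (simp add: fun_eq_iff distrib_left)
  have comm: "(\<lambda>L. pconst c * (pconst c' * f L)) = (\<lambda>L. pconst c' * (pconst c * f L))"
    for c c' and f :: "(nat \<Rightarrow> 'v set) \<Rightarrow> cpoly"
    by (simp only: mult.left_commute)
  show "\<one>\<^bsub>EndH e\<^esub> \<in> carrier (EndH e)"
    "y \<in> carrier (EndH e) \<Longrightarrow> y' \<in> carrier (EndH e) \<Longrightarrow> y \<otimes>\<^bsub>EndH e\<^esub> y' \<in> carrier (EndH e)"
    "y \<in> carrier (EndH e) \<Longrightarrow> y' \<in> carrier (EndH e) \<Longrightarrow> y \<oplus>\<^bsub>EndH e\<^esub> y' \<in> carrier (EndH e)"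
    "y \<in> carrier (EndH e) \<Longrightarrow> c \<odot>\<^bsub>EndH e\<^esub> y \<in> carrier (EndH e)"
    unfolding End_HT_def using closed distr comm by blast+
qed

text \<open>Linearity is checked after multiplication by \<open>root i\<close>, where the operator
  becomes a difference of linear maps.\<close>

lemma demazure_HT_carrier:
  assumes i: "twin i" shows "DH e i \<in> carrier (EndH e)"
proof -
  note spec = demazure_HT_spec(1)[OF i]
  have eqI: "DH e i f L = r" if "f \<in> H e" "root i * r = f L - hact e (tr i) f L" for f L r
    using spec[OF that(1), of L] that(2) root_nonzero[of i] by (metis mult_left_cancel)
  have "DH e i (f + g) = DH e i f + DH e i g"
    if f: "f \<in> H e" and g: "g \<in> H e" for f g
  proof
    fix L
    have "root i * (DH e i f + DH e i g) L = (f + g) L - hact e (tr i) (f + g) L"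
      using spec[OF f, of L] spec[OF g, of L] by (simp only: plus_fun_apply distrib_left) (simp add: hact_def pp_simps)
    then show "DH e i (f + g) L = (DH e i f + DH e i g) L"
      by (rule eqI[OF HT_add[OF f g]])
  qed
  moreover have "DH e i (\<lambda>L. pconst c * f L) = (\<lambda>L. pconst c * DH e i f L)"
    if f: "f \<in> H e" for f c
  proof
    fix L
    have "root i * (pconst c * DH e i f L) = pconst c * (f L - hact e (tr i) f L)"
      using spec[OF f, of L] by (simp only: mult.left_commute)
    also have "\<dots> = pconst c * f L - hact e (tr i) (\<lambda>L. pconst c * f L) L"
      by (simp add: hact_def pp_simps right_diff_distrib)
    finally show "DH e i (\<lambda>L. pconst c * f L) L = pconst c * DH e i f L"
      by (rule eqI[OF HT_scale[OF f]])
  qed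
  moreover have "DH e i \<in> extensional (H e)" by (simp add: demazure_HT_def)
  ultimately show ?thesis
    unfolding carrier_End_HT lin_on_def using demazure_HT_HT[OF i] by blast
qed

section \<open>Independence of permutations over the polynomials\<close>

lemma perm_ok_cancel: "perm_ok w \<Longrightarrow> pinv w \<circ> (w \<circ> u) = u" "perm_ok w \<Longrightarrow> w \<circ> (pinv w \<circ> u) = u"
  by (simp_all add: fun_eq_iff)

abbreviation "perms \<equiv> Collect perm_ok"

lemma finite_perm_ok: "finite (perms)"
  by (rule finite_subset[OF _ finite_permutations[of "{1..num B}"]]) (auto simp: perm_ok_def)

text \<open>Lagrange interpolation at the values \<open>w(\<theta>)\<close> of a polynomial \<open>\<theta>\<close> with trivial stabiliser shows
  that distinct permutations are linearly independent over the polynomials.\<close>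

lemma perm_independent:
  assumes z: "\<And>p. p \<in> polyring \<Longrightarrow> (\<Sum>w\<in>perms. a w * pp w p) = 0" and u: "perm_ok u"
  shows "a u = 0"
proof -
  let ?G = "perms"
  \<comment> \<open>The coefficients are pairwise distinct, so a permutation can be read off from
    the image of \<open>\<theta>\<close>.\<close>
  define \<theta> :: cpoly where "\<theta> = (\<Sum>j\<in>{1..num B}. pconst (of_nat j) * pvar j)"
  have \<theta>: "\<theta> \<in> polyring" unfolding \<theta>_def by (intro polys_sum polys_mult) auto
  have pp\<theta>: "pp w \<theta> = (\<Sum>j\<in>{1..num B}. pconst (of_nat (pinv w j)) * pvar j)" if w: "perm_ok w" for w
    using sum.permute[OF perm_ok_permutes[OF w], of "\<lambda>j. pconst (of_nat (pinv w j)) * pvar j"] w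
    by (simp add: \<theta>_def pp_simps comp_def)
  have inj: "w = w'" if w: "perm_ok w" "perm_ok w'" and eq: "pp w \<theta> = pp w' \<theta>" for w w'
  proof -
    have "pinv w j = pinv w' j" for j
    proof (cases "j \<in> {1..num B}")
      case True
      then have "(of_nat (pinv w j) :: complex) = of_nat (pinv w' j)"
        using arg_cong[OF eq, of "\<lambda>p. lookup p (Poly_Mapping.single j 1)"]
        unfolding pp\<theta>[OF w(1)] pp\<theta>[OF w(2)] by (subst (asm) (1 2) lookup_linear_form) auto
      then show ?thesis by (simp only: of_nat_eq_iff)
    next
      case False
      then show ?thesis
        using permutes_not_in[OF perm_ok_permutes[OF perm_ok_inv]] w by metis
    qed
    then have "pinv (pinv w) = pinv (pinv w')" by presburger
    then show ?thesis using w by (simp add: perm_ok_inv_inv)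
  qed
  \<comment> \<open>Powers of \<open>\<theta>\<close> give the case of the empty \<open>S\<close>. A
    further factor \<open>pp w \<theta> - pp v \<theta>\<close> yields the sum for the exponent
    \<open>Suc k\<close> minus a multiple of the sum for \<open>k\<close>, hence the induction for
    arbitrary \<open>k\<close>.\<close>
  have vanish: "(\<Sum>w\<in>?G. a w * (pp w \<theta> ^ k * (\<Prod>v\<in>S. pp w \<theta> - pp v \<theta>))) = 0" if "finite S" for S k
    using that
  proof (induction S arbitrary: k)
    case empty
    show ?case using z[OF polys_power[OF \<theta>], of k] by (simp add: pp_simps)
  next
    case (insert v S)
    have "(\<Sum>w\<in>?G. a w * (pp w \<theta> ^ k * (\<Prod>v\<in>insert v S. pp w \<theta> - pp v \<theta>)))
        = (\<Sum>w\<in>?G. a w * (pp w \<theta> ^ Suc k * (\<Prod>v\<in>S. pp w \<theta> - pp v \<theta>))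
            - pp v \<theta> * (a w * (pp w \<theta> ^ k * (\<Prod>v\<in>S. pp w \<theta> - pp v \<theta>))))"
      using insert by (intro sum.cong refl) (simp add: algebra_simps)
    also have "\<dots> = 0"
      unfolding sum_subtractf sum_distrib_left[symmetric] insert.IH by simp
    finally show ?case .
  qed
  define c where "c = (\<Prod>v\<in>?G - {u}. pp u \<theta> - pp v \<theta>)"
  have "c \<noteq> 0" unfolding c_def using inj u finite_perm_ok by (auto simp: prod_zero_iff)
  \<comment> \<open>With the factors of all permutations other than \<open>u\<close>, only the term
    of \<open>u\<close> survives.\<close>
  have "(\<Sum>w\<in>?G. a w * (pp w \<theta> ^ 0 * (\<Prod>v\<in>?G - {u}. pp w \<theta> - pp v \<theta>))) = (\<Sum>w\<in>?G. if w = u then a u * c else 0)"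
  proof (rule sum.cong[OF refl])
    fix w assume w: "w \<in> ?G"
    show "a w * (pp w \<theta> ^ 0 * (\<Prod>v\<in>?G - {u}. pp w \<theta> - pp v \<theta>)) = (if w = u then a u * c else 0)"
    proof (cases "w = u")
      case True
      then show ?thesis by (simp add: c_def)
    next
      case False
      then have "(\<Prod>v\<in>?G - {u}. pp w \<theta> - pp v \<theta>) = 0"
        using w finite_perm_ok by (intro prod_zero) auto
      then show ?thesis using False by simp
    qed
  qed
  then have "a u * c = 0" using vanish[of "?G - {u}" 0] u finite_perm_ok by simp
  then show ?thesis using \<open>c \<noteq> 0\<close> by simp
qed

text \<open>\<open>x\<close> and \<open>y\<close> are both given by \<open>\<Sum>\<^sub>w (a w / q) w\<close> with \<open>q\<close> invariant; by independence, the
  coefficients, and hence \<open>y\<close>, are determined by \<open>x\<close>.\<close>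

definition coeffs_of :: "(nat \<Rightarrow> nat) \<Rightarrow> (cpoly \<Rightarrow> cpoly) \<Rightarrow>
    (((nat \<Rightarrow> 'v set) \<Rightarrow> cpoly) \<Rightarrow> (nat \<Rightarrow> 'v set) \<Rightarrow> cpoly) \<Rightarrow> cpoly \<Rightarrow> ((nat \<Rightarrow> nat) \<Rightarrow> cpoly) \<Rightarrow> bool" where
  "coeffs_of e x y q a \<longleftrightarrow> x ` polyring \<subseteq> polyring \<and> y \<in> carrier (EndH e)
     \<and> q \<noteq> 0 \<and> (\<forall>w. perm_ok w \<longrightarrow> pp w q = q)
     \<and> (\<forall>p\<in>polyring. q * x p = (\<Sum>w\<in>perms. a w * pp w p))
     \<and> (\<forall>f\<in>H e. \<forall>L. q * y f L = (\<Sum>w\<in>perms. a w * hact e w f L))"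

definition compatible :: "(nat \<Rightarrow> nat) \<Rightarrow> (cpoly \<Rightarrow> cpoly) \<Rightarrow>
    (((nat \<Rightarrow> 'v set) \<Rightarrow> cpoly) \<Rightarrow> (nat \<Rightarrow> 'v set) \<Rightarrow> cpoly) \<Rightarrow> bool" where
  "compatible e x y \<longleftrightarrow> (\<exists>q a. coeffs_of e x y q a)"

lemma compatibleI:
  assumes "\<And>p. p \<in> polyring \<Longrightarrow> x p \<in> polyring" "y \<in> carrier (EndH e)"
    "q \<noteq> 0" "\<And>w. perm_ok w \<Longrightarrow> pp w q = q"
    "\<And>p. p \<in> polyring \<Longrightarrow> q * x p = (\<Sum>w\<in>perms. a w * pp w p)"
    "\<And>f L. f \<in> H e \<Longrightarrow> q * y f L = (\<Sum>w\<in>perms. a w * hact e w f L)"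
  shows "compatible e x y"
  unfolding compatible_def coeffs_of_def by (intro exI[of _ q] exI[of _ a]) (use assms in auto)

lemma coeffs_ofD:
  assumes "coeffs_of e x y q a"
  shows "p \<in> polyring \<Longrightarrow> x p \<in> polyring" "y \<in> carrier (EndH e)"
    "q \<noteq> 0" "perm_ok w \<Longrightarrow> pp w q = q"
    "p \<in> polyring \<Longrightarrow> q * x p = (\<Sum>w\<in>perms. a w * pp w p)"
    "f \<in> H e \<Longrightarrow> q * y f L = (\<Sum>w\<in>perms. a w * hact e w f L)"
  using assms unfolding coeffs_of_def by blast+

lemma compatible_unique:
  assumes 1: "compatible e x y" and 2: "compatible e x y'"
  shows "y = y'"
proof -
  obtain q a where "coeffs_of e x y q a" using 1 unfolding compatible_def by blast
  note q = coeffs_ofD[OF this]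
  obtain q' b where "coeffs_of e x y' q' b" using 2 unfolding compatible_def by blast
  note q' = coeffs_ofD[OF this]
  have "(\<Sum>w\<in>perms. (q' * a w - q * b w) * pp w p) = 0" if p: "p \<in> polyring" for p
  proof -
    \<comment> \<open>The two expressions for the same \<open>x\<close> are brought to the common
      denominator \<open>q * q'\<close>.\<close>
    have "(\<Sum>w\<in>perms. (q' * a w - q * b w) * pp w p) = q' * (q * x p) - q * (q' * x p)"
      unfolding q(5)[OF p] q'(5)[OF p] by (simp add: sum_subtractf sum_distrib_left algebra_simps)
    then show ?thesis by (simp add: mult.left_commute)
  qed
  then have "q' * a w - q * b w = 0" if "perm_ok w" for w
    using that by (rule perm_independent)
  then have ab: "q' * a w = q * b w" if "perm_ok w" for w using that by simp
  have "y f L = y' f L" if f: "f \<in> H e" for f L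
  proof -
    have "(q' * q) * y f L = (\<Sum>w\<in>perms. (q' * a w) * hact e w f L)"
      by (simp add: mult.assoc q(6)[OF f] sum_distrib_left)
    also have "\<dots> = (\<Sum>w\<in>perms. (q * b w) * hact e w f L)"
      by (rule sum.cong) (auto simp: ab)
    also have "\<dots> = (q' * q) * y' f L"
      using q'(6)[OF f, of L] by (simp add: sum_distrib_left mult.assoc mult.left_commute[of q' q])
    finally show ?thesis using q(3) q'(3) by simp
  qed
  then show ?thesis
    using q(2) q'(2) unfolding carrier_End_HT by (intro extensionalityI[of y "H e"]) auto
qed

section \<open>Generators and algebra operations in terms of coefficients\<close>

lemma hact_id:
  assumes f: "f \<in> H e" shows "hact e id f L = f L"
proof (cases "L \<in> Fix e")
  case True
  then show ?thesis using pact_id[OF graded_Gr[OF fixed_pointsD(1)[OF True]]] by (simp add: hact_def inv_id)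
next
  case False
  then show ?thesis using HT_D(1)[OF f] by (simp add: hact_def)
qed

lemma compatible_one: "compatible e (\<lambda>p\<in>polyring. p) \<one>\<^bsub>EndH e\<^esub>"
proof (rule compatibleI[where q = 1 and a = "\<lambda>w. if w = id then 1 else 0"])
  have *: "(\<Sum>w\<in>perms. (if w = id then 1 else 0) * g w) = g id" for g :: "(nat \<Rightarrow> nat) \<Rightarrow> cpoly"
    using finite_perm_ok by (simp add: if_distrib[of "\<lambda>x. x * _"] cong: if_cong)
  show "1 * (\<lambda>p\<in>polyring. p) p = (\<Sum>w\<in>perms. (if w = id then 1 else 0) * pp w p)" if "p \<in> polyring" for p
    unfolding * using that by simp
  show "1 * \<one>\<^bsub>EndH e\<^esub> f L = (\<Sum>w\<in>perms. (if w = id then 1 else 0) * hact e w f L)" if "f \<in> H e" for f L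
    unfolding * using that by (simp add: hact_id End_HT_simps)
  show "pp w 1 = 1" for w using pp_simps(5)[of w 1] by simp
qed (auto simp: End_HT_closed)

text \<open>The natural denominator \<open>root i\<close> is not invariant. It is replaced by its
  norm, the product of its images under all permutations, and \<open>N\<close> is the cofactor that
  the numerator receives in exchange.\<close>

lemma compatible_demazure:
  assumes i: "twin i" shows "compatible e (demazure (num B) i) (DH e i)"
proof -
  let ?G = "perms"
  define N where "N = (\<Prod>w\<in>?G - {id}. pp w (root i))"
  have norm: "(\<Prod>w\<in>?G. pp w (root i)) = root i * N"
    unfolding N_def using prod.remove[OF finite_perm_ok, of id "\<lambda>w. pp w (root i)"] by simp
  have pp0: "pp w (root i) \<noteq> 0" if "perm_ok w" for w
    using inj_eq[OF permutes_inj[OF perm_ok_permutes[OF that]], of "Suc i" i] by (simp add: pp_simps)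
  have nz: "root i * N \<noteq> 0"
    unfolding norm[symmetric] using pp0 finite_perm_ok by (auto simp: prod_zero_iff)
  \<comment> \<open>Left multiplication by \<open>u\<close> permutes the factors of the
    norm.\<close>
  have inv: "pp u (root i * N) = root i * N" if u: "perm_ok u" for u
  proof -
    have "pp u (\<Prod>w\<in>?G. pp w (root i)) = (\<Prod>w\<in>?G. pp (u \<circ> w) (root i))"
      by (simp only: pp_simps(9) pp_comp)
    also have "\<dots> = (\<Prod>w\<in>?G. pp w (root i))"
      by (rule prod.reindex_bij_witness[of _ "\<lambda>w. pinv u \<circ> w" "\<lambda>w. u \<circ> w"])
        (simp_all add: u perm_ok_comp perm_ok_inv perm_ok_cancel)
    finally show ?thesis unfolding norm .
  qed
  have tr: "tr i \<noteq> id" by (metis id_apply n_not_Suc_n transpose_apply_first)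
  have *: "(\<Sum>w\<in>?G. (if w = id then N else if w = tr i then - N else 0) * g w) = N * (g id - g (tr i))"
    for g :: "(nat \<Rightarrow> nat) \<Rightarrow> cpoly"
  proof -
    have "(\<Sum>w\<in>?G. (if w = id then N else if w = tr i then - N else 0) * g w)
        = (\<Sum>w\<in>{id, tr i}. (if w = id then N else if w = tr i then - N else 0) * g w)"
      using finite_perm_ok perm_ok_transpose[OF i] by (intro sum.mono_neutral_right) auto
    also have "\<dots> = N * (g id - g (tr i))" using tr tr[symmetric] by (simp add: algebra_simps)
    finally show ?thesis .
  qed
  show ?thesis
  proof (rule compatibleI[where q = "root i * N" and a = "\<lambda>w. if w = id then N else if w = tr i then - N else 0"])
    fix p assume p: "p \<in> polyring"
    show "demazure (num B) i p \<in> polyring" using demazure_spec(2)[OF i p] .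
    show "root i * N * demazure (num B) i p = (\<Sum>w\<in>?G. (if w = id then N else if w = tr i then - N else 0) * pp w p)"
      unfolding * using demazure_spec(1)[OF i p] by (simp only: pp_id mult.assoc mult.left_commute[of "root i"])
  next
    fix f L assume f: "f \<in> H e"
    show "root i * N * DH e i f L
        = (\<Sum>w\<in>?G. (if w = id then N else if w = tr i then - N else 0) * hact e w f L)"
      unfolding * hact_id[OF f] using demazure_HT_spec(1)[OF i f, of L]
      by (simp only: mult.assoc mult.left_commute[of "root i"])
  qed (use nz inv demazure_HT_carrier[OF i] in auto)
qed

lemma compatible_add:
  assumes 1: "compatible e x y" and 2: "compatible e x' y'"
  shows "compatible e (\<lambda>p\<in>polyring. x p + x' p) (y \<oplus>\<^bsub>EndH e\<^esub> y')"
proof -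
  obtain q a where "coeffs_of e x y q a" using 1 unfolding compatible_def by blast
  note q = coeffs_ofD[OF this]
  obtain q' b where "coeffs_of e x' y' q' b" using 2 unfolding compatible_def by blast
  note q' = coeffs_ofD[OF this]
  have *: "q * q' * (r + r') = (\<Sum>w\<in>perms. (q' * a w + q * b w) * g w)"
    if "q * r = (\<Sum>w\<in>perms. a w * g w)" "q' * r' = (\<Sum>w\<in>perms. b w * g w)" for r r' g
  proof -
    have "q * q' * (r + r') = q' * (q * r) + q * (q' * r')" by (simp add: algebra_simps)
    also have "\<dots> = (\<Sum>w\<in>perms. (q' * a w + q * b w) * g w)"
      unfolding that by (simp add: sum_distrib_left sum.distrib algebra_simps)
    finally show ?thesis .
  qed
  show ?thesis
  proof (rule compatibleI[where q = "q * q'" and a = "\<lambda>w. q' * a w + q * b w"])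
    show "q * q' * (\<lambda>p\<in>polyring. x p + x' p) p = (\<Sum>w\<in>perms. (q' * a w + q * b w) * pp w p)"
      if "p \<in> polyring" for p using *[OF q(5)[OF that] q'(5)[OF that]] that by simp
    show "q * q' * (y \<oplus>\<^bsub>EndH e\<^esub> y') f L = (\<Sum>w\<in>perms. (q' * a w + q * b w) * hact e w f L)"
      if "f \<in> H e" for f L using *[OF q(6)[OF that] q'(6)[OF that]] that by (simp add: End_HT_simps)
  qed (use q q' in \<open>auto simp: End_HT_closed pp_simps\<close>)
qed

lemma compatible_smult:
  assumes "compatible e x y"
  shows "compatible e (\<lambda>p\<in>polyring. pconst c * x p) (c \<odot>\<^bsub>EndH e\<^esub> y)"
proof -
  obtain q a where "coeffs_of e x y q a" using assms unfolding compatible_def by blast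
  note q = coeffs_ofD[OF this]
  have *: "q * (pconst c * r) = (\<Sum>w\<in>perms. (pconst c * a w) * g w)"
    if "q * r = (\<Sum>w\<in>perms. a w * g w)" for r g
  proof -
    have "q * (pconst c * r) = pconst c * (q * r)" by (rule mult.left_commute)
    then show ?thesis unfolding that by (simp add: sum_distrib_left mult.assoc)
  qed
  show ?thesis
  proof (rule compatibleI[where q = q and a = "\<lambda>w. pconst c * a w"])
    show "q * (\<lambda>p\<in>polyring. pconst c * x p) p = (\<Sum>w\<in>perms. (pconst c * a w) * pp w p)"
      if "p \<in> polyring" for p using *[OF q(5)[OF that]] that by simp
    show "q * (c \<odot>\<^bsub>EndH e\<^esub> y) f L = (\<Sum>w\<in>perms. (pconst c * a w) * hact e w f L)"
      if "f \<in> H e" for f L using *[OF q(6)[OF that]] that by (simp add: End_HT_simps)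
  qed (use q in \<open>auto simp: End_HT_closed\<close>)
qed

lemma hact_hact:
  assumes w: "perm_ok w" and u: "perm_ok u" and L: "L \<in> Fix e"
  shows "hact e (w \<circ> u) f L = pp w (hact e u f (pact (pinv w) L))"
proof -
  have "bij w" "bij u" using w u permutes_bij perm_ok_permutes by blast+
  then have "pinv (w \<circ> u) = pinv u \<circ> pinv w" by (rule o_inv_distrib)
  then show ?thesis
    using pact_fixed_points[OF perm_ok_inv[OF w] L] L
      pact_pact[OF perm_ok_inv[OF u] perm_ok_inv[OF w] graded_Gr[OF fixed_pointsD(1)[OF L]]]
    by (simp add: hact_D pp_comp)
qed

text \<open>The product in the twisted group algebra, where moving a coefficient past
  \<open>w\<close> applies \<open>pp w\<close> to it. \<open>T\<close> stands for the values
  \<open>pp v p\<close> as well as \<open>hact e v f L\<close>, so both sides of a pair obtain the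
  same coefficients.\<close>

lemma convolution:
  fixes T :: "(nat \<Rightarrow> nat) \<Rightarrow> cpoly"
  shows "(\<Sum>w\<in>perms. \<Sum>u\<in>perms. a w * (pp w (b u) * T (w \<circ> u)))
    = (\<Sum>v\<in>perms. (\<Sum>w\<in>perms. a w * pp w (b (pinv w \<circ> v))) * T v)"
proof -
  have "(\<Sum>u\<in>perms. a w * (pp w (b u) * T (w \<circ> u)))
      = (\<Sum>v\<in>perms. a w * pp w (b (pinv w \<circ> v)) * T v)" if w: "perm_ok w" for w
    by (rule sum.reindex_bij_witness[of _ "\<lambda>v. pinv w \<circ> v" "\<lambda>u. w \<circ> u"])
      (simp_all add: w perm_ok_comp perm_ok_inv perm_ok_cancel mult.assoc)
  then have "(\<Sum>w\<in>perms. \<Sum>u\<in>perms. a w * (pp w (b u) * T (w \<circ> u)))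
      = (\<Sum>w\<in>perms. \<Sum>v\<in>perms. a w * pp w (b (pinv w \<circ> v)) * T v)"
    by - (rule sum.cong[OF refl], simp)
  also have "\<dots> = (\<Sum>v\<in>perms. \<Sum>w\<in>perms. a w * pp w (b (pinv w \<circ> v)) * T v)"
    by (rule sum.swap)
  finally show ?thesis by (simp add: sum_distrib_right)
qed

lemma compatible_mult:
  assumes 1: "compatible e x y" and 2: "compatible e x' y'"
  shows "compatible e (compose polyring x x') (y \<otimes>\<^bsub>EndH e\<^esub> y')"
proof -
  let ?G = "perms"
  obtain q a where "coeffs_of e x y q a" using 1 unfolding compatible_def by blast
  note q = coeffs_ofD[OF this]
  obtain q' b where "coeffs_of e x' y' q' b" using 2 unfolding compatible_def by blast
  note q' = coeffs_ofD[OF this]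
  let ?c = "\<lambda>v. \<Sum>w\<in>?G. a w * pp w (b (pinv w \<circ> v))"
  \<comment> \<open>Here the invariance of the denominator is used: \<open>q'\<close> passes through
    \<open>w\<close>.\<close>
  have *: "q' * pp w r = (\<Sum>u\<in>?G. pp w (b u) * pp w (g u))" if "perm_ok w" "q' * r = (\<Sum>u\<in>?G. b u * g u)" for w r g
  proof -
    have "q' * pp w r = pp w (q' * r)" using q'(4)[OF that(1)] by (simp add: pp_simps)
    then show ?thesis unfolding that(2) by (simp add: pp_simps)
  qed
  show ?thesis
  proof (rule compatibleI[where q = "q * q'" and a = ?c])
    fix p assume p: "p \<in> polyring"
    have "q * q' * x (x' p) = q' * (q * x (x' p))" by (simp only: mult.assoc mult.left_commute)
    also have "\<dots> = (\<Sum>w\<in>?G. a w * (q' * pp w (x' p)))"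
      unfolding q(5)[OF q'(1)[OF p]] by (simp only: sum_distrib_left mult.left_commute)
    also have "\<dots> = (\<Sum>w\<in>?G. \<Sum>u\<in>?G. a w * (pp w (b u) * pp (w \<circ> u) p))"
      by (intro sum.cong refl) (simp add: *[OF _ q'(5)[OF p]] sum_distrib_left pp_comp)
    also have "\<dots> = (\<Sum>v\<in>?G. ?c v * pp v p)" by (rule convolution)
    finally show "q * q' * compose polyring x x' p = (\<Sum>v\<in>?G. ?c v * pp v p)"
      using p by (simp add: compose_def)
  next
    fix f L assume f: "f \<in> H e"
    have y'f: "y' f \<in> H e" using q'(2) f by (auto simp: carrier_End_HT lin_on_def)
    have "q * q' * y (y' f) L = q' * (q * y (y' f) L)" by (simp only: mult.assoc mult.left_commute)
    also have "\<dots> = (\<Sum>w\<in>?G. a w * (q' * hact e w (y' f) L))"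
      unfolding q(6)[OF y'f] by (simp only: sum_distrib_left mult.left_commute)
    also have "\<dots> = (\<Sum>w\<in>?G. \<Sum>u\<in>?G. a w * (pp w (b u) * hact e (w \<circ> u) f L))"
    proof (intro sum.cong refl)
      fix w assume w: "w \<in> ?G"
      show "a w * (q' * hact e w (y' f) L) = (\<Sum>u\<in>?G. a w * (pp w (b u) * hact e (w \<circ> u) f L))"
      proof (cases "L \<in> Fix e")
        case True
        have "q' * hact e w (y' f) L = (\<Sum>u\<in>?G. pp w (b u) * pp w (hact e u f (pact (pinv w) L)))"
          unfolding hact_D[OF True] using w by (intro * q'(6)[OF f]) simp
        also have "\<dots> = (\<Sum>u\<in>?G. pp w (b u) * hact e (w \<circ> u) f L)"
          using w True by (intro sum.cong refl) (simp add: hact_hact)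
        finally show ?thesis by (simp add: sum_distrib_left)
      next
        case False
        then show ?thesis by (simp add: hact_def)
      qed
    qed
    also have "\<dots> = (\<Sum>v\<in>?G. ?c v * hact e v f L)" by (rule convolution)
    finally show "q * q' * (y \<otimes>\<^bsub>EndH e\<^esub> y') f L = (\<Sum>v\<in>?G. ?c v * hact e v f L)"
      using f by (simp add: End_HT_simps compose_def)
  qed (use q q' in \<open>auto simp: End_HT_closed pp_simps compose_def\<close>)
qed

text \<open>An operator does not show how it was built from generators, so no recursion defines the
  homomorphism. It is introduced as a relation generated simultaneously on both sides; that it is a
  function follows from \<open>compatible_unique\<close>.\<close>

inductive paired :: "(nat \<Rightarrow> nat) \<Rightarrow> nat set \<Rightarrow> (cpoly \<Rightarrow> cpoly) \<Rightarrow>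
    (((nat \<Rightarrow> 'v set) \<Rightarrow> cpoly) \<Rightarrow> (nat \<Rightarrow> 'v set) \<Rightarrow> cpoly) \<Rightarrow> bool" for e I where
  gen: "i \<in> I \<Longrightarrow> paired e I (demazure (num B) i) (DH e i)"
| one: "paired e I \<one>\<^bsub>End_poly (num B)\<^esub> \<one>\<^bsub>EndH e\<^esub>"
| add: "paired e I x y \<Longrightarrow> paired e I x' y' \<Longrightarrow> paired e I (x \<oplus>\<^bsub>End_poly (num B)\<^esub> x') (y \<oplus>\<^bsub>EndH e\<^esub> y')"
| mult: "paired e I x y \<Longrightarrow> paired e I x' y' \<Longrightarrow> paired e I (x \<otimes>\<^bsub>End_poly (num B)\<^esub> x') (y \<otimes>\<^bsub>EndH e\<^esub> y')"
| smult: "paired e I x y \<Longrightarrow> paired e I (c \<odot>\<^bsub>End_poly (num B)\<^esub> x) (c \<odot>\<^bsub>EndH e\<^esub> y)"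

lemma paired_compatible:
  assumes "\<And>i. i \<in> I \<Longrightarrow> twin i" and "paired e I x y" shows "compatible e x y"
  using assms(2)
proof induction
  case (gen i)
  then show ?case by (intro compatible_demazure assms(1))
next
  case one
  then show ?case using compatible_one by (simp only: End_poly_def End_alg_simps)
next
  case (add x y x' y')
  then show ?case using compatible_add by (simp only: End_poly_def End_alg_simps)
next
  case (mult x y x' y')
  then show ?case using compatible_mult by (simp only: End_poly_def End_alg_simps)
next
  case (smult x y c)
  then show ?case using compatible_smult by (simp only: End_poly_def End_alg_simps)
qed

lemma paired_exists:
  "x \<in> gen_subalg (End_poly (num B)) (demazure (num B) ` I) \<Longrightarrow> \<exists>y. paired e I x y"
  by (induction rule: gen_subalg.induct) (auto intro: paired.intros)

section \<open>Degrees\<close>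

lemma HT_deg_add: "f \<in> Hdeg e q \<Longrightarrow> g \<in> Hdeg e q \<Longrightarrow> f + g \<in> Hdeg e q"
  by (auto simp: HT_deg_def HT_add)

lemma HT_deg_scale: "f \<in> Hdeg e q \<Longrightarrow> (\<lambda>L. pconst c * f L) \<in> Hdeg e q"
  using homog_mult[OF homog_pconst, of _ q c] by (auto simp: HT_deg_def HT_scale)

lemma HT_deg_HT: "f \<in> Hdeg e q \<Longrightarrow> f \<in> H e"
  by (simp add: HT_deg_def)

text \<open>Each letter of a word lowers the degree on cohomology by 2. The homogeneous partner
  found here is, by uniqueness, the value of the homomorphism.\<close>

lemma paired_gen_words:
  assumes I: "\<And>i. i \<in> I \<Longrightarrow> twin i"
  shows "x \<in> gen_words (End_poly (num B)) (demazure (num B) ` I) r \<Longrightarrow>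
    \<exists>y. paired e I x y \<and> homEnd e (- 2 * int r) y"
proof (induction r arbitrary: x)
  case 0
  have "homEnd e 0 \<one>\<^bsub>EndH e\<^esub>"
    by (auto simp: homogeneous_end_def End_HT_simps dest: HT_deg_HT)
  then show ?case using 0 paired.one by auto
next
  case (Suc r)
  then obtain i w where x: "x = demazure (num B) i \<otimes>\<^bsub>End_poly (num B)\<^esub> w" "i \<in> I"
    "w \<in> gen_words (End_poly (num B)) (demazure (num B) ` I) r" by auto
  obtain y where y: "paired e I w y" "homEnd e (- 2 * int r) y" using Suc.IH[OF x(3)] by blast
  have "homEnd e (- 2 * int (Suc r)) (DH e i \<otimes>\<^bsub>EndH e\<^esub> y)"
    unfolding homogeneous_end_def
  proof (intro allI ballI)
    fix q f assume f: "f \<in> Hdeg e q"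
    then have "y f \<in> Hdeg e (q - 2 * int r)" using y(2) by (auto simp: homogeneous_end_def)
    from demazure_HT_deg[OF I[OF x(2)] this]
    show "(DH e i \<otimes>\<^bsub>EndH e\<^esub> y) f \<in> Hdeg e (q + - 2 * int (Suc r))"
      using HT_deg_HT[OF f] by (simp add: End_HT_simps compose_def algebra_simps)
  qed
  then show ?case unfolding x(1) using paired.mult[OF paired.gen[OF x(2)] y(1)] by blast
qed

lemma paired_lin_span:
  assumes I: "\<And>i. i \<in> I \<Longrightarrow> twin i"
    and x: "x \<in> lin_span (End_poly (num B)) (\<Union>r\<in>{r. m = - 2 * int r}. gen_words (End_poly (num B)) (demazure (num B) ` I) r)"
  shows "\<exists>y. paired e I x y \<and> homEnd e m y"
  using x
proof induction
  case (base x)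
  then show ?case using paired_gen_words[OF I] by auto
next
  case zero
  \<comment> \<open>\<open>paired\<close> has no rule for zero, so zero is written as a multiple of
    one.\<close>
  have "\<zero>\<^bsub>End_poly (num B)\<^esub> = 0 \<odot>\<^bsub>End_poly (num B)\<^esub> \<one>\<^bsub>End_poly (num B)\<^esub>"
    by (auto simp: End_poly_def End_alg_simps fun_eq_iff)
  moreover have "homEnd e m (0 \<odot>\<^bsub>EndH e\<^esub> \<one>\<^bsub>EndH e\<^esub>)"
  proof -
    have "(\<lambda>L. 0) \<in> Hdeg e q" if "f \<in> H e" for f q
      using HT_scale[OF that, of 0] by (simp add: HT_deg_def)
    then show ?thesis by (auto simp: homogeneous_end_def End_HT_simps dest: HT_deg_HT)
  qed
  ultimately show ?case using paired.smult[OF paired.one, of e I 0] by metis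
next
  case (add x x')
  then obtain y y' where y: "paired e I x y" "homEnd e m y" "paired e I x' y'" "homEnd e m y'"
    by blast
  have "homEnd e m (y \<oplus>\<^bsub>EndH e\<^esub> y')"
    using y(2,4) by (auto simp: homogeneous_end_def End_HT_simps HT_deg_HT HT_deg_add)
  then show ?case using paired.add[OF y(1,3)] by blast
next
  case (smult x c)
  then obtain y where y: "paired e I x y" "homEnd e m y" by blast
  have "homEnd e m (c \<odot>\<^bsub>EndH e\<^esub> y)"
    using y(2) by (auto simp: homogeneous_end_def End_HT_simps HT_deg_HT HT_deg_scale)
  then show ?case using paired.smult[OF y(1)] by blast
qed

end

theorem theorem6p8:
  fixes M :: "'v::ab_group_add cyc_rep" and B :: "'v seg_basis"
    and ks :: "nat list" and e :: "nat \<Rightarrow> nat"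
  assumes "cyclic_rep M" and "nilpotent_rep M"
    and "segment_basis M B" and "numbered_by M B ks"
    and "Gr M e \<noteq> {}"
  shows "\<exists>\<rho>. \<rho> \<in> ring_hom (nil_Hecke (num B) ks) (End_HT M B e)
    \<and> (\<forall>c. \<forall>x\<in>carrier (nil_Hecke (num B) ks).
         \<rho> (c \<odot>\<^bsub>nil_Hecke (num B) ks\<^esub> x) = c \<odot>\<^bsub>End_HT M B e\<^esub> \<rho> x)
    \<and> (\<forall>m. \<forall>x\<in>nil_Hecke_deg (num B) ks m. homogeneous_end M B e m (\<rho> x))
    \<and> (\<forall>i\<in>simple_idx (num B) ks. \<rho> (demazure (num B) i) = demazure_HT M B e i)"
proof -
  interpret seg_rep M B using assms by unfold_locales
  let ?I = "simple_idx (num B) ks" and ?A = "End_poly (num B)" and ?E = "End_HT M B e"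
  have I: "twin i" if "i \<in> ?I" for i using assms(4) that by (rule simple_idx_twin)
  \<comment> \<open>Each algebraic property of \<open>\<rho>\<close> is now an introduction rule of
    \<open>paired\<close> combined with uniqueness of the partner.\<close>
  define \<rho> where "\<rho> = (\<lambda>x. THE y. paired e ?I x y)"
  have unique: "y = y'" if "paired e ?I x y" "paired e ?I x y'" for x y y'
    using I that by (intro compatible_unique[of e x] paired_compatible[of ?I])
  have \<rho>: "\<rho> x = y" if "paired e ?I x y" for x y
    unfolding \<rho>_def using that unique[OF _ that] by (rule the_equality)
  have paired: "paired e ?I x (\<rho> x)" if "x \<in> carrier (nil_Hecke (num B) ks)" for x
    using paired_exists[of x ?I e] that \<rho> by (auto simp: nil_Hecke_def)
  have ops: "x \<otimes>\<^bsub>nil_Hecke (num B) ks\<^esub> x' = x \<otimes>\<^bsub>?A\<^esub> x'" "x \<oplus>\<^bsub>nil_Hecke (num B) ks\<^esub> x' = x \<oplus>\<^bsub>?A\<^esub> x'"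
    "\<one>\<^bsub>nil_Hecke (num B) ks\<^esub> = \<one>\<^bsub>?A\<^esub>" "c \<odot>\<^bsub>nil_Hecke (num B) ks\<^esub> x = c \<odot>\<^bsub>?A\<^esub> x" for x x' c
    by (simp_all add: nil_Hecke_def)
  have "\<rho> \<in> ring_hom (nil_Hecke (num B) ks) ?E"
  proof (rule ring_hom_memI)
    fix x assume x: "x \<in> carrier (nil_Hecke (num B) ks)"
    show "\<rho> x \<in> carrier ?E"
      using paired_compatible[OF I paired[OF x]] by (auto simp: compatible_def dest: coeffs_ofD(2))
    fix x' assume x': "x' \<in> carrier (nil_Hecke (num B) ks)"
    show "\<rho> (x \<otimes>\<^bsub>nil_Hecke (num B) ks\<^esub> x') = \<rho> x \<otimes>\<^bsub>?E\<^esub> \<rho> x'"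
      unfolding ops by (rule \<rho>[OF paired.mult[OF paired[OF x] paired[OF x']]])
    show "\<rho> (x \<oplus>\<^bsub>nil_Hecke (num B) ks\<^esub> x') = \<rho> x \<oplus>\<^bsub>?E\<^esub> \<rho> x'"
      unfolding ops by (rule \<rho>[OF paired.add[OF paired[OF x] paired[OF x']]])
  next
    show "\<rho> \<one>\<^bsub>nil_Hecke (num B) ks\<^esub> = \<one>\<^bsub>?E\<^esub>"
      unfolding ops by (rule \<rho>[OF paired.one])
  qed
  moreover have "\<rho> (c \<odot>\<^bsub>nil_Hecke (num B) ks\<^esub> x) = c \<odot>\<^bsub>?E\<^esub> \<rho> x"
    if "x \<in> carrier (nil_Hecke (num B) ks)" for c x
    unfolding ops by (rule \<rho>[OF paired.smult[OF paired[OF that]]])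
  moreover have "homogeneous_end M B e m (\<rho> x)" if "x \<in> nil_Hecke_deg (num B) ks m" for m x
    using paired_lin_span[OF I, of ?I x m e] that \<rho> by (auto simp: nil_Hecke_deg_def)
  moreover have "\<rho> (demazure (num B) i) = demazure_HT M B e i" if "i \<in> ?I" for i
    by (rule \<rho>[OF paired.gen[OF that]])
  ultimately show ?thesis by blast
qed

end
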